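(* Assume that $h$ is Hölder continuous. Then the process $\widetilde S_h$ is locally self-similar; more precisely, as $\varepsilon\to0$ (with $\varepsilon>0$), the finite-dimensional distributions of the field $$\left\{\frac{\widetilde S_h(t+\varepsilon u)-\widetilde S_h(t)}{\varepsilon^{h(t)}}\right\}_{t,u\ge0}$$ converge to those of the centered Gaussian field $\mathcal{T}=\{\mathcal{T}(t,u)\}_{t,u\ge0}$ with covariance $$\mathbb{E}[\mathcal{T}(t,u)\mathcal{T}(s,v)]=\begin{cases}\dfrac{R(h(t),h(t))}{4h(t)^2-2h(t)}\left(|u|^{2h(t)}+|v|^{2h(t)}-|u-v|^{2h(t)}\right)&\text{if }t=s,\\[2mm]0&\text{if }t\ne s.\end{cases}$$ Moreover, for every $t\ge0$, as $\varepsilon\to0$, the process $\{(\widetilde S_h(t+\varepsilon u)-\widetilde S_h(t))/\varepsilon^{h(t)}\}_{u\ge0}$ converges in distribution, in the space of continuous functions of $u\in[0,\infty)$ endowed with the topology of uniform convergence on compact sets, to $\mathcal{T}(t,\cdot)$, which is a fractional Brownian motion with Hurst index $h(t)$ such that $\mathbb{E}[\mathcal{T}(t,1)^2]=R(h(t),h(t))/(2h(t)^2-h(t))$.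
   Context: Let $1/2<a\le b<1$, let $h:\mathbb{R}\to[a,b]$ be continuous, and let $R:[a,b]^2\to(0,\infty)$ be the continuous function associated with a centered Gaussian field $X=\{X_n(H):H\in(1/2,1),n\in\mathbb{N}\}$ satisfying: (i) for every $M>0$, the map $(j,k,H_1,H_2)\mapsto\mathbb{E}[X_j(H_1)X_k(H_2)]$ is bounded on $\{(j,k)\in\mathbb{N}^2:|j-k|\le M\}\times[a,b]^2$; (ii) $\lim_{j-k\to\infty}\sup_{(H_1,H_2)\in[a,b]^2}\left|(j-k)^{2-H_1-H_2}\mathbb{E}[X_j(H_1)X_k(H_2)]-R(H_1,H_2)\right|=0$. Put $\mathcal{R}(t,s;H_1,H_2)=R(H_1,H_2)\mathbf 1_{t\ge s}+R(H_2,H_1)\mathbf 1_{t<s}$. The process $\widetilde S_h=\{\widetilde S_h(t)\}_{t\ge0}$ is the limit, in the sense of finite-dimensional distributions as $N\to\infty$, of $S_h^N(t)=\sum_{n=1}^{\lfloor Nt\rfloor}N^{-h(n/N)}X_n(h(n/N))$; it is the centered Gaussian process with covariance $$\mathbb{E}[\widetilde S_h(t)\widetilde S_h(s)]=\int_0^t d\theta\int_0^s d\sigma\,\mathcal{R}(\theta,\sigma;h(\theta),h(\sigma))|\theta-\sigma|^{h(\theta)+h(\sigma)-2},\qquad t,s\ge0,$$ taken in a continuous modification. A fractional Brownian motion with Hurst index $H\in(0,1)$ is a centered Gaussian process $W_H$ with $\mathbb{E}[W_H(t)W_H(s)]=\frac{\mathbb{E}[W_H(1)^2]}{2}(|t|^{2H}+|s|^{2H}-|t-s|^{2H})$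 (the variance at time 1 need not be 1). *)

theory Defs
  imports "HOL-Probability.Probability"
begin

definition holder_continuous_on ::
    "'a::metric_space set \<Rightarrow> ('a \<Rightarrow> 'b::metric_space) \<Rightarrow> bool" where
  "holder_continuous_on A f \<longleftrightarrow>
     (\<exists>\<alpha> C. 0 < \<alpha> \<and> \<alpha> \<le> 1 \<and> 0 \<le> C \<and>
        (\<forall>x\<in>A. \<forall>y\<in>A. dist (f x) (f y) \<le> C * dist x y powr \<alpha>))"

text \<open>The first alternative is the degenerate Gaussian law with variance zero.\<close>

definition centered_gaussian_rv :: "'w measure \<Rightarrow> ('w \<Rightarrow> real) \<Rightarrow> bool" where
  "centered_gaussian_rv M Z \<longleftrightarrow>
     (Z \<in> borel_measurable M \<and> (AE \<omega> in M. Z \<omega> = 0)) \<or>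
     (\<exists>\<sigma>>0. distributed M lborel Z (normal_density 0 \<sigma>))"

definition centered_gaussian_family ::
    "'w measure \<Rightarrow> 'i set \<Rightarrow> ('i \<Rightarrow> 'w \<Rightarrow> real) \<Rightarrow> bool" where
  "centered_gaussian_family M I Y \<longleftrightarrow>
     (\<forall>J c. finite J \<and> J \<subseteq> I \<longrightarrow> centered_gaussian_rv M (\<lambda>\<omega>. \<Sum>i\<in>J. c i * Y i \<omega>))"

definition is_fBm :: "'w measure \<Rightarrow> real \<Rightarrow> (real \<Rightarrow> 'w \<Rightarrow> real) \<Rightarrow> bool" where
  "is_fBm M H W \<longleftrightarrow> 0 < H \<and> H < 1 \<and> centered_gaussian_family M {0..} W \<and>
     (\<forall>t\<ge>0. \<forall>s\<ge>0. (\<integral>\<omega>. W t \<omega> * W s \<omega> \<partial>M) =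
        (\<integral>\<omega>. (W 1 \<omega>)\<^sup>2 \<partial>M) / 2 *
          (\<bar>t\<bar> powr (2 * H) + \<bar>s\<bar> powr (2 * H) - \<bar>t - s\<bar> powr (2 * H)))"

definition is_modification ::
    "'w measure \<Rightarrow> 'i set \<Rightarrow> ('i \<Rightarrow> 'w \<Rightarrow> real) \<Rightarrow> ('i \<Rightarrow> 'w \<Rightarrow> real) \<Rightarrow> bool" where
  "is_modification M I W Y \<longleftrightarrow>
     (\<forall>i\<in>I. W i \<in> borel_measurable M \<and> (AE \<omega> in M. W i \<omega> = Y i \<omega>))"

definition borel_of :: "'x topology \<Rightarrow> 'x measure" where
  "borel_of T = sigma (topspace T) {U. openin T U}"

text \<open>The random elements \<^term>\<open>Y e\<close> live on \<^term>\<open>M\<close>, the limit \<^term>\<open>Z\<close> on \<^term>\<open>N\<close>.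
  Measurability is part of the definition: the Bochner integral of a non-measurable function
  is zero, so convergence of the integrals alone would say nothing.\<close>

definition converges_in_distribution ::
    "'x topology \<Rightarrow> 'w measure \<Rightarrow> ('e \<Rightarrow> 'w \<Rightarrow> 'x) \<Rightarrow> 'v measure \<Rightarrow> ('v \<Rightarrow> 'x) \<Rightarrow> 'e filter \<Rightarrow> bool"
    where
  "converges_in_distribution T M Y N Z F \<longleftrightarrow>
     (\<forall>\<^sub>F e in F. Y e \<in> measurable M (borel_of T)) \<and>
     Z \<in> measurable N (borel_of T) \<and>
     (\<forall>f :: 'x \<Rightarrow> real. continuous_map T euclideanreal f \<and> bounded (f ` topspace T) \<longrightarrow>
        ((\<lambda>e. \<integral>\<omega>. f (Y e \<omega>) \<partial>M) \<longlongrightarrow> (\<integral>\<omega>. f (Z \<omega>) \<partial>N)) F)"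

definition converges_fdd ::
    "'i set \<Rightarrow> 'w measure \<Rightarrow> ('e \<Rightarrow> 'i \<Rightarrow> 'w \<Rightarrow> real) \<Rightarrow> 'v measure \<Rightarrow> ('i \<Rightarrow> 'v \<Rightarrow> real) \<Rightarrow>
      'e filter \<Rightarrow> bool" where
  "converges_fdd I M Y N Z F \<longleftrightarrow>
     (\<forall>J. finite J \<and> J \<subseteq> I \<longrightarrow>
        converges_in_distribution (product_topology (\<lambda>_. euclideanreal) J)
          M (\<lambda>e \<omega>. \<lambda>i\<in>J. Y e i \<omega>) N (\<lambda>\<omega>. \<lambda>i\<in>J. Z i \<omega>) F)"

text \<open>Continuous functions on \<^term>\<open>A\<close> are represented as extensional functions (with value
  \<^const>\<open>undefined\<close> outside \<^term>\<open>A\<close>). On a compact set the pointwise strict inequality below is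
  the same as a strict bound on the supremum of the distance.\<close>

definition continuous_fun_space ::
    "'a::topological_space set \<Rightarrow> ('a \<Rightarrow> 'b::metric_space) set" where
  "continuous_fun_space A = {f \<in> extensional A. continuous_on A f}"

definition compact_convergence_topology ::
    "'a::topological_space set \<Rightarrow> ('a \<Rightarrow> 'b::metric_space) topology" where
  "compact_convergence_topology A = topology_generated_by
     {{g \<in> continuous_fun_space A. \<forall>x\<in>K. dist (g x) (f x) < e} | f K e.
        f \<in> continuous_fun_space A \<and> compact K \<and> K \<subseteq> A \<and> 0 < e}"

definition partial_sum_process ::
    "(nat \<Rightarrow> real \<Rightarrow> 'w \<Rightarrow> real) \<Rightarrow> (real \<Rightarrow> real) \<Rightarrow> nat \<Rightarrow> real \<Rightarrow> 'w \<Rightarrow> real" where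
  "partial_sum_process X h N t \<omega> =
     (\<Sum>n = 1..nat \<lfloor>real N * t\<rfloor>.
        real N powr (- h (real n / real N)) * X n (h (real n / real N)) \<omega>)"

definition symm_R ::
    "(real \<Rightarrow> real \<Rightarrow> real) \<Rightarrow> real \<Rightarrow> real \<Rightarrow> real \<Rightarrow> real \<Rightarrow> real" where
  "symm_R R t s H1 H2 = (if t \<ge> s then R H1 H2 else R H2 H1)"

definition limit_covariance ::
    "(real \<Rightarrow> real \<Rightarrow> real) \<Rightarrow> (real \<Rightarrow> real) \<Rightarrow> real \<Rightarrow> real \<Rightarrow> real" where
  "limit_covariance R h t s =
     (LBINT \<theta>:{0..t}. (LBINT \<sigma>:{0..s}.
        symm_R R \<theta> \<sigma> (h \<theta>) (h \<sigma>) * \<bar>\<theta> - \<sigma>\<bar> powr (h \<theta> + h \<sigma> - 2)))"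

definition tangent_covariance ::
    "(real \<Rightarrow> real \<Rightarrow> real) \<Rightarrow> (real \<Rightarrow> real) \<Rightarrow> real \<times> real \<Rightarrow> real \<times> real \<Rightarrow> real" where
  "tangent_covariance R h = (\<lambda>(t, u) (s, v).
     if t = s
     then R (h t) (h t) / (4 * (h t)\<^sup>2 - 2 * h t) *
            (\<bar>u\<bar> powr (2 * h t) + \<bar>v\<bar> powr (2 * h t) - \<bar>u - v\<bar> powr (2 * h t))
     else 0)"

definition rescaled_increment ::
    "(real \<Rightarrow> 'w \<Rightarrow> real) \<Rightarrow> (real \<Rightarrow> real) \<Rightarrow> real \<Rightarrow> real \<Rightarrow> real \<Rightarrow> 'w \<Rightarrow> real" where
  "rescaled_increment S h \<epsilon> t u \<omega> = (S (t + \<epsilon> * u) \<omega> - S t \<omega>) / \<epsilon> powr h t"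

end

theory Submission
  imports Defs
begin

text \<open>By Stone--Weierstrass, a bounded continuous function on a compact set of paths is approximated
  by trigonometric polynomials in finitely many values of the path. Hence a tight family of centered
  Gaussian processes converges in distribution as soon as the covariances converge, for vectors and
  for continuous paths alike.

  An increment of the limit process has as variance the integral of the covariance kernel over a
  square. Near \<^term>\<open>(t, t)\<close> the kernel is squeezed between multiples of
  \<^term>\<open>\<bar>\<theta> - \<sigma>\<bar> powr q\<close> with \<^term>\<open>q\<close> close to \<^term>\<open>2 * h t - 2\<close>, whose integral over a square is
  explicit; Hoelder continuity of \<^term>\<open>h\<close> makes the error of order \<^term>\<open>\<epsilon> powr \<alpha>\<close> in the exponent
  harmless. Polarization gives the covariances at a common \<^term>\<open>t\<close>; for different times the
  kernel is bounded and the covariance is of order \<^term>\<open>\<epsilon>\<^sup>2\<close>, which the normalization cannot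
  compensate. The same bounds give second moments of order \<^term>\<open>\<bar>u - v\<bar> powr (2 * a)\<close> with
  \<^term>\<open>2 * a > 1\<close>, so Kolmogorov's chaining argument works with second moments and yields both
  tightness and the continuous modification of the limit.\<close>

section \<open>Trigonometric polynomials and convergence in distribution\<close>

text \<open>On a compact set of large probability a test function is replaced by a trigonometric
  polynomial, whose expectation is linear in characteristic functions. No subsequences are
  extracted, so the argument runs along any filter, in particular \<open>at_right 0\<close>. A path
  is a point of the product space \<open>real \<Rightarrow> real\<close>: compactness comes from
  Tychonoff, and a common modulus of continuity makes pointwise and compact convergence agree on the
  set.

  The exponent of the kernel varies with both arguments. The constant of the limit is that of the
  integral of \<open>\<bar>\<theta> - \<sigma>\<bar> powr (2 * H - 2)\<close> over a square of side
  \<open>d\<close>, namely \<open>d powr (2 * H) / (H * (2 * H - 1))\<close>.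

  The limit field is given by its covariance alone and its paths may be irregular, so convergence in
  path space refers to a modification built on the same space \<open>Q\<close>.\<close>

lemma open_coordinate_vimage:
  fixes W :: "'b::topological_space set"
  assumes "open W" shows "open ((\<lambda>x. x i) -` W)"
  by (rule open_vimage[OF assms continuous_on_product_coordinates])

text \<open>The Stone--Weierstrass locale \<open>function_ring_on\<close> asks for a Hausdorff type,
  and the class hierarchy for the weaker separation axioms before it. In each case a coordinate
  where the functions differ pulls back the separating open sets.\<close>

instance "fun" :: (type, t0_space) t0_space
proof
  fix f g :: "'a \<Rightarrow> 'b"
  assume "f \<noteq> g"
  then obtain i where i: "f i \<noteq> g i" by auto
  then obtain U where "open U" "f i \<in> U \<longleftrightarrow> g i \<notin> U"
    using t0_space_class.t0_space[OF i] by blast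
  then show "\<exists>U. open U \<and> \<not> (f \<in> U \<longleftrightarrow> g \<in> U)"
    using open_coordinate_vimage[of U i] by (intro exI[of _ "(\<lambda>x. x i) -` U"]) auto
qed

instance "fun" :: (type, t1_space) t1_space
proof
  fix f g :: "'a \<Rightarrow> 'b"
  assume "f \<noteq> g"
  then obtain i where i: "f i \<noteq> g i" by auto
  then obtain U where "open U" "f i \<in> U" "g i \<notin> U"
    using t1_space_class.t1_space[OF i] by blast
  then show "\<exists>U. open U \<and> f \<in> U \<and> g \<notin> U"
    using open_coordinate_vimage[of U i] by (intro exI[of _ "(\<lambda>x. x i) -` U"]) auto
qed

instance "fun" :: (type, t2_space) t2_space
proof
  fix f g :: "'a \<Rightarrow> 'b"
  assume "f \<noteq> g"
  then obtain i where i: "f i \<noteq> g i" by auto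
  then obtain U V where "open U" "open V" "f i \<in> U" "g i \<in> V" "U \<inter> V = {}"
    using hausdorff[OF i] by blast
  then show "\<exists>U V. open U \<and> open V \<and> f \<in> U \<and> g \<in> V \<and> U \<inter> V = {}"
    using open_coordinate_vimage[of U i] open_coordinate_vimage[of V i]
    by (intro exI[of _ "(\<lambda>x. x i) -` U"] exI[of _ "(\<lambda>x. x i) -` V"]) auto
qed

text \<open>Expectations of \<open>cos (l x)\<close> and \<open>sin (l x)\<close> are the two parts
  of a finite-dimensional characteristic function. Each form sees finitely many coordinates even
  when \<open>I\<close> is a half-line, so one class serves vectors and paths.\<close>

definition linear_forms :: "'i set \<Rightarrow> (('i \<Rightarrow> real) \<Rightarrow> real) set" where
  "linear_forms I = {(\<lambda>x. \<Sum>i\<in>J. c i * x i) | J c. finite J \<and> J \<subseteq> I}"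

lemma linear_forms_combine:
  assumes "l1 \<in> linear_forms I" "l2 \<in> linear_forms I"
  shows "(\<lambda>x. r * l1 x + s * l2 x) \<in> linear_forms I"
proof -
  obtain J1 c1 J2 c2 where J: "finite J1" "J1 \<subseteq> I" "finite J2" "J2 \<subseteq> I"
    and l: "l1 = (\<lambda>x. \<Sum>i\<in>J1. c1 i * x i)" "l2 = (\<lambda>x. \<Sum>i\<in>J2. c2 i * x i)"
    using assms by (auto simp: linear_forms_def)
  define c where "c i = r * (if i \<in> J1 then c1 i else 0) + s * (if i \<in> J2 then c2 i else 0)" for i
  have "(\<Sum>i\<in>J1. c1 i * x i) = (\<Sum>i\<in>J1 \<union> J2. (if i \<in> J1 then c1 i else 0) * x i)"
    "(\<Sum>i\<in>J2. c2 i * x i) = (\<Sum>i\<in>J1 \<union> J2. (if i \<in> J2 then c2 i else 0) * x i)" for x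
    using J by (auto intro!: sum.mono_neutral_cong_left)
  then have "(\<lambda>x. r * l1 x + s * l2 x) = (\<lambda>x. \<Sum>i\<in>J1 \<union> J2. c i * x i)"
    by (simp add: l c_def sum_distrib_left sum.distrib[symmetric] algebra_simps)
  then show ?thesis
    using J unfolding linear_forms_def by (intro CollectI exI[of _ "J1 \<union> J2"] exI[of _ c]) auto
qed

text \<open>Multiplication is deliberately not a rule: with sums and scalings alone, convergence of
  expectations passes from the generators to every member by linearity. The products that
  Stone--Weierstrass needs are derived afterwards.\<close>

inductive_set trig_polys :: "'i set \<Rightarrow> (('i \<Rightarrow> real) \<Rightarrow> real) set" for I where
  cos: "l \<in> linear_forms I \<Longrightarrow> (\<lambda>x. cos (l x)) \<in> trig_polys I"
| sin: "l \<in> linear_forms I \<Longrightarrow> (\<lambda>x. sin (l x)) \<in> trig_polys I"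
| add: "f \<in> trig_polys I \<Longrightarrow> g \<in> trig_polys I \<Longrightarrow> (\<lambda>x. f x + g x) \<in> trig_polys I"
| scale: "f \<in> trig_polys I \<Longrightarrow> (\<lambda>x. r * f x) \<in> trig_polys I"

lemma trig_polys_const: "(\<lambda>x. c) \<in> trig_polys I"
proof -
  have "(\<lambda>x. 0) \<in> linear_forms I"
    unfolding linear_forms_def by (intro CollectI exI[of _ "{}"]) auto
  from trig_polys.scale[OF trig_polys.cos[OF this], of c] show ?thesis by simp
qed

lemma linear_forms_coordinate:
  assumes "i \<in> I" shows "(\<lambda>x. r * x i) \<in> linear_forms I"
  using assms unfolding linear_forms_def by (intro CollectI exI[of _ "{i}"] exI[of _ "\<lambda>_. r"]) auto

text \<open>The product-to-sum formulas turn a product of two generators into a combination of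
  generators for the sum and the difference of their linear forms; induction on each factor does the
  rest.\<close>

lemma trig_polys_mult:
  assumes "f \<in> trig_polys I" "g \<in> trig_polys I"
  shows "(\<lambda>x. f x * g x) \<in> trig_polys I"
proof -
  have diff: "(\<lambda>x. l1 x - l2 x) \<in> linear_forms I" and sum: "(\<lambda>x. l1 x + l2 x) \<in> linear_forms I"
    if "l1 \<in> linear_forms I" "l2 \<in> linear_forms I" for l1 l2 :: "('a \<Rightarrow> real) \<Rightarrow> real"
    using linear_forms_combine[OF that, of 1 "-1"] linear_forms_combine[OF that, of 1 1] by simp_all
  have sub: "(\<lambda>x. p x - q x) \<in> trig_polys I" if "p \<in> trig_polys I" "q \<in> trig_polys I" for p q
    using trig_polys.add[OF that(1) trig_polys.scale[OF that(2), of "-1"]] by simp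
  have half: "(\<lambda>x. p x / 2) \<in> trig_polys I" if "p \<in> trig_polys I" for p
    using trig_polys.scale[OF that, of "1/2"] by simp
  note product_to_sum = cos_times_cos sin_times_sin sin_times_cos cos_times_sin
  have 1: "(\<lambda>x. cos (l x) * g x) \<in> trig_polys I" if l: "l \<in> linear_forms I" for l
    using assms(2)
    by induction (auto simp: product_to_sum distrib_left mult.left_commute
        intro!: half sub trig_polys.intros intro: diff sum l)
  have 2: "(\<lambda>x. sin (l x) * g x) \<in> trig_polys I" if l: "l \<in> linear_forms I" for l
    using assms(2)
    by induction (auto simp: product_to_sum distrib_left mult.left_commute
        intro!: half sub trig_polys.intros intro: diff sum l)
  show ?thesis
    using assms(1)
    by induction (auto simp: distrib_right mult.assoc intro: trig_polys.intros 1 2)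
qed

lemma trig_polys_polynomial:
  assumes "real_polynomial_function q" "g \<in> trig_polys I"
  shows "(\<lambda>x. q (g x)) \<in> trig_polys I"
  using assms(1)
proof induction
  case (linear f)
  then have "f y = f 1 * y" for y
    using linear_scale[of f y 1] by (simp add: bounded_linear.linear mult.commute)
  then have "(\<lambda>x. f (g x)) = (\<lambda>x. f 1 * g x)" by (intro ext)
  then show ?case using trig_polys.scale[OF assms(2), of "f 1"] by simp
qed (auto intro: trig_polys.add trig_polys_const trig_polys_mult)

lemma continuous_on_linear_form: "l \<in> linear_forms I \<Longrightarrow> continuous_on S l"
  unfolding linear_forms_def
  by (auto intro!: continuous_intros continuous_on_subset[OF continuous_on_product_coordinates])

lemma trig_polys_continuous: "f \<in> trig_polys I \<Longrightarrow> continuous_on S f"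
  by (induction rule: trig_polys.induct)
    (auto intro: continuous_on_cos continuous_on_sin continuous_on_add continuous_on_mult_left
      continuous_on_linear_form)

lemma trig_polys_bounded: "f \<in> trig_polys I \<Longrightarrow> \<exists>B. \<forall>x. \<bar>f x\<bar> \<le> B"
proof (induction rule: trig_polys.induct)
  case (add f g)
  then obtain B C where "\<forall>x. \<bar>f x\<bar> \<le> B" "\<forall>x. \<bar>g x\<bar> \<le> C" by blast
  then have "\<bar>f x + g x\<bar> \<le> B + C" for x
    by (meson abs_triangle_ineq add_mono order_trans)
  then show ?case by blast
next
  case (scale f r)
  then obtain B where "\<forall>x. \<bar>f x\<bar> \<le> B" by blast
  then have "\<bar>r * f x\<bar> \<le> \<bar>r\<bar> * B" for x
    by (simp add: abs_mult mult_left_mono)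
  then show ?case by blast
qed (auto intro: exI[of _ 1])

text \<open>Composing an approximation on \<^term>\<open>K\<close> with a polynomial close to the truncation at
  level \<^term>\<open>B\<close> makes it bounded everywhere without spoiling it on \<^term>\<open>K\<close>.\<close>

lemma trig_polys_approx:
  fixes K :: "('i \<Rightarrow> real) set"
  assumes K: "compact K" "K \<subseteq> extensional I"
    and f: "continuous_on K f" "\<And>x. x \<in> K \<Longrightarrow> \<bar>f x\<bar> \<le> B" and "0 \<le> B" and e: "0 < e"
  obtains g where "g \<in> trig_polys I" "\<And>x. x \<in> K \<Longrightarrow> \<bar>g x - f x\<bar> \<le> e" "\<And>x. \<bar>g x\<bar> \<le> B + e"
proof -
  interpret function_ring_on "trig_polys I" K
  proof
    show "compact K" by (rule K)
    show "continuous_on K f" if "f \<in> trig_polys I" for f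
      using that by (rule trig_polys_continuous)
    show "(\<lambda>x. f x + g x) \<in> trig_polys I" if "f \<in> trig_polys I" "g \<in> trig_polys I" for f g
      using that by (rule trig_polys.add)
    show "(\<lambda>x. f x * g x) \<in> trig_polys I" if "f \<in> trig_polys I" "g \<in> trig_polys I" for f g
      using that by (rule trig_polys_mult)
    show "(\<lambda>_. c) \<in> trig_polys I" for c
      by (rule trig_polys_const)
    fix x y :: "'i \<Rightarrow> real" assume xy: "x \<in> K" "y \<in> K" "x \<noteq> y"
    then obtain i where i: "i \<in> I" "x i \<noteq> y i"
      using K(2) by (metis extensionalityI subset_iff)
    \<comment> \<open>Scaling brings both coordinates into the interval around 0 on which
      \<open>sin\<close> is injective, so a single sine separates \<open>x\<close> from
      \<open>y\<close>.\<close>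
    define r where "r = 1 / (1 + \<bar>x i\<bar> + \<bar>y i\<bar>)"
    have r: "0 < r" unfolding r_def by (intro divide_pos_pos) linarith+
    have small: "\<bar>r * z\<bar> < pi / 2" if "\<bar>z\<bar> < 1 + \<bar>x i\<bar> + \<bar>y i\<bar>" for z
    proof -
      have "r * \<bar>z\<bar> < 1" using that unfolding r_def by (simp add: field_simps)
      then show ?thesis using r pi_ge_two by (simp add: abs_mult)
    qed
    have xy_small: "\<bar>r * x i\<bar> < pi / 2" "\<bar>r * y i\<bar> < pi / 2"
      by (rule small; linarith)+
    have "sin (r * x i) \<noteq> sin (r * y i)"
    proof
      assume "sin (r * x i) = sin (r * y i)"
      then have "r * x i = r * y i"
        by (rule sin_inj_pi[rotated 4]) (use xy_small in linarith)+
      then show False using i r by simp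
    qed
    then show "\<exists>f\<in>trig_polys I. f x \<noteq> f y"
      by (rule bexI[OF _ trig_polys.sin[OF linear_forms_coordinate[OF i(1), of r]]])
  qed
  obtain g where g: "g \<in> trig_polys I" "\<And>x. x \<in> K \<Longrightarrow> \<bar>f x - g x\<bar> < e / 2"
    using Stone_Weierstrass_basic[OF f(1), of "e/2"] e by auto
  obtain G where G: "\<And>x. \<bar>g x\<bar> \<le> G" using trig_polys_bounded[OF g(1)] by blast
  define \<tau> where "\<tau> y = max (-B) (min B y)" for y
  \<comment> \<open>\<open>g\<close> is bounded on the whole space, so all its values lie in
    \<open>{-G..G}\<close> and a polynomial close to \<open>\<tau>\<close> there controls
    \<open>q (g x)\<close> off \<open>K\<close> as well.\<close>
  have "continuous_on {-G..G} \<tau>" unfolding \<tau>_def by (intro continuous_intros)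
  then obtain q where q: "real_polynomial_function q" "\<And>y. y \<in> {-G..G} \<Longrightarrow> \<bar>\<tau> y - q y\<bar> < e / 2"
    using Stone_Weierstrass_real_polynomial_function[of "{-G..G}" \<tau> "e/2"] e by auto
  have G': "g x \<in> {-G..G}" for x using G[of x] by (simp add: abs_le_iff minus_le_iff)
  show ?thesis
  proof (rule that[of "\<lambda>x. q (g x)"])
    show "(\<lambda>x. q (g x)) \<in> trig_polys I" by (rule trig_polys_polynomial[OF q(1) g(1)])
    show "\<bar>q (g x)\<bar> \<le> B + e" for x
    proof -
      have "\<bar>\<tau> (g x)\<bar> \<le> B" unfolding \<tau>_def using \<open>0 \<le> B\<close> by linarith
      then show ?thesis using q(2)[OF G', of x] e by linarith
    qed
    show "\<bar>q (g x) - f x\<bar> \<le> e" if "x \<in> K" for x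
    proof -
      have "\<bar>\<tau> (g x) - f x\<bar> \<le> \<bar>f x - g x\<bar>"
        unfolding \<tau>_def using f(2)[OF that] by linarith
      then show ?thesis using q(2)[OF G', of x] g(2)[OF that] by linarith
    qed
  qed
qed

section \<open>Borel sets of a topology and the criterion for convergence in distribution\<close>

lemma space_borel_of [simp]: "space (borel_of T) = topspace T"
  unfolding borel_of_def by (rule space_measure_of) (auto dest: openin_subset)

lemma sets_borel_of: "sets (borel_of T) = sigma_sets (topspace T) {U. openin T U}"
  unfolding borel_of_def by (rule sets_measure_of) (auto dest: openin_subset)

lemma borel_measurable_continuous_map:
  fixes f :: "'x \<Rightarrow> real"
  assumes "continuous_map T euclideanreal f"
  shows "f \<in> borel_measurable (borel_of T)"
proof (rule borel_measurableI)
  fix S :: "real set" assume "open S"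
  then have "openin T {x \<in> topspace T. f x \<in> S}"
    using assms by (auto simp: continuous_map_def)
  moreover have "f -` S \<inter> space (borel_of T) = {x \<in> topspace T. f x \<in> S}"
    by auto
  ultimately show "f -` S \<inter> space (borel_of T) \<in> sets (borel_of T)"
    by (auto simp: sets_borel_of)
qed

lemma trig_polys_continuous_map:
  assumes "\<And>i. i \<in> I \<Longrightarrow> continuous_map T euclideanreal (\<lambda>x. x i)" "g \<in> trig_polys I"
  shows "continuous_map T euclideanreal g"
proof -
  have lin: "continuous_map T euclideanreal l" if "l \<in> linear_forms I" for l
    using that assms(1) unfolding linear_forms_def
    by (auto intro!: continuous_map_sum continuous_map_real_mult_left)
  have comp: "continuous_map T euclideanreal (\<lambda>x. \<phi> (l x))"
    if "continuous_on UNIV \<phi>" "l \<in> linear_forms I" for \<phi> :: "real \<Rightarrow> real" and l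
    using continuous_map_compose[OF lin[OF that(2)], of euclideanreal \<phi>] that(1)
    by (simp add: comp_def)
  show ?thesis
    using assms(2)
    by induction (auto intro: continuous_map_add continuous_map_real_mult_left
        comp[OF continuous_on_cos[OF continuous_on_id]] comp[OF continuous_on_sin[OF continuous_on_id]])
qed

text \<open>Off \<open>A\<close> the two variables differ by at most \<open>\<eta>\<close>, on
  \<open>A\<close> by at most \<open>B + C\<close>.\<close>

lemma expectation_approx:
  fixes f g :: "'x \<Rightarrow> real"
  assumes "prob_space M" and A: "A \<in> sets M"
    and meas: "(\<lambda>\<omega>. f (Y \<omega>)) \<in> borel_measurable M" "(\<lambda>\<omega>. g (Y \<omega>)) \<in> borel_measurable M"
    and bound: "\<And>\<omega>. \<omega> \<in> space M \<Longrightarrow> \<bar>f (Y \<omega>)\<bar> \<le> B" "\<And>\<omega>. \<omega> \<in> space M \<Longrightarrow> \<bar>g (Y \<omega>)\<bar> \<le> C"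
    and close: "\<And>\<omega>. \<omega> \<in> space M - A \<Longrightarrow> \<bar>g (Y \<omega>) - f (Y \<omega>)\<bar> \<le> \<eta>" and "0 \<le> \<eta>"
  shows "\<bar>(\<integral>\<omega>. g (Y \<omega>) \<partial>M) - (\<integral>\<omega>. f (Y \<omega>) \<partial>M)\<bar> \<le> \<eta> + (B + C) * measure M A"
proof -
  interpret prob_space M by fact
  have int: "integrable M (\<lambda>\<omega>. f (Y \<omega>))" "integrable M (\<lambda>\<omega>. g (Y \<omega>))"
    using bound meas by (auto intro: integrable_const_bound[where B = B] integrable_const_bound[where B = C])
  have intA: "integrable M (\<lambda>\<omega>. (B + C) * indicator A \<omega>)"
    using A by (simp add: emeasure_eq_measure)
  have "\<bar>(\<integral>\<omega>. g (Y \<omega>) \<partial>M) - (\<integral>\<omega>. f (Y \<omega>) \<partial>M)\<bar> = \<bar>\<integral>\<omega>. g (Y \<omega>) - f (Y \<omega>) \<partial>M\<bar>"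
    using int by simp
  also have "\<dots> \<le> (\<integral>\<omega>. \<bar>g (Y \<omega>) - f (Y \<omega>)\<bar> \<partial>M)"
    by (rule integral_abs_bound)
  also have "\<dots> \<le> (\<integral>\<omega>. \<eta> + (B + C) * indicator A \<omega> \<partial>M)"
  proof (rule integral_mono)
    fix \<omega> assume \<omega>: "\<omega> \<in> space M"
    show "\<bar>g (Y \<omega>) - f (Y \<omega>)\<bar> \<le> \<eta> + (B + C) * indicator A \<omega>"
      using bound[OF \<omega>] close[of \<omega>] \<omega> \<open>0 \<le> \<eta>\<close> by (cases "\<omega> \<in> A") auto
  qed (use int intA in auto)
  also have "\<dots> = \<eta> + (B + C) * measure M A"
    using A intA by (simp add: prob_space)
  finally show ?thesis .
qed

text \<open>Characteristic functions and tightness suffice because on a compact \<^term>\<open>K\<close> every continuous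
  function is a uniform limit of trigonometric polynomials in finitely many coordinates. The
  criterion therefore covers finite-dimensional vectors and continuous processes alike.\<close>

lemma converges_in_distribution_criterion:
  fixes T :: "('i \<Rightarrow> real) topology"
  assumes M: "prob_space M" and N: "prob_space N"
    and Y: "\<forall>\<^sub>F e in F. Y e \<in> measurable M (borel_of T)" and Z: "Z \<in> measurable N (borel_of T)"
    and coord: "\<And>i. i \<in> I \<Longrightarrow> continuous_map T euclideanreal (\<lambda>x. x i)"
    and char_cos: "\<And>l. l \<in> linear_forms I \<Longrightarrow>
      ((\<lambda>e. \<integral>\<omega>. cos (l (Y e \<omega>)) \<partial>M) \<longlongrightarrow> (\<integral>\<omega>. cos (l (Z \<omega>)) \<partial>N)) F"
    and char_sin: "\<And>l. l \<in> linear_forms I \<Longrightarrow>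
      ((\<lambda>e. \<integral>\<omega>. sin (l (Y e \<omega>)) \<partial>M) \<longlongrightarrow> (\<integral>\<omega>. sin (l (Z \<omega>)) \<partial>N)) F"
    and tight: "\<And>\<delta>. \<delta> > 0 \<Longrightarrow> \<exists>K. compact K \<and> K \<subseteq> extensional I \<and> continuous_map (top_of_set K) T id \<and>
      (\<forall>\<^sub>F e in F. \<exists>A\<in>sets M. measure M A \<le> \<delta> \<and> (\<forall>\<omega>\<in>space M - A. Y e \<omega> \<in> K)) \<and>
      (\<exists>A\<in>sets N. measure N A \<le> \<delta> \<and> (\<forall>\<omega>\<in>space N - A. Z \<omega> \<in> K))"
  shows "converges_in_distribution T M Y N Z F"
  unfolding converges_in_distribution_def
proof (intro conjI allI impI)
  interpret M: prob_space M by fact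
  interpret N: prob_space N by fact
  \<comment> \<open>Additivity of the integral needs integrability, which rests on measurability of
    \<open>Y e\<close> and so holds only eventually along \<open>F\<close>. Scaling commutes with
    the integral unconditionally.\<close>
  have trig_conv: "((\<lambda>e. \<integral>\<omega>. g (Y e \<omega>) \<partial>M) \<longlongrightarrow> (\<integral>\<omega>. g (Z \<omega>) \<partial>N)) F"
    if "g \<in> trig_polys I" for g
    using that
  proof induction
    case (add f g)
    have int: "integrable M' (\<lambda>\<omega>. p (V \<omega>))"
      if "V \<in> measurable M' (borel_of T)" "p \<in> trig_polys I" "finite_measure M'"
      for V p and M' :: "'z measure"
    proof -
      obtain B where "\<forall>x. \<bar>p x\<bar> \<le> B" using trig_polys_bounded[OF \<open>p \<in> _\<close>] by blast
      moreover have "(\<lambda>\<omega>. p (V \<omega>)) \<in> borel_measurable M'"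
        by (rule measurable_compose[OF that(1) borel_measurable_continuous_map])
          (rule trig_polys_continuous_map[OF coord that(2)])
      ultimately show ?thesis
        by (intro finite_measure.integrable_const_bound[OF that(3), where B = B] AE_I2) auto
    qed
    have "((\<lambda>e. (\<integral>\<omega>. f (Y e \<omega>) \<partial>M) + (\<integral>\<omega>. g (Y e \<omega>) \<partial>M)) \<longlongrightarrow>
        (\<integral>\<omega>. f (Z \<omega>) \<partial>N) + (\<integral>\<omega>. g (Z \<omega>) \<partial>N)) F"
      by (intro tendsto_add add.IH)
    moreover have "\<forall>\<^sub>F e in F. (\<integral>\<omega>. f (Y e \<omega>) \<partial>M) + (\<integral>\<omega>. g (Y e \<omega>) \<partial>M) = (\<integral>\<omega>. f (Y e \<omega>) + g (Y e \<omega>) \<partial>M)"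
      using Y by eventually_elim
        (simp add: Bochner_Integration.integral_add int add.hyps M.finite_measure_axioms)
    moreover have "(\<integral>\<omega>. f (Z \<omega>) \<partial>N) + (\<integral>\<omega>. g (Z \<omega>) \<partial>N) = (\<integral>\<omega>. f (Z \<omega>) + g (Z \<omega>) \<partial>N)"
      using Z by (simp add: Bochner_Integration.integral_add int add.hyps N.finite_measure_axioms)
    ultimately show ?case
      using Lim_transform_eventually by fastforce
  qed (auto intro!: char_cos char_sin tendsto_mult_left)
  show "\<forall>\<^sub>F e in F. Y e \<in> measurable M (borel_of T)" "Z \<in> measurable N (borel_of T)" by fact+
  fix f :: "('i \<Rightarrow> real) \<Rightarrow> real"
  assume "continuous_map T euclideanreal f \<and> bounded (f ` topspace T)"
  then have f: "continuous_map T euclideanreal f" and "bounded (f ` topspace T)" by auto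
  then obtain B0 where "\<And>x. x \<in> topspace T \<Longrightarrow> \<bar>f x\<bar> \<le> B0"
    by (auto simp: bounded_iff)
  then obtain B where B: "\<And>x. x \<in> topspace T \<Longrightarrow> \<bar>f x\<bar> \<le> B" "0 \<le> B"
    by (metis abs_ge_zero abs_ge_self order_trans)
  show "((\<lambda>e. \<integral>\<omega>. f (Y e \<omega>) \<partial>M) \<longlongrightarrow> (\<integral>\<omega>. f (Z \<omega>) \<partial>N)) F"
  proof (rule tendstoI)
    fix \<epsilon> :: real assume \<epsilon>: "0 < \<epsilon>"
    \<comment> \<open>Exchanging \<open>f\<close> for \<open>g\<close> costs at most
      \<open>\<eta> + (2 * B + \<eta>) * \<eta>\<close>, which for \<open>\<eta> \<le> 1\<close> is
      at most \<open>\<epsilon> / 4\<close>. Two exchanges leave \<open>\<epsilon> / 2\<close> for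
      the convergence of the expectations of \<open>g\<close>.\<close>
    define \<eta> where "\<eta> = min 1 (\<epsilon> / (4 * (2 * B + 2)))"
    have \<eta>: "0 < \<eta>" "\<eta> \<le> 1" "\<eta> * (2 * B + 2) \<le> \<epsilon> / 4"
    proof -
      show "0 < \<eta>" "\<eta> \<le> 1" using \<epsilon> B(2) by (auto simp: \<eta>_def)
      have "\<eta> \<le> \<epsilon> / (4 * (2 * B + 2))" by (simp add: \<eta>_def)
      then show "\<eta> * (2 * B + 2) \<le> \<epsilon> / 4" using B(2) by (simp add: field_simps)
    qed
    from tight[OF \<eta>(1)] obtain K where K: "compact K" "K \<subseteq> extensional I" "continuous_map (top_of_set K) T id"
      and KY: "\<forall>\<^sub>F e in F. \<exists>A\<in>sets M. measure M A \<le> \<eta> \<and> (\<forall>\<omega>\<in>space M - A. Y e \<omega> \<in> K)"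
      and KZ: "\<exists>A\<in>sets N. measure N A \<le> \<eta> \<and> (\<forall>\<omega>\<in>space N - A. Z \<omega> \<in> K)"
      by blast
    have "continuous_on K f"
      using continuous_map_compose[OF K(3) f] by simp
    moreover have KT: "K \<subseteq> topspace T"
      using K(3) by (auto simp: continuous_map_def)
    ultimately obtain g where g: "g \<in> trig_polys I" "\<And>x. x \<in> K \<Longrightarrow> \<bar>g x - f x\<bar> \<le> \<eta>" "\<And>x. \<bar>g x\<bar> \<le> B + \<eta>"
      using trig_polys_approx[OF K(1,2), of f B \<eta>] B \<eta>(1) by (metis subset_iff)
    have approx: "\<bar>(\<integral>\<omega>. g (V \<omega>) \<partial>M') - (\<integral>\<omega>. f (V \<omega>) \<partial>M')\<bar> \<le> \<epsilon> / 4"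
      if V: "V \<in> measurable M' (borel_of T)" and M': "prob_space M'"
        and A: "\<exists>A\<in>sets M'. measure M' A \<le> \<eta> \<and> (\<forall>\<omega>\<in>space M' - A. V \<omega> \<in> K)"
      for V and M' :: "'z measure"
    proof -
      from A obtain A where A: "A \<in> sets M'" "measure M' A \<le> \<eta>" "\<And>\<omega>. \<omega> \<in> space M' - A \<Longrightarrow> V \<omega> \<in> K"
        by blast
      have "\<bar>(\<integral>\<omega>. g (V \<omega>) \<partial>M') - (\<integral>\<omega>. f (V \<omega>) \<partial>M')\<bar> \<le> \<eta> + (B + (B + \<eta>)) * measure M' A"
        using measurable_space[OF V]
        by (intro expectation_approx[OF M' A(1)] measurable_compose[OF V borel_measurable_continuous_map]
            f trig_polys_continuous_map[OF coord g(1)] g(2,3) A(3) B(1) less_imp_le[OF \<eta>(1)]) auto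
      also have "\<dots> \<le> \<eta> + (2 * B + 1) * \<eta>"
        using A(2) \<eta> B(2) by (intro add_left_mono mult_mono) auto
      also have "\<dots> \<le> \<epsilon> / 4" using \<eta>(3) by (simp add: algebra_simps)
      finally show ?thesis .
    qed
    have "\<forall>\<^sub>F e in F. dist (\<integral>\<omega>. g (Y e \<omega>) \<partial>M) (\<integral>\<omega>. g (Z \<omega>) \<partial>N) < \<epsilon> / 2"
      using tendstoD[OF trig_conv[OF g(1)], of "\<epsilon> / 2"] \<epsilon> by simp
    with Y KY show "\<forall>\<^sub>F e in F. dist (\<integral>\<omega>. f (Y e \<omega>) \<partial>M) (\<integral>\<omega>. f (Z \<omega>) \<partial>N) < \<epsilon>"
    proof eventually_elim
      case (elim e)
      show ?case
        using approx[OF elim(1) M elim(2)] approx[OF Z N KZ] elim(3) \<epsilon>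
        unfolding dist_real_def by linarith
    qed
  qed
qed

section \<open>Centered Gaussian families\<close>

text \<open>Measurability can be tested only on sets described by countably many evaluations,
  whereas \<open>borel_of T\<close> is generated by arbitrary open sets; a countable base bridges
  the two.\<close>

lemma measurable_borel_of_countable_base:
  assumes "countable \<B>" and base: "\<And>U x. openin T U \<Longrightarrow> x \<in> U \<Longrightarrow> \<exists>B\<in>\<B>. x \<in> B \<and> B \<subseteq> U"
    and Y: "\<And>\<omega>. \<omega> \<in> space M \<Longrightarrow> Y \<omega> \<in> topspace T"
    and sets: "\<And>B. B \<in> \<B> \<Longrightarrow> Y -` B \<inter> space M \<in> sets M"
  shows "Y \<in> measurable M (borel_of T)"
proof (rule measurable_sigma_sets[OF sets_borel_of])
  show "{U. openin T U} \<subseteq> Pow (topspace T)" by (auto dest: openin_subset)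
  show "Y \<in> space M \<rightarrow> topspace T" using Y by auto
  fix U assume "U \<in> {U. openin T U}"
  then have U: "openin T U" by simp
  have "U = (\<Union>B\<in>{B\<in>\<B>. B \<subseteq> U}. B)"
    using base[OF U] by blast
  then have "Y -` U \<inter> space M = (\<Union>B\<in>{B\<in>\<B>. B \<subseteq> U}. Y -` B \<inter> space M)"
    by blast
  also have "\<dots> \<in> sets M"
    using assms(1) sets by (intro sets.countable_UN') (auto intro: countable_subset)
  finally show "Y -` U \<inter> space M \<in> sets M" .
qed

text \<open>Open boxes with rational corners form a countable base.\<close>

lemma measurable_product_topology:
  fixes Y :: "'w \<Rightarrow> 'i \<Rightarrow> real"
  assumes J: "finite J" and Y: "\<And>i. i \<in> J \<Longrightarrow> (\<lambda>\<omega>. Y \<omega> i) \<in> borel_measurable M"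
  shows "(\<lambda>\<omega>. \<lambda>i\<in>J. Y \<omega> i) \<in> measurable M (borel_of (product_topology (\<lambda>_. euclideanreal) J))"
proof -
  define \<B> :: "('i \<Rightarrow> real) set set" where
    "\<B> = (\<lambda>(p, q). Pi\<^sub>E J (\<lambda>i. {p i<..<q i})) ` (Pi\<^sub>E J (\<lambda>_. \<rat>) \<times> Pi\<^sub>E J (\<lambda>_. \<rat>))"
  show ?thesis
  proof (rule measurable_borel_of_countable_base)
    show "countable \<B>" unfolding \<B>_def
      using J by (intro countable_image countable_SIGMA countable_PiE countable_rat)
  next
    fix U :: "('i \<Rightarrow> real) set" and x
    assume "openin (product_topology (\<lambda>_. euclideanreal) J) U" "x \<in> U"
    from product_topology_open_contains_basis[OF this] obtain V
      where V: "x \<in> Pi\<^sub>E J V" "\<And>i. open (V i)" "Pi\<^sub>E J V \<subseteq> U" by auto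
    have "\<exists>p q. p \<in> \<rat> \<and> q \<in> \<rat> \<and> p < x i \<and> x i < q \<and> {p<..<q} \<subseteq> V i" if "i \<in> J" for i
    proof -
      have "x i \<in> V i" using V(1) that by auto
      then obtain e where e: "e > 0" "ball (x i) e \<subseteq> V i" using V(2) openE by blast
      obtain p where p: "p \<in> \<rat>" "x i - e < p" "p < x i" using Rats_dense_in_real[of "x i - e" "x i"] e by auto
      obtain q where q: "q \<in> \<rat>" "x i < q" "q < x i + e" using Rats_dense_in_real[of "x i" "x i + e"] e by auto
      have "{p<..<q} \<subseteq> ball (x i) e" using p q by (auto simp: dist_real_def)
      then show ?thesis using p q e(2) by blast
    qed
    then obtain p q where pq: "\<And>i. i \<in> J \<Longrightarrow> p i \<in> \<rat> \<and> q i \<in> \<rat> \<and> p i < x i \<and> x i < q i \<and> {p i<..<q i} \<subseteq> V i"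
      by metis
    \<comment> \<open>The corners are restricted to \<open>J\<close> because only the extensional
      rational vectors form a countable set.\<close>
    let ?B = "Pi\<^sub>E J (\<lambda>i. {restrict p J i<..<restrict q J i})"
    have "?B \<in> \<B>" unfolding \<B>_def
      by (rule image_eqI[of _ _ "(restrict p J, restrict q J)"]) (use pq in auto)
    moreover have "x \<in> ?B" using V(1) pq by (auto simp: PiE_iff)
    moreover have "?B \<subseteq> Pi\<^sub>E J V"
      by (rule PiE_mono) (simp add: pq)
    ultimately show "\<exists>B\<in>\<B>. x \<in> B \<and> B \<subseteq> U"
      using V(3) by (intro bexI[of _ ?B] conjI) (auto simp del: greaterThanLessThan_iff)
  next
    show "(\<lambda>i\<in>J. Y \<omega> i) \<in> topspace (product_topology (\<lambda>_. euclideanreal) J)" for \<omega>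
      by simp
  next
    fix B assume "B \<in> \<B>"
    then obtain p q where B: "B = Pi\<^sub>E J (\<lambda>i. {p i<..<q i})" by (auto simp: \<B>_def)
    have "(\<lambda>\<omega>. \<lambda>i\<in>J. Y \<omega> i) -` B \<inter> space M = {\<omega> \<in> space M. \<forall>i\<in>J. p i < Y \<omega> i \<and> Y \<omega> i < q i}"
      by (auto simp: B PiE_iff)
    also have "\<dots> \<in> sets M"
    proof (rule sets.sets_Collect_finite_All[OF _ J])
      fix i assume "i \<in> J"
      from measurable_sets[OF Y[OF this], of "{p i<..<q i}"]
      show "{\<omega> \<in> space M. p i < Y \<omega> i \<and> Y \<omega> i < q i} \<in> sets M"
        by (simp add: vimage_def Int_def conj_commute)
    qed
    finally show "(\<lambda>\<omega>. \<lambda>i\<in>J. Y \<omega> i) -` B \<inter> space M \<in> sets M" .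
  qed
qed

section \<open>Second moments and characteristic functions of centered Gaussian families\<close>

lemma centered_gaussian_rv_measurable:
  assumes "centered_gaussian_rv M Z"
  shows "Z \<in> borel_measurable M"
  using assms unfolding centered_gaussian_rv_def
  by (auto dest!: distributed_measurable simp: measurable_lborel1)

lemma centered_gaussian_rv_square_integrable:
  assumes "centered_gaussian_rv M Z"
  shows "integrable M (\<lambda>\<omega>. (Z \<omega>)\<^sup>2)"
  using assms unfolding centered_gaussian_rv_def
proof (elim disjE exE conjE)
  assume "Z \<in> borel_measurable M" "AE \<omega> in M. Z \<omega> = 0"
  then show ?thesis
    by (subst integrable_cong_AE[of _ _ "\<lambda>_. 0"]) auto
next
  fix \<sigma> :: real assume \<sigma>: "0 < \<sigma>" and Z: "distributed M lborel Z (normal_density 0 \<sigma>)"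
  have "integrable lborel (\<lambda>x. normal_density 0 \<sigma> x * x\<^sup>2)"
    using integrable_normal_moment[OF \<sigma>, of 0 2] by simp
  then show ?thesis
    by (subst (asm) distributed_integrable[OF Z]) auto
qed

lemma centered_gaussian_rv_char:
  assumes M: "prob_space M" and Z: "centered_gaussian_rv M Z"
  shows "(\<integral>\<omega>. cos (Z \<omega>) \<partial>M) = exp (- (\<integral>\<omega>. (Z \<omega>)\<^sup>2 \<partial>M) / 2)"
    and "(\<integral>\<omega>. sin (Z \<omega>) \<partial>M) = 0"
proof -
  interpret prob_space M by fact
  have meas [measurable]: "Z \<in> borel_measurable M"
    by (rule centered_gaussian_rv_measurable[OF Z])
  have "(\<integral>\<omega>. cos (Z \<omega>) \<partial>M) = exp (- (\<integral>\<omega>. (Z \<omega>)\<^sup>2 \<partial>M) / 2) \<and> (\<integral>\<omega>. sin (Z \<omega>) \<partial>M) = 0"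
    using Z unfolding centered_gaussian_rv_def
  proof (elim disjE exE conjE)
    assume ae: "AE \<omega> in M. Z \<omega> = 0"
    have "(\<integral>\<omega>. cos (Z \<omega>) \<partial>M) = (\<integral>\<omega>. 1 \<partial>M)" "(\<integral>\<omega>. (Z \<omega>)\<^sup>2 \<partial>M) = (\<integral>\<omega>. 0 \<partial>M)"
      "(\<integral>\<omega>. sin (Z \<omega>) \<partial>M) = (\<integral>\<omega>. 0 \<partial>M)"
      by (intro integral_cong_AE; use ae in \<open>auto elim!: eventually_mono\<close>)+
    then show ?thesis by (simp add: prob_space)
  next
    fix \<sigma> :: real assume \<sigma>: "0 < \<sigma>" and D: "distributed M lborel Z (normal_density 0 \<sigma>)"
    have var: "(\<integral>\<omega>. (Z \<omega>)\<^sup>2 \<partial>M) = \<sigma>\<^sup>2"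
      using normal_distributed_variance[OF \<sigma> D] normal_distributed_expectation[OF \<sigma> D] by simp
    \<comment> \<open>After standardization the known characteristic function of the standard normal
      law is evaluated at \<open>\<sigma>\<close>; its real and imaginary parts are the two
      claims.\<close>
    have std: "distributed M lborel (\<lambda>x. Z x / \<sigma>) std_normal_density"
      using D normal_standard_normal_convert[OF \<sigma>, of Z 0] by simp
    have d: "distr M borel (\<lambda>x. Z x / \<sigma>) = std_normal_distribution"
      using distributed_distr_eq_density[OF std] by (simp cong: distr_cong)
    have "char std_normal_distribution \<sigma> = (\<integral>\<omega>. iexp (\<sigma> * (Z \<omega> / \<sigma>)) \<partial>M)"
      unfolding d[symmetric] char_def by (subst integral_distr) auto
    then have ch: "(\<integral>\<omega>. iexp (Z \<omega>) \<partial>M) = complex_of_real (exp (- \<sigma>\<^sup>2 / 2))"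
      using \<sigma> by (simp add: char_std_normal_distribution)
    have int: "integrable M (\<lambda>\<omega>. iexp (Z \<omega>))"
      by (rule integrable_const_bound[where B = 1]) auto
    have "Re (\<integral>\<omega>. iexp (Z \<omega>) \<partial>M) = (\<integral>\<omega>. cos (Z \<omega>) \<partial>M)" "Im (\<integral>\<omega>. iexp (Z \<omega>) \<partial>M) = (\<integral>\<omega>. sin (Z \<omega>) \<partial>M)"
      using int by (simp_all add: integral_Re[symmetric] integral_Im[symmetric] Re_exp Im_exp)
    then show ?thesis by (simp add: ch var)
  qed
  then show "(\<integral>\<omega>. cos (Z \<omega>) \<partial>M) = exp (- (\<integral>\<omega>. (Z \<omega>)\<^sup>2 \<partial>M) / 2)"
    and "(\<integral>\<omega>. sin (Z \<omega>) \<partial>M) = 0" by auto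
qed

text \<open>In the definition of a Gaussian family every index occurs once, while \<open>g\<close>
  may repeat indices, as happens for increments sharing an endpoint. The coefficients are therefore
  collected on the fibres of \<open>g\<close>.\<close>

lemma centered_gaussian_family_combination:
  assumes Y: "centered_gaussian_family M I Y" and F: "finite F" "\<And>k. k \<in> F \<Longrightarrow> g k \<in> I"
  shows "centered_gaussian_rv M (\<lambda>\<omega>. \<Sum>k\<in>F. c k * Y (g k) \<omega>)"
proof -
  have "(\<Sum>k\<in>F. c k * Y (g k) \<omega>) = (\<Sum>i\<in>g ` F. (\<Sum>k | k \<in> F \<and> g k = i. c k) * Y i \<omega>)" for \<omega>
    unfolding sum.image_gen[OF F(1), of _ g] sum_distrib_right
    by (intro sum.cong) auto
  then show ?thesis
    using Y F unfolding centered_gaussian_family_def by (auto simp: image_subset_iff)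
qed

lemma centered_gaussian_family_member:
  assumes "centered_gaussian_family M I Y" "i \<in> I"
  shows "centered_gaussian_rv M (Y i)"
  using centered_gaussian_family_combination[OF assms(1), of "{()}" "\<lambda>_. i" "\<lambda>_. 1"] assms(2) by simp

lemma centered_gaussian_family_reindex:
  assumes Y: "centered_gaussian_family M I Y" and g: "\<And>k. k \<in> K \<Longrightarrow> g k \<in> I"
  shows "centered_gaussian_family M K (\<lambda>k. Y (g k))"
  unfolding centered_gaussian_family_def
  using g by (auto intro!: centered_gaussian_family_combination[OF Y])

lemma square_integrable_product:
  fixes f g :: "'w \<Rightarrow> real"
  assumes [measurable]: "f \<in> borel_measurable M" "g \<in> borel_measurable M"
    and int: "integrable M (\<lambda>\<omega>. (f \<omega>)\<^sup>2)" "integrable M (\<lambda>\<omega>. (g \<omega>)\<^sup>2)"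
  shows "integrable M (\<lambda>\<omega>. f \<omega> * g \<omega>)"
proof (rule Bochner_Integration.integrable_bound[OF Bochner_Integration.integrable_add[OF int]])
  have "\<bar>x * y\<bar> \<le> x\<^sup>2 + y\<^sup>2" for x y :: real
  proof -
    have "2 * \<bar>x * y\<bar> \<le> x\<^sup>2 + y\<^sup>2"
      using sum_squares_bound[of "\<bar>x\<bar>" "\<bar>y\<bar>"] by (simp add: abs_mult)
    then show ?thesis using abs_ge_zero[of "x * y"] by linarith
  qed
  then show "AE \<omega> in M. norm (f \<omega> * g \<omega>) \<le> norm ((f \<omega>)\<^sup>2 + (g \<omega>)\<^sup>2)" by simp
qed measurable

lemma centered_gaussian_family_integrable:
  assumes "centered_gaussian_family M I Y" "i \<in> I" "j \<in> I"
  shows "integrable M (\<lambda>\<omega>. Y i \<omega> * Y j \<omega>)"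
  using assms
  by (intro square_integrable_product centered_gaussian_rv_measurable
      centered_gaussian_rv_square_integrable centered_gaussian_family_member)

lemma centered_gaussian_family_variance:
  assumes Y: "centered_gaussian_family M I Y" and J: "J \<subseteq> I"
  shows "(\<integral>\<omega>. (\<Sum>i\<in>J. c i * Y i \<omega>)\<^sup>2 \<partial>M) = (\<Sum>i\<in>J. \<Sum>j\<in>J. c i * c j * (\<integral>\<omega>. Y i \<omega> * Y j \<omega> \<partial>M))"
proof -
  have int: "integrable M (\<lambda>\<omega>. Y i \<omega> * Y j \<omega>)" if "i \<in> J" "j \<in> J" for i j
    using that J by (intro centered_gaussian_family_integrable[OF Y]) auto
  have "(\<integral>\<omega>. (\<Sum>i\<in>J. c i * Y i \<omega>)\<^sup>2 \<partial>M) = (\<integral>\<omega>. (\<Sum>i\<in>J. \<Sum>j\<in>J. c i * c j * (Y i \<omega> * Y j \<omega>)) \<partial>M)"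
    by (intro Bochner_Integration.integral_cong)
      (auto simp: power2_eq_square sum_product intro!: sum.cong)
  also have "\<dots> = (\<Sum>i\<in>J. \<Sum>j\<in>J. c i * c j * (\<integral>\<omega>. Y i \<omega> * Y j \<omega> \<partial>M))"
    using int by (simp add: Bochner_Integration.integral_sum)
  finally show ?thesis .
qed

lemma linear_forms_restrict: "l \<in> linear_forms J \<Longrightarrow> l (\<lambda>i\<in>J. x i) = l x"
  unfolding linear_forms_def by (auto intro!: sum.cong)

text \<open>A linear form of a Gaussian family has a real characteristic function,
  \<open>exp\<close> of minus half its variance, and the variance is a finite quadratic form in the
  covariances. The sine parts vanish identically.\<close>

lemma gaussian_char_convergence:
  assumes M: "prob_space M" and N: "prob_space N"
    and Y: "\<forall>\<^sub>F e in F. centered_gaussian_family M I (Y e)" and Z: "centered_gaussian_family N I Z"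
    and cov: "\<And>i j. i \<in> I \<Longrightarrow> j \<in> I \<Longrightarrow>
      ((\<lambda>e. \<integral>\<omega>. Y e i \<omega> * Y e j \<omega> \<partial>M) \<longlongrightarrow> (\<integral>\<omega>. Z i \<omega> * Z j \<omega> \<partial>N)) F"
    and l: "l \<in> linear_forms I"
  shows "((\<lambda>e. \<integral>\<omega>. cos (l (\<lambda>i. Y e i \<omega>)) \<partial>M) \<longlongrightarrow> (\<integral>\<omega>. cos (l (\<lambda>i. Z i \<omega>)) \<partial>N)) F"
    and "((\<lambda>e. \<integral>\<omega>. sin (l (\<lambda>i. Y e i \<omega>)) \<partial>M) \<longlongrightarrow> (\<integral>\<omega>. sin (l (\<lambda>i. Z i \<omega>)) \<partial>N)) F"
proof -
  obtain J c where J: "finite J" "J \<subseteq> I" and l': "l = (\<lambda>x. \<Sum>i\<in>J. c i * x i)"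
    using l by (auto simp: linear_forms_def)
  have gauss: "centered_gaussian_rv M' (\<lambda>\<omega>. \<Sum>i\<in>J. c i * V i \<omega>)" if "centered_gaussian_family M' I V"
    for V and M' :: "'z measure"
    using that J unfolding centered_gaussian_family_def by blast
  have "((\<lambda>e. exp (- (\<Sum>i\<in>J. \<Sum>j\<in>J. c i * c j * (\<integral>\<omega>. Y e i \<omega> * Y e j \<omega> \<partial>M)) / 2)) \<longlongrightarrow>
      exp (- (\<Sum>i\<in>J. \<Sum>j\<in>J. c i * c j * (\<integral>\<omega>. Z i \<omega> * Z j \<omega> \<partial>N)) / 2)) F"
    using J by (intro tendsto_intros cov) auto
  moreover have "(\<integral>\<omega>. cos (l (\<lambda>i. Z i \<omega>)) \<partial>N) =
      exp (- (\<Sum>i\<in>J. \<Sum>j\<in>J. c i * c j * (\<integral>\<omega>. Z i \<omega> * Z j \<omega> \<partial>N)) / 2)"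
    unfolding l' centered_gaussian_rv_char(1)[OF N gauss[OF Z]] centered_gaussian_family_variance[OF Z J(2)] ..
  moreover have "\<forall>\<^sub>F e in F. exp (- (\<Sum>i\<in>J. \<Sum>j\<in>J. c i * c j * (\<integral>\<omega>. Y e i \<omega> * Y e j \<omega> \<partial>M)) / 2) =
      (\<integral>\<omega>. cos (l (\<lambda>i. Y e i \<omega>)) \<partial>M)"
    using Y
  proof eventually_elim
    case (elim e)
    show ?case
      unfolding l' centered_gaussian_rv_char(1)[OF M gauss[OF elim]] centered_gaussian_family_variance[OF elim J(2)] ..
  qed
  ultimately show "((\<lambda>e. \<integral>\<omega>. cos (l (\<lambda>i. Y e i \<omega>)) \<partial>M) \<longlongrightarrow> (\<integral>\<omega>. cos (l (\<lambda>i. Z i \<omega>)) \<partial>N)) F"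
    using Lim_transform_eventually by fastforce
  have sin_Y: "\<forall>\<^sub>F e in F. 0 = (\<integral>\<omega>. sin (l (\<lambda>i. Y e i \<omega>)) \<partial>M)"
    using Y
  proof eventually_elim
    case (elim e)
    show ?case unfolding l' centered_gaussian_rv_char(2)[OF M gauss[OF elim]] ..
  qed
  have sin_Z: "(\<integral>\<omega>. sin (l (\<lambda>i. Z i \<omega>)) \<partial>N) = 0"
    unfolding l' centered_gaussian_rv_char(2)[OF N gauss[OF Z]] ..
  show "((\<lambda>e. \<integral>\<omega>. sin (l (\<lambda>i. Y e i \<omega>)) \<partial>M) \<longlongrightarrow> (\<integral>\<omega>. sin (l (\<lambda>i. Z i \<omega>)) \<partial>N)) F"
    unfolding sin_Z by (rule Lim_transform_eventually[OF tendsto_const sin_Y])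
qed

lemma linear_forms_mono: "J \<subseteq> I \<Longrightarrow> linear_forms J \<subseteq> linear_forms I"
  unfolding linear_forms_def by blast

text \<open>Tightness is the only point left: eventually each variance is at most the limiting one
  plus 1, so Markov's inequality confines all coordinates to one cube.\<close>

lemma gaussian_converges_fdd:
  fixes Z :: "'i \<Rightarrow> 'v \<Rightarrow> real"
  assumes M: "prob_space M" and N: "prob_space N"
    and Y: "\<forall>\<^sub>F e in F. centered_gaussian_family M I (Y e)" and Z: "centered_gaussian_family N I Z"
    and cov: "\<And>i j. i \<in> I \<Longrightarrow> j \<in> I \<Longrightarrow>
      ((\<lambda>e. \<integral>\<omega>. Y e i \<omega> * Y e j \<omega> \<partial>M) \<longlongrightarrow> (\<integral>\<omega>. Z i \<omega> * Z j \<omega> \<partial>N)) F"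
  shows "converges_fdd I M Y N Z F"
  unfolding converges_fdd_def
proof (intro allI impI, elim conjE)
  fix J assume J: "finite J" "J \<subseteq> I"
  have meas: "V i \<in> borel_measurable M'" if "centered_gaussian_family M' I V" "i \<in> J"
    for V i and M' :: "'z measure"
    using that J by (intro centered_gaussian_rv_measurable centered_gaussian_family_member[where I = I]) auto
  show "converges_in_distribution (product_topology (\<lambda>_. euclideanreal) J)
          M (\<lambda>e \<omega>. \<lambda>i\<in>J. Y e i \<omega>) N (\<lambda>\<omega>. \<lambda>i\<in>J. Z i \<omega>) F"
  proof (rule converges_in_distribution_criterion[OF M N, where I = J])
    show "\<forall>\<^sub>F e in F. (\<lambda>\<omega>. \<lambda>i\<in>J. Y e i \<omega>) \<in> measurable M (borel_of (product_topology (\<lambda>_. euclideanreal) J))"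
      using Y by eventually_elim (rule measurable_product_topology[OF J(1) meas])
    show "(\<lambda>\<omega>. \<lambda>i\<in>J. Z i \<omega>) \<in> measurable N (borel_of (product_topology (\<lambda>_. euclideanreal) J))"
      by (rule measurable_product_topology[OF J(1) meas[OF Z]])
    show "continuous_map (product_topology (\<lambda>_. euclideanreal) J) euclideanreal (\<lambda>x. x i)" if "i \<in> J" for i
      using that by (rule continuous_map_product_projection)
  next
    fix l :: "('i \<Rightarrow> real) \<Rightarrow> real" assume l: "l \<in> linear_forms J"
    then have lI: "l \<in> linear_forms I" using linear_forms_mono[OF J(2)] by blast
    show "((\<lambda>e. \<integral>\<omega>. cos (l (\<lambda>i\<in>J. Y e i \<omega>)) \<partial>M) \<longlongrightarrow> (\<integral>\<omega>. cos (l (\<lambda>i\<in>J. Z i \<omega>)) \<partial>N)) F"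
      and "((\<lambda>e. \<integral>\<omega>. sin (l (\<lambda>i\<in>J. Y e i \<omega>)) \<partial>M) \<longlongrightarrow> (\<integral>\<omega>. sin (l (\<lambda>i\<in>J. Z i \<omega>)) \<partial>N)) F"
      unfolding linear_forms_restrict[OF l]
      by (rule gaussian_char_convergence[OF M N Y Z _ lI], rule cov, assumption, assumption)+
  next
    fix \<delta> :: real assume \<delta>: "\<delta> > 0"
    \<comment> \<open>The union bound over \<open>J\<close> is at most \<open>C / r\<^sup>2\<close>,
      and \<open>r\<close> is chosen to make this \<open>\<delta>\<close>. The final 1 keeps
      \<open>C\<close> positive when \<open>J\<close> is empty.\<close>
    define C where "C = (\<Sum>i\<in>J. (\<integral>\<omega>. Z i \<omega> * Z i \<omega> \<partial>N) + 1) + 1"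
    have "0 \<le> (\<integral>\<omega>. Z i \<omega> * Z i \<omega> \<partial>N)" for i by (rule Bochner_Integration.integral_nonneg) simp
    then have C: "0 < C" unfolding C_def by (intro add_nonneg_pos sum_nonneg add_nonneg_nonneg) auto
    define r where "r = sqrt (C / \<delta>)"
    have r: "0 < r" "r\<^sup>2 = C / \<delta>" using C \<delta> by (auto simp: r_def)
    define K :: "('i \<Rightarrow> real) set" where "K = Pi\<^sub>E J (\<lambda>_. {-r..r})"
    have bound: "\<exists>A\<in>sets M'. measure M' A \<le> \<delta> \<and> (\<forall>\<omega>\<in>space M' - A. (\<lambda>i\<in>J. V i \<omega>) \<in> K)"
      if V: "centered_gaussian_family M' I V" and M': "prob_space M'"
        and le: "\<forall>i\<in>J. (\<integral>\<omega>. V i \<omega> * V i \<omega> \<partial>M') \<le> (\<integral>\<omega>. Z i \<omega> * Z i \<omega> \<partial>N) + 1"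
      for V and M' :: "'z measure"
    proof -
      interpret M': prob_space M' by fact
      define A where "A i = {\<omega> \<in> space M'. r\<^sup>2 \<le> V i \<omega> * V i \<omega>}" for i
      have A: "A i \<in> sets M'" if "i \<in> J" for i
        using meas[OF V that] unfolding A_def by measurable
      have mA: "measure M' (A i) \<le> ((\<integral>\<omega>. Z i \<omega> * Z i \<omega> \<partial>N) + 1) / r\<^sup>2" if i: "i \<in> J" for i
      proof -
        have "measure M' (A i) \<le> (\<integral>\<omega>. V i \<omega> * V i \<omega> \<partial>M') / r\<^sup>2"
          unfolding A_def
          by (rule integral_Markov_inequality_measure[where A = "{}"])
            (use r C \<delta> i J in \<open>auto intro: centered_gaussian_family_integrable[OF V]\<close>)
        also have "\<dots> \<le> ((\<integral>\<omega>. Z i \<omega> * Z i \<omega> \<partial>N) + 1) / r\<^sup>2"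
          using le i by (intro divide_right_mono) auto
        finally show ?thesis .
      qed
      have "measure M' (\<Union>i\<in>J. A i) \<le> (\<Sum>i\<in>J. measure M' (A i))"
        using A by (intro M'.finite_measure_subadditive_finite J) auto
      also have "\<dots> \<le> (\<Sum>i\<in>J. ((\<integral>\<omega>. Z i \<omega> * Z i \<omega> \<partial>N) + 1) / r\<^sup>2)"
        by (rule sum_mono) (rule mA)
      also have "\<dots> \<le> C / r\<^sup>2"
        unfolding sum_divide_distrib[symmetric] C_def by (intro divide_right_mono) auto
      also have "\<dots> = \<delta>" using r C \<delta> by simp
      finally have "measure M' (\<Union>i\<in>J. A i) \<le> \<delta>" .
      moreover have "(\<lambda>i\<in>J. V i \<omega>) \<in> K" if "\<omega> \<in> space M' - (\<Union>i\<in>J. A i)" for \<omega>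
      proof -
        have "\<bar>V i \<omega>\<bar> \<le> r" if "i \<in> J" for i
        proof -
          have "(V i \<omega>)\<^sup>2 < r\<^sup>2"
            using \<open>\<omega> \<in> _\<close> that by (auto simp: A_def power2_eq_square)
          then show ?thesis using r(1) power2_less_imp_less[of "\<bar>V i \<omega>\<bar>" r] by (simp add: less_imp_le)
        qed
        then show ?thesis by (fastforce simp: K_def abs_le_iff)
      qed
      ultimately show ?thesis using A J(1) by (intro bexI[of _ "\<Union>i\<in>J. A i"]) auto
    qed
    have "\<forall>\<^sub>F e in F. \<forall>i\<in>J. (\<integral>\<omega>. Y e i \<omega> * Y e i \<omega> \<partial>M) \<le> (\<integral>\<omega>. Z i \<omega> * Z i \<omega> \<partial>N) + 1"
      unfolding eventually_ball_finite_distrib[OF J(1)]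
    proof
      fix i assume "i \<in> J"
      then have "((\<lambda>e. \<integral>\<omega>. Y e i \<omega> * Y e i \<omega> \<partial>M) \<longlongrightarrow> (\<integral>\<omega>. Z i \<omega> * Z i \<omega> \<partial>N)) F"
        using cov J by blast
      from order_tendstoD(2)[OF this, of "(\<integral>\<omega>. Z i \<omega> * Z i \<omega> \<partial>N) + 1"]
      show "\<forall>\<^sub>F e in F. (\<integral>\<omega>. Y e i \<omega> * Y e i \<omega> \<partial>M) \<le> (\<integral>\<omega>. Z i \<omega> * Z i \<omega> \<partial>N) + 1"
        by (auto elim: eventually_mono)
    qed
    with Y have KY: "\<forall>\<^sub>F e in F. \<exists>A\<in>sets M. measure M A \<le> \<delta> \<and> (\<forall>\<omega>\<in>space M - A. (\<lambda>i\<in>J. Y e i \<omega>) \<in> K)"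
      by eventually_elim (rule bound[OF _ M])
    have KZ: "\<exists>A\<in>sets N. measure N A \<le> \<delta> \<and> (\<forall>\<omega>\<in>space N - A. (\<lambda>i\<in>J. Z i \<omega>) \<in> K)"
      by (rule bound[OF Z N]) simp
    \<comment> \<open>Compactness refers to the topology of the whole function type, so the cube is
      written as a full product with a singleton factor off \<open>J\<close>.\<close>
    have "K = Pi\<^sub>E UNIV (\<lambda>i. if i \<in> J then {-r..r} else {undefined})"
      unfolding K_def by (auto simp: PiE_iff extensional_def split: if_splits)
    moreover have "compactin (product_topology (\<lambda>_. euclideanreal) UNIV)
        (Pi\<^sub>E UNIV (\<lambda>i. if i \<in> J then {-r..r} else {undefined}))"
      unfolding compactin_PiE by simp
    ultimately have "compact K" by (simp add: euclidean_product_topology)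
    moreover have "K \<subseteq> extensional J" by (auto simp: K_def PiE_iff)
    moreover have "continuous_map (top_of_set K) (product_topology (\<lambda>_. euclideanreal) J) id"
      unfolding continuous_map_componentwise
      using \<open>K \<subseteq> extensional J\<close>
      by (auto intro: continuous_on_subset[OF continuous_on_product_coordinates])
    ultimately show "\<exists>K. compact K \<and> K \<subseteq> extensional J \<and>
        continuous_map (top_of_set K) (product_topology (\<lambda>_. euclideanreal) J) id \<and>
        (\<forall>\<^sub>F e in F. \<exists>A\<in>sets M. measure M A \<le> \<delta> \<and> (\<forall>\<omega>\<in>space M - A. (\<lambda>i\<in>J. Y e i \<omega>) \<in> K)) \<and>
        (\<exists>A\<in>sets N. measure N A \<le> \<delta> \<and> (\<forall>\<omega>\<in>space N - A. (\<lambda>i\<in>J. Z i \<omega>) \<in> K))"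
      using KY KZ by blast
  qed
qed

section \<open>The space of continuous functions with compact convergence\<close>

definition dyadic_floor :: "nat \<Rightarrow> real \<Rightarrow> real" where
  "dyadic_floor n u = real (nat \<lfloor>2 ^ n * u\<rfloor>) / 2 ^ n"

lemma dyadic_floor_nonneg [simp]: "0 \<le> dyadic_floor n u"
  by (simp add: dyadic_floor_def)

lemma dyadic_floor_bounds:
  assumes "0 \<le> u"
  shows "dyadic_floor n u \<le> u" "u - dyadic_floor n u \<le> 1 / 2 ^ n"
proof -
  have *: "real (nat \<lfloor>2 ^ n * u\<rfloor>) = of_int \<lfloor>2 ^ n * u\<rfloor>"
    using assms by simp
  have fl: "of_int \<lfloor>2 ^ n * u\<rfloor> \<le> 2 ^ n * u" "2 ^ n * u - of_int \<lfloor>2 ^ n * u\<rfloor> \<le> 1" by linarith+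
  show "dyadic_floor n u \<le> u"
    unfolding dyadic_floor_def * using fl(1) by (simp add: pos_divide_le_eq mult.commute)
  have "u - dyadic_floor n u = (2 ^ n * u - of_int \<lfloor>2 ^ n * u\<rfloor>) / 2 ^ n"
    unfolding dyadic_floor_def * by (simp add: diff_divide_distrib)
  also have "\<dots> \<le> 1 / 2 ^ n" by (rule divide_right_mono[OF fl(2)]) simp
  finally show "u - dyadic_floor n u \<le> 1 / 2 ^ n" .
qed

lemma dyadic_floor_tendsto:
  assumes "0 \<le> u" shows "(\<lambda>n. dyadic_floor n u) \<longlonglongrightarrow> u"
proof (rule tendsto_sandwich)
  show "(\<lambda>n. u - (1/2) ^ n) \<longlonglongrightarrow> u"
    using tendsto_diff[OF tendsto_const[of u] LIMSEQ_realpow_zero[of "1/2::real"]] by simp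
  show "(\<lambda>n. u) \<longlonglongrightarrow> u" by simp
qed (use dyadic_floor_bounds[OF assms] in \<open>auto simp: power_one_over algebra_simps\<close>)

text \<open>The maximum is attained, so a pointwise strict bound leaves a uniform gap; this gap
  makes the generating sets of the compact convergence topology open around each of their
  members.\<close>

lemma compact_strict_bound:
  fixes f :: "'a::topological_space \<Rightarrow> real"
  assumes "compact K" "continuous_on K f" "\<And>x. x \<in> K \<Longrightarrow> f x < e"
  obtains m where "m < e" "\<And>x. x \<in> K \<Longrightarrow> f x \<le> m"
proof (cases "K = {}")
  case True
  then show ?thesis using that[of "e - 1"] by auto
next
  case False
  then obtain x where "x \<in> K" "\<And>y. y \<in> K \<Longrightarrow> f y \<le> f x"
    using continuous_attains_sup[OF assms(1) _ assms(2)] by blast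
  then show ?thesis using that[of "f x"] assms(3) by blast
qed

lemma topspace_compact_convergence [simp]:
  "topspace (compact_convergence_topology A) = continuous_fun_space A"
  unfolding compact_convergence_topology_def topology_generated_by_topspace
proof (intro equalityI subsetI)
  fix f assume "f \<in> continuous_fun_space A"
  then show "f \<in> \<Union>{{g \<in> continuous_fun_space A. \<forall>x\<in>K. dist (g x) (f x) < e} | f K e.
        f \<in> continuous_fun_space A \<and> compact K \<and> K \<subseteq> A \<and> 0 < e}"
    \<comment> \<open>For the empty compact set the condition is vacuous and the generating set is
      the whole space.\<close>
    by (intro UnionI[of "{g \<in> continuous_fun_space A. \<forall>x\<in>{}. dist (g x) (f x) < 1}"])
      (auto intro!: exI[of _ f] exI[of _ "{}"] exI[of _ 1])
qed auto

text \<open>Uniform balls over \<open>{0..real L}\<close> around \<open>g\<close> form a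
  neighbourhood base at \<open>g\<close>. A generating set need not be centered at \<open>g\<close>,
  but the gap \<open>e - m\<close> allows recentering, and every compact subset of the half-line
  lies in some \<open>{0..real L}\<close>.\<close>

lemma compact_convergence_neighbourhood:
  fixes g :: "real \<Rightarrow> real"
  assumes "openin (compact_convergence_topology {0..}) U" "g \<in> U"
  obtains L :: nat and e where "0 < e"
    "\<And>g'. g' \<in> continuous_fun_space {0..} \<Longrightarrow> (\<And>x. x \<in> {0..real L} \<Longrightarrow> \<bar>g' x - g x\<bar> < e) \<Longrightarrow> g' \<in> U"
proof -
  have "\<forall>g\<in>U. \<exists>(L::nat) e. 0 < e \<and> (\<forall>g'\<in>continuous_fun_space {0..}. (\<forall>x\<in>{0..real L}. \<bar>g' x - g x\<bar> < e) \<longrightarrow> g' \<in> U)"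
    using openin_topology_generated_by[OF assms(1)[unfolded compact_convergence_topology_def]]
  proof induction
    case (Int U V)
    show ?case
    proof
      fix g assume g: "g \<in> U \<inter> V"
      from Int.IH(1) g obtain L e where U: "0 < e"
        "\<forall>g'\<in>continuous_fun_space {0..}. (\<forall>x\<in>{0..real L}. \<bar>g' x - g x\<bar> < e) \<longrightarrow> g' \<in> U" by blast
      from Int.IH(2) g obtain L' e' where V: "0 < e'"
        "\<forall>g'\<in>continuous_fun_space {0..}. (\<forall>x\<in>{0..real L'}. \<bar>g' x - g x\<bar> < e') \<longrightarrow> g' \<in> V" by blast
      show "\<exists>(L::nat) e. 0 < e \<and> (\<forall>g'\<in>continuous_fun_space {0..}. (\<forall>x\<in>{0..real L}. \<bar>g' x - g x\<bar> < e) \<longrightarrow> g' \<in> U \<inter> V)"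
      proof (intro exI[of _ "max L L'"] exI[of _ "min e e'"] conjI ballI impI)
        fix g' assume g': "g' \<in> continuous_fun_space {0..}"
          "\<forall>x\<in>{0..real (max L L')}. \<bar>g' x - g x\<bar> < min e e'"
        then have "\<bar>g' x - g x\<bar> < e" if "x \<in> {0..real L}" for x using that by auto
        moreover have "\<bar>g' x - g x\<bar> < e'" if "x \<in> {0..real L'}" for x using that g' by auto
        ultimately show "g' \<in> U \<inter> V" using U(2) V(2) g'(1) by blast
      qed (use U(1) V(1) in simp)
    qed
  next
    case (UN \<U>)
    show ?case
    proof
      fix g assume "g \<in> \<Union>\<U>"
      then obtain U where "U \<in> \<U>" "g \<in> U" by blast
      with UN.IH obtain L e where "0 < e"
        "\<forall>g'\<in>continuous_fun_space {0..}. (\<forall>x\<in>{0..real L}. \<bar>g' x - g x\<bar> < e) \<longrightarrow> g' \<in> U" by blast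
      with \<open>U \<in> \<U>\<close> show "\<exists>(L::nat) e. 0 < e \<and> (\<forall>g'\<in>continuous_fun_space {0..}. (\<forall>x\<in>{0..real L}. \<bar>g' x - g x\<bar> < e) \<longrightarrow> g' \<in> \<Union>\<U>)"
        by (intro exI[of _ L] exI[of _ e]) blast
    qed
  next
    case (Basis U)
    then obtain f K e where U: "U = {g \<in> continuous_fun_space {0..}. \<forall>x\<in>K. dist (g x) (f x) < e}"
      and f: "f \<in> continuous_fun_space {0..}" and K: "compact K" "K \<subseteq> {0..}" and e: "0 < e"
      by blast
    obtain r where "\<And>x. x \<in> K \<Longrightarrow> \<bar>x\<bar> \<le> r"
      using compact_imp_bounded[OF K(1)] by (auto simp: bounded_iff)
    note r = this
    have KL: "K \<subseteq> {0..real (nat \<lceil>r\<rceil>)}"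
    proof
      fix x assume "x \<in> K"
      then have "0 \<le> x" "x \<le> r" using r[of x] K(2) by auto
      moreover have "x \<le> real (nat \<lceil>r\<rceil>)" by (rule order_trans[OF \<open>x \<le> r\<close> of_nat_ceiling])
      ultimately show "x \<in> {0..real (nat \<lceil>r\<rceil>)}" unfolding atLeastAtMost_iff by blast
    qed
    show ?case
    proof
      fix g assume g: "g \<in> U"
      have "continuous_on K f" "continuous_on K g"
        using f g K(2) by (auto simp: U continuous_fun_space_def intro: continuous_on_subset)
      then have "continuous_on K (\<lambda>x. dist (g x) (f x))" by (intro continuous_intros)
      moreover have "dist (g x) (f x) < e" if "x \<in> K" for x
        using g that by (simp add: U)
      ultimately obtain m where m: "m < e" "\<And>x. x \<in> K \<Longrightarrow> dist (g x) (f x) \<le> m"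
        using compact_strict_bound[OF K(1), of "\<lambda>x. dist (g x) (f x)" e] by blast
      have "g' \<in> U" if g': "g' \<in> continuous_fun_space {0..}" and lt: "\<forall>x\<in>{0..real (nat \<lceil>r\<rceil>)}. \<bar>g' x - g x\<bar> < e - m" for g'
      proof -
        have "dist (g' x) (f x) < e" if "x \<in> K" for x
        proof -
          have "\<bar>g' x - g x\<bar> < e - m" using lt KL that by auto
          then show ?thesis using m(2)[OF that] by (simp add: dist_real_def)
        qed
        then show ?thesis using g' by (simp add: U)
      qed
      then show "\<exists>(L::nat) e. 0 < e \<and> (\<forall>g'\<in>continuous_fun_space {0..}. (\<forall>x\<in>{0..real L}. \<bar>g' x - g x\<bar> < e) \<longrightarrow> g' \<in> U)"
        using m(1) by (intro exI[of _ "nat \<lceil>r\<rceil>"] exI[of _ "e - m"]) auto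
    qed
  qed auto
  then show ?thesis using that assms(2) by blast
qed

section \<open>A countable base of the path space and measurability of continuous processes\<close>

definition rational_polynomial :: "rat list \<Rightarrow> real \<Rightarrow> real" where
  "rational_polynomial l x = (\<Sum>i<length l. of_rat (l ! i) * x ^ i)"

text \<open>Weierstrass approximation followed by rounding the coefficients to rationals; coding a
  polynomial by a list over \<open>rat\<close> makes the set of centers countable.\<close>

lemma rational_polynomial_dense:
  assumes "continuous_on {0..real L} g" "0 < e"
  obtains l where "\<And>x. x \<in> {0..real L} \<Longrightarrow> \<bar>g x - rational_polynomial l x\<bar> < e"
proof -
  obtain p where p: "real_polynomial_function p" "\<And>x. x \<in> {0..real L} \<Longrightarrow> \<bar>g x - p x\<bar> < e / 2"
    using Stone_Weierstrass_real_polynomial_function[OF _ assms(1), of "e/2"] assms(2) by auto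
  obtain a k where a: "p = (\<lambda>x. \<Sum>i\<le>k. a i * x ^ i)"
    using real_polynomial_function_imp_sum[OF p(1)] by blast
  \<comment> \<open>There are \<open>Suc k\<close> rounded coefficients, each multiplied by a power
    of \<open>x\<close> of size at most \<open>(real L + 1) ^ k\<close>, so the rounding errors add
    up to \<open>e / 2\<close>. The base exceeds \<open>real L\<close> by 1 so that its powers
    increase.\<close>
  define d where "d = e / (2 * real (Suc k) * (real L + 1) ^ k)"
  have d: "0 < d" using assms(2) by (simp add: d_def)
  have "\<exists>r. \<bar>a i - of_rat r\<bar> < d" for i
  proof -
    obtain q where "q \<in> \<rat>" "a i - d < q" "q < a i + d"
      using Rats_dense_in_real[of "a i - d" "a i + d"] d by auto
    then obtain r where "q = of_rat r" by (auto simp: Rats_def)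
    then show ?thesis using \<open>a i - d < q\<close> \<open>q < a i + d\<close> by (intro exI[of _ r]) (simp add: abs_less_iff)
  qed
  then obtain r where r: "\<And>i. \<bar>a i - of_rat (r i)\<bar> < d" by metis
  define l where "l = map r [0..<Suc k]"
  have l: "rational_polynomial l x = (\<Sum>i\<le>k. of_rat (r i) * x ^ i)" for x
    unfolding rational_polynomial_def l_def
    by (rule sum.cong) (auto simp: less_Suc_eq_le simp del: upt_Suc)
  show ?thesis
  proof (rule that[of l])
    fix x assume x: "x \<in> {0..real L}"
    have "\<bar>p x - rational_polynomial l x\<bar> = \<bar>\<Sum>i\<le>k. (a i - of_rat (r i)) * x ^ i\<bar>"
      unfolding l a by (simp add: sum_subtractf[symmetric] algebra_simps)
    also have "\<dots> \<le> (\<Sum>i\<le>k. \<bar>(a i - of_rat (r i)) * x ^ i\<bar>)" by (rule sum_abs)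
    also have "\<dots> \<le> (\<Sum>i\<le>k. d * (real L + 1) ^ k)"
    proof (rule sum_mono)
      fix i assume "i \<in> {..k}"
      have "x ^ i \<le> (real L + 1) ^ i" using x by (intro power_mono) auto
      also have "\<dots> \<le> (real L + 1) ^ k" using \<open>i \<in> {..k}\<close> by (intro power_increasing) auto
      finally show "\<bar>(a i - of_rat (r i)) * x ^ i\<bar> \<le> d * (real L + 1) ^ k"
        unfolding abs_mult using r[of i] x d by (intro mult_mono) auto
    qed
    also have "\<dots> = e / 2"
    proof -
      have "0 < (real L + 1) ^ k" by simp
      then show ?thesis by (simp add: d_def del: of_nat_Suc)
    qed
    finally show "\<bar>g x - rational_polynomial l x\<bar> < e" using p(2)[OF x] by linarith
  qed
qed

text \<open>A strict bound on an interval becomes a condition on countably many points. Limits of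
  dyadic points lose strictness, hence the gap \<open>1 / real (Suc j)\<close>, whose existence is
  compactness.\<close>

lemma continuous_bound_dyadic:
  fixes g :: "real \<Rightarrow> real"
  assumes g: "continuous_on {0..} g"
  shows "(\<forall>x\<in>{0..real L}. \<bar>g x\<bar> < e) \<longleftrightarrow>
    (\<exists>j::nat. \<forall>i n. real i / 2 ^ n \<le> real L \<longrightarrow> \<bar>g (real i / 2 ^ n)\<bar> \<le> e - 1 / real (Suc j))"
proof
  assume *: "\<forall>x\<in>{0..real L}. \<bar>g x\<bar> < e"
  have "continuous_on {0..real L} (\<lambda>x. \<bar>g x\<bar>)"
    by (intro continuous_intros continuous_on_subset[OF g]) auto
  then obtain m where m: "m < e" "\<And>x. x \<in> {0..real L} \<Longrightarrow> \<bar>g x\<bar> \<le> m"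
    using compact_strict_bound[of "{0..real L}" "\<lambda>x. \<bar>g x\<bar>" e] * by auto
  obtain j where "1 / real (Suc j) < e - m"
    using m(1) reals_Archimedean[of "e - m"] by (auto simp: inverse_eq_divide)
  then show "\<exists>j::nat. \<forall>i n. real i / 2 ^ n \<le> real L \<longrightarrow> \<bar>g (real i / 2 ^ n)\<bar> \<le> e - 1 / real (Suc j)"
    by (intro exI[of _ j] allI impI, intro order_trans[OF m(2)]) auto
next
  assume "\<exists>j::nat. \<forall>i n. real i / 2 ^ n \<le> real L \<longrightarrow> \<bar>g (real i / 2 ^ n)\<bar> \<le> e - 1 / real (Suc j)"
  then obtain j where j: "\<And>i n. real i / 2 ^ n \<le> real L \<Longrightarrow> \<bar>g (real i / 2 ^ n)\<bar> \<le> e - 1 / real (Suc j)"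
    by blast
  show "\<forall>x\<in>{0..real L}. \<bar>g x\<bar> < e"
  proof
    fix x assume x: "x \<in> {0..real L}"
    have "(\<lambda>n. g (dyadic_floor n x)) \<longlonglongrightarrow> g x"
      using x by (intro continuous_on_tendsto_compose[OF g dyadic_floor_tendsto]) auto
    then have lim: "(\<lambda>n. \<bar>g (dyadic_floor n x)\<bar>) \<longlonglongrightarrow> \<bar>g x\<bar>" by (intro tendsto_intros)
    have le: "\<bar>g (dyadic_floor n x)\<bar> \<le> e - 1 / real (Suc j)" for n
      using j[of "nat \<lfloor>2 ^ n * x\<rfloor>" n] dyadic_floor_bounds(1)[of x n] x by (simp add: dyadic_floor_def)
    have "\<bar>g x\<bar> \<le> e - 1 / real (Suc j)"
      by (rule LIMSEQ_le_const2[OF lim]) (use le in blast)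
    then show "\<bar>g x\<bar> < e" by (smt (verit) divide_pos_pos of_nat_0_less_iff zero_less_Suc)
  qed
qed

text \<open>Balls over \<open>{0..real L}\<close> centered at rational polynomials with radii
  \<open>1 / real (Suc m)\<close> form a countable base, and continuity of the paths reduces
  membership in such a ball to dyadic times.\<close>

lemma measurable_compact_convergence:
  fixes Y :: "real \<Rightarrow> 'w \<Rightarrow> real"
  assumes Y: "\<And>u. 0 \<le> u \<Longrightarrow> Y u \<in> borel_measurable M"
    and cont: "\<And>\<omega>. \<omega> \<in> space M \<Longrightarrow> continuous_on {0..} (\<lambda>u. Y u \<omega>)"
  shows "(\<lambda>\<omega>. \<lambda>u\<in>{0..}. Y u \<omega>) \<in> measurable M (borel_of (compact_convergence_topology {0..}))"
proof -
  define B where "B = (\<lambda>(L::nat, l, m::nat). {g \<in> continuous_fun_space {0..}.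
    \<forall>x\<in>{0..real L}. \<bar>g x - rational_polynomial l x\<bar> < 1 / real (Suc m)})"
  have space: "(\<lambda>u\<in>{0..}. Y u \<omega>) \<in> continuous_fun_space {0..}" if "\<omega> \<in> space M" for \<omega>
    unfolding continuous_fun_space_def using cont[OF that]
    by (auto intro: continuous_on_eq)
  show ?thesis
  proof (rule measurable_borel_of_countable_base)
    show "countable (range B)" by (rule countable_image) simp
  next
    fix U g assume U: "openin (compact_convergence_topology {0..}) U" "g \<in> (U :: (real \<Rightarrow> real) set)"
    then obtain L e where e: "0 < e" and LU: "\<And>g'. g' \<in> continuous_fun_space {0..} \<Longrightarrow>
        (\<And>x. x \<in> {0..real L} \<Longrightarrow> \<bar>g' x - g x\<bar> < e) \<Longrightarrow> g' \<in> U"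
      using compact_convergence_neighbourhood[OF U] by blast
    have g: "g \<in> continuous_fun_space {0..}" using openin_subset[OF U(1)] U(2) by auto
    obtain m where m: "1 / real (Suc m) < e / 2"
      using e reals_Archimedean[of "e / 2"] by (auto simp: inverse_eq_divide)
    have "continuous_on {0..real L} g"
      using g by (auto simp: continuous_fun_space_def intro: continuous_on_subset)
    then obtain l where l: "\<And>x. x \<in> {0..real L} \<Longrightarrow> \<bar>g x - rational_polynomial l x\<bar> < 1 / real (Suc m)"
      using rational_polynomial_dense[of L g "1 / real (Suc m)"] by auto
    have "g \<in> B (L, l, m)" using g l by (simp add: B_def)
    moreover have "B (L, l, m) \<subseteq> U"
    proof
      fix g' assume g': "g' \<in> B (L, l, m)"
      then have "\<bar>g' x - g x\<bar> < e" if "x \<in> {0..real L}" for x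
        using l[OF that] that m unfolding B_def by fastforce
      then show "g' \<in> U" using g' by (intro LU) (auto simp: B_def)
    qed
    ultimately show "\<exists>B\<in>range B. g \<in> B \<and> B \<subseteq> U" by blast
  next
    show "(\<lambda>u\<in>{0..}. Y u \<omega>) \<in> topspace (compact_convergence_topology {0..})" if "\<omega> \<in> space M" for \<omega>
      using space[OF that] by simp
  next
    fix V assume "V \<in> range B"
    then obtain L l m where V: "V = B (L, l, m)" by auto
    have poly: "continuous_on {0..} (rational_polynomial l)"
      unfolding rational_polynomial_def by (intro continuous_intros)
    have "(\<lambda>\<omega>. \<lambda>u\<in>{0..}. Y u \<omega>) -` V \<inter> space M =
      {\<omega> \<in> space M. \<forall>x\<in>{0..real L}. \<bar>Y x \<omega> - rational_polynomial l x\<bar> < 1 / real (Suc m)}"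
      using space by (auto simp: V B_def)
    also have "\<dots> = {\<omega> \<in> space M. \<exists>j::nat. \<forall>i n. real i / 2 ^ n \<le> real L \<longrightarrow>
      \<bar>Y (real i / 2 ^ n) \<omega> - rational_polynomial l (real i / 2 ^ n)\<bar> \<le> 1 / real (Suc m) - 1 / real (Suc j)}"
      by (intro Collect_cong conj_cong refl continuous_bound_dyadic continuous_on_diff cont poly)
    also have "\<dots> \<in> sets M"
    proof -
      have [measurable]: "Y (real i / 2 ^ n) \<in> borel_measurable M" for i n by (rule Y) simp
      show ?thesis by measurable
    qed
    finally show "(\<lambda>\<omega>. \<lambda>u\<in>{0..}. Y u \<omega>) -` V \<inter> space M \<in> sets M" .
  qed
qed

section \<open>The covariance kernel\<close>

lemma nn_integral_powr_from_0:
  assumes "q > -1" "0 \<le> (c::real)"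
  shows "(\<integral>\<^sup>+x. ennreal (x powr q) * indicator {0..c} x \<partial>lborel) = ennreal (c powr (q + 1) / (q + 1))"
proof -
  have "((\<lambda>x. x powr q) has_integral (c powr (q + 1) / (q + 1))) {0..c}"
    by (rule has_integral_powr_from_0[OF assms])
  then have "((\<lambda>x. if x \<in> {0..c} then x powr q else 0) has_integral (c powr (q + 1) / (q + 1))) UNIV"
    by (subst has_integral_restrict_UNIV)
  then have "(\<integral>\<^sup>+x. ennreal (if x \<in> {0..c} then x powr q else 0) \<partial>lborel) = ennreal (c powr (q + 1) / (q + 1))"
    by (intro nn_integral_has_integral_lborel) (auto intro!: borel_measurable_if_I)
  also have "(\<integral>\<^sup>+x. ennreal (if x \<in> {0..c} then x powr q else 0) \<partial>lborel) =
      (\<integral>\<^sup>+x. ennreal (x powr q) * indicator {0..c} x \<partial>lborel)"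
    by (intro nn_integral_cong) (auto split: split_indicator)
  finally show ?thesis .
qed

lemma nn_integral_powr_right:
  assumes "q > -1" "x \<le> (y::real)"
  shows "(\<integral>\<^sup>+s. ennreal ((s - x) powr q) * indicator {x..y} s \<partial>lborel) = ennreal ((y - x) powr (q + 1) / (q + 1))"
proof -
  have "(\<integral>\<^sup>+s. ennreal ((s - x) powr q) * indicator {x..y} s \<partial>lborel) =
      (\<integral>\<^sup>+s. ennreal ((x + 1 * s - x) powr q) * indicator {x..y} (x + 1 * s) \<partial>lborel)"
    by (subst nn_integral_real_affine[where c = 1 and t = x]) auto
  also have "\<dots> = (\<integral>\<^sup>+s. ennreal (s powr q) * indicator {0..y - x} s \<partial>lborel)"
    by (intro nn_integral_cong) (auto split: split_indicator)
  also have "\<dots> = ennreal ((y - x) powr (q + 1) / (q + 1))"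
    using assms by (intro nn_integral_powr_from_0) auto
  finally show ?thesis .
qed

lemma nn_integral_powr_left:
  assumes "q > -1" "x \<le> (y::real)"
  shows "(\<integral>\<^sup>+s. ennreal ((y - s) powr q) * indicator {x..y} s \<partial>lborel) = ennreal ((y - x) powr (q + 1) / (q + 1))"
proof -
  have "(\<integral>\<^sup>+s. ennreal ((y - s) powr q) * indicator {x..y} s \<partial>lborel) =
      (\<integral>\<^sup>+s. ennreal ((y - (y + (-1) * s)) powr q) * indicator {x..y} (y + (-1) * s) \<partial>lborel)"
    by (subst nn_integral_real_affine[where c = "-1" and t = y]) auto
  also have "\<dots> = (\<integral>\<^sup>+s. ennreal (s powr q) * indicator {0..y - x} s \<partial>lborel)"
    by (intro nn_integral_cong) (auto split: split_indicator)
  also have "\<dots> = ennreal ((y - x) powr (q + 1) / (q + 1))"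
    using assms by (intro nn_integral_powr_from_0) auto
  finally show ?thesis .
qed

lemma nn_integral_abs_powr:
  assumes q: "q > -1" and \<theta>: "\<theta> \<in> {x<..y::real}"
  shows "(\<integral>\<^sup>+\<sigma>. ennreal (\<bar>\<theta> - \<sigma>\<bar> powr q) * indicator {x<..y} \<sigma> \<partial>lborel) =
    ennreal ((\<theta> - x) powr (q + 1) / (q + 1)) + ennreal ((y - \<theta>) powr (q + 1) / (q + 1))"
proof -
  have "(\<integral>\<^sup>+\<sigma>. ennreal (\<bar>\<theta> - \<sigma>\<bar> powr q) * indicator {x<..y} \<sigma> \<partial>lborel) =
      (\<integral>\<^sup>+\<sigma>. ennreal ((\<theta> - \<sigma>) powr q) * indicator {x..\<theta>} \<sigma> + ennreal ((\<sigma> - \<theta>) powr q) * indicator {\<theta>..y} \<sigma> \<partial>lborel)"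
  proof (rule nn_integral_cong_AE)
    \<comment> \<open>Only \<open>\<sigma> = x\<close> has to be excluded. At
      \<open>\<sigma> = \<theta>\<close> both closed intervals contribute, but
      \<open>0 powr q = 0\<close>.\<close>
    show "AE \<sigma> in lborel. ennreal (\<bar>\<theta> - \<sigma>\<bar> powr q) * indicator {x<..y} \<sigma> =
      ennreal ((\<theta> - \<sigma>) powr q) * indicator {x..\<theta>} \<sigma> + ennreal ((\<sigma> - \<theta>) powr q) * indicator {\<theta>..y} \<sigma>"
      using AE_lborel_singleton[of x]
      by eventually_elim (use \<theta> in \<open>auto simp: abs_if split: split_indicator\<close>)
  qed
  also have "\<dots> = ennreal ((\<theta> - x) powr (q + 1) / (q + 1)) + ennreal ((y - \<theta>) powr (q + 1) / (q + 1))"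
    using \<theta> q by (simp add: nn_integral_add nn_integral_powr_left nn_integral_powr_right)
  finally show ?thesis .
qed

text \<open>For \<open>q = 2 * H - 2\<close> the value is
  \<open>(y - x) powr (2 * H) / (H * (2 * H - 1))\<close>, which is where the power law and the
  normalizing constant of the limit come from. The bound \<open>q > -1\<close> is integrability at
  the diagonal.\<close>

lemma nn_integral_square_abs_powr:
  assumes q: "q > -1" and xy: "x \<le> (y::real)"
  shows "(\<integral>\<^sup>+p. ennreal (\<bar>fst p - snd p\<bar> powr q * indicator ({x<..y} \<times> {x<..y}) p) \<partial>(lborel \<Otimes>\<^sub>M lborel)) =
    ennreal (2 * (y - x) powr (q + 2) / ((q + 1) * (q + 2)))"
proof -
  have "(\<integral>\<^sup>+p. ennreal (\<bar>fst p - snd p\<bar> powr q * indicator ({x<..y} \<times> {x<..y}) p) \<partial>(lborel \<Otimes>\<^sub>M lborel)) =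
    (\<integral>\<^sup>+\<theta>. \<integral>\<^sup>+\<sigma>. ennreal (\<bar>fst (\<theta>, \<sigma>) - snd (\<theta>, \<sigma>)\<bar> powr q * indicator ({x<..y} \<times> {x<..y}) (\<theta>, \<sigma>)) \<partial>lborel \<partial>lborel)"
    by (rule lborel.nn_integral_fst[symmetric]) measurable
  also have "\<dots> = (\<integral>\<^sup>+\<theta>. (ennreal ((\<theta> - x) powr (q + 1) / (q + 1)) + ennreal ((y - \<theta>) powr (q + 1) / (q + 1))) * indicator {x<..y} \<theta> \<partial>lborel)"
  proof (rule nn_integral_cong)
    fix \<theta> :: real
    show "(\<integral>\<^sup>+\<sigma>. ennreal (\<bar>fst (\<theta>, \<sigma>) - snd (\<theta>, \<sigma>)\<bar> powr q * indicator ({x<..y} \<times> {x<..y}) (\<theta>, \<sigma>)) \<partial>lborel) =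
      (ennreal ((\<theta> - x) powr (q + 1) / (q + 1)) + ennreal ((y - \<theta>) powr (q + 1) / (q + 1))) * indicator {x<..y} \<theta>"
    proof (cases "\<theta> \<in> {x<..y}")
      case True
      have "(\<integral>\<^sup>+\<sigma>. ennreal (\<bar>fst (\<theta>, \<sigma>) - snd (\<theta>, \<sigma>)\<bar> powr q * indicator ({x<..y} \<times> {x<..y}) (\<theta>, \<sigma>)) \<partial>lborel) =
          (\<integral>\<^sup>+\<sigma>. ennreal (\<bar>\<theta> - \<sigma>\<bar> powr q) * indicator {x<..y} \<sigma> \<partial>lborel)"
        using True by (intro nn_integral_cong) (auto split: split_indicator)
      then show ?thesis using True by (simp add: nn_integral_abs_powr[OF q True])
    next
      case False
      then have zero: "indicator {x<..y} \<theta> = (0 :: ennreal)"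
        "\<And>\<sigma>. indicator ({x<..y} \<times> {x<..y}) (\<theta>, \<sigma>) = (0 :: real)"
        by (auto simp: indicator_def)
      show ?thesis unfolding zero by simp
    qed
  qed
  also have "\<dots> = (\<integral>\<^sup>+\<theta>. ennreal (1 / (q + 1)) * (ennreal ((\<theta> - x) powr (q + 1)) * indicator {x..y} \<theta>) +
      ennreal (1 / (q + 1)) * (ennreal ((y - \<theta>) powr (q + 1)) * indicator {x..y} \<theta>) \<partial>lborel)"
  proof (rule nn_integral_cong_AE)
    show "AE \<theta> in lborel. (ennreal ((\<theta> - x) powr (q + 1) / (q + 1)) + ennreal ((y - \<theta>) powr (q + 1) / (q + 1))) * indicator {x<..y} \<theta> =
      ennreal (1 / (q + 1)) * (ennreal ((\<theta> - x) powr (q + 1)) * indicator {x..y} \<theta>) +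
      ennreal (1 / (q + 1)) * (ennreal ((y - \<theta>) powr (q + 1)) * indicator {x..y} \<theta>)"
      using AE_lborel_singleton[of x]
      by eventually_elim (use q in \<open>auto simp: ennreal_mult'[symmetric] split: split_indicator\<close>)
  qed
  also have "\<dots> = ennreal (1 / (q + 1)) * ennreal ((y - x) powr (q + 1 + 1) / (q + 1 + 1)) +
      ennreal (1 / (q + 1)) * ennreal ((y - x) powr (q + 1 + 1) / (q + 1 + 1))"
    using q xy by (simp add: nn_integral_add nn_integral_cmult nn_integral_powr_left nn_integral_powr_right)
  also have "\<dots> = ennreal (2 * (y - x) powr (q + 2) / ((q + 1) * (q + 2)))"
    using q by (simp add: ennreal_mult'[symmetric] ennreal_plus[symmetric] add.assoc del: ennreal_plus)
  finally show ?thesis .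
qed

lemma integral_square_abs_powr:
  assumes q: "q > -1" and xy: "x \<le> (y::real)"
  shows "integrable (lborel \<Otimes>\<^sub>M lborel) (\<lambda>p. \<bar>fst p - snd p\<bar> powr q * indicator ({x<..y} \<times> {x<..y}) p)" (is ?int)
    and "(\<integral>p. \<bar>fst p - snd p\<bar> powr q * indicator ({x<..y} \<times> {x<..y}) p \<partial>(lborel \<Otimes>\<^sub>M lborel)) =
      2 * (y - x) powr (q + 2) / ((q + 1) * (q + 2))"
proof -
  have meas: "(\<lambda>p. \<bar>fst p - snd p\<bar> powr q * indicator ({x<..y} \<times> {x<..y}) p) \<in> borel_measurable (lborel \<Otimes>\<^sub>M lborel)"
    by measurable
  show int: ?int
    by (rule integrableI_nonneg[OF meas]) (auto simp: nn_integral_square_abs_powr[OF assms])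
  have "0 \<le> 2 * (y - x) powr (q + 2) / ((q + 1) * (q + 2))" using q by simp
  then show "(\<integral>p. \<bar>fst p - snd p\<bar> powr q * indicator ({x<..y} \<times> {x<..y}) p \<partial>(lborel \<Otimes>\<^sub>M lborel)) =
      2 * (y - x) powr (q + 2) / ((q + 1) * (q + 2))"
    using nn_integral_square_abs_powr[OF assms] nn_integral_eq_integral[OF int]
    by (subst integral_eq_nn_integral[OF meas]) auto
qed

section \<open>The kernel of the limit process and its integrals over boxes\<close>

definition covariance_kernel :: "(real \<Rightarrow> real \<Rightarrow> real) \<Rightarrow> (real \<Rightarrow> real) \<Rightarrow> real \<times> real \<Rightarrow> real" where
  "covariance_kernel R h = (\<lambda>(\<theta>, \<sigma>). symm_R R \<theta> \<sigma> (h \<theta>) (h \<sigma>) * \<bar>\<theta> - \<sigma>\<bar> powr (h \<theta> + h \<sigma> - 2))"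

text \<open>For half-open intervals this is the covariance of two increments of the limit process. A
  product integral, unlike the iterated one of \<open>limit_covariance\<close>, allows direct
  comparison of integrands on a box.\<close>

definition box_covariance :: "(real \<Rightarrow> real \<Rightarrow> real) \<Rightarrow> (real \<Rightarrow> real) \<Rightarrow> real set \<Rightarrow> real set \<Rightarrow> real" where
  "box_covariance R h A B = (\<integral>p. covariance_kernel R h p * indicator (A \<times> B) p \<partial>(lborel \<Otimes>\<^sub>M lborel))"

locale hurst_function =
  fixes a b :: real and h :: "real \<Rightarrow> real" and R :: "real \<Rightarrow> real \<Rightarrow> real"
  assumes ab: "1/2 < a" "a \<le> b" "b < 1"
    and h_cont: "continuous_on UNIV h"
    and h_range: "\<And>x. h x \<in> {a..b}"
    and R_cont: "continuous_on ({a..b} \<times> {a..b}) (\<lambda>(H1, H2). R H1 H2)"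
    and R_pos: "\<And>H1 H2. H1 \<in> {a..b} \<Longrightarrow> H2 \<in> {a..b} \<Longrightarrow> 0 < R H1 H2"
begin

lemma h_bounds: "a \<le> h x" "h x \<le> b" "1/2 < h x" "h x < 1"
  using h_range[of x] ab by auto

lemma continuous_R_h: "continuous_on UNIV (\<lambda>p. R (h (fst p)) (h (snd p)))"
proof -
  have hc: "continuous_on UNIV (\<lambda>p :: real \<times> real. h (fst p))" "continuous_on UNIV (\<lambda>p :: real \<times> real. h (snd p))"
    by (auto intro!: continuous_on_compose2[OF h_cont] continuous_intros)
  have "continuous_on UNIV ((\<lambda>(H1, H2). R H1 H2) \<circ> (\<lambda>p. (h (fst p), h (snd p))))"
    by (rule continuous_on_compose)
      (use h_range in \<open>auto intro!: hc continuous_on_Pair continuous_on_subset[OF R_cont]\<close>)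
  then show ?thesis by (simp add: comp_def)
qed

lemma R_bounded: obtains C where "0 < C" "\<And>\<theta> \<sigma>. symm_R R \<theta> \<sigma> (h \<theta>) (h \<sigma>) \<le> C"
proof -
  have "compact ((\<lambda>(H1, H2). R H1 H2) ` ({a..b} \<times> {a..b}))"
    by (intro compact_continuous_image R_cont compact_Times compact_Icc)
  then obtain C where C: "\<And>H1 H2. H1 \<in> {a..b} \<Longrightarrow> H2 \<in> {a..b} \<Longrightarrow> \<bar>R H1 H2\<bar> \<le> C"
    using compact_imp_bounded by (fastforce simp: bounded_iff)
  have "R H1 H2 \<le> C" if "H1 \<in> {a..b}" "H2 \<in> {a..b}" for H1 H2
    using C[OF that] by linarith
  moreover have "0 < C" using C[OF h_range h_range, of 0 0] R_pos[OF h_range h_range, of 0 0] by linarith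
  ultimately show ?thesis using that[of C] h_range by (simp add: symm_R_def)
qed

lemma symm_R_pos: "0 < symm_R R \<theta> \<sigma> (h \<theta>) (h \<sigma>)"
  using R_pos h_range by (simp add: symm_R_def)

lemma kernel_nonneg: "0 \<le> covariance_kernel R h p"
  using symm_R_pos[of "fst p" "snd p"] by (simp add: covariance_kernel_def case_prod_beta)

lemma kernel_measurable [measurable]: "covariance_kernel R h \<in> borel_measurable (lborel \<Otimes>\<^sub>M lborel)"
proof -
  have [measurable]: "h \<in> borel_measurable borel"
    by (rule borel_measurable_continuous_onI[OF h_cont])
  have [measurable]: "(\<lambda>p. R (h (fst p)) (h (snd p))) \<in> borel_measurable (borel \<Otimes>\<^sub>M borel)"
    unfolding borel_prod by (rule borel_measurable_continuous_onI[OF continuous_R_h])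
  have "continuous_on UNIV (\<lambda>p :: real \<times> real. (snd p, fst p))"
    by (intro continuous_intros)
  from continuous_on_compose2[OF continuous_R_h this]
  have [measurable]: "(\<lambda>p. R (h (snd p)) (h (fst p))) \<in> borel_measurable (borel \<Otimes>\<^sub>M borel)"
    unfolding borel_prod by (intro borel_measurable_continuous_onI) simp
  have "(\<lambda>p. (if snd p \<le> fst p then R (h (fst p)) (h (snd p)) else R (h (snd p)) (h (fst p))) *
      \<bar>fst p - snd p\<bar> powr (h (fst p) + h (snd p) - 2)) \<in> borel_measurable (borel \<Otimes>\<^sub>M borel)"
    by measurable
  then show ?thesis
    by (simp add: covariance_kernel_def symm_R_def case_prod_beta' cong: measurable_cong_sets)
qed

text \<open>At distances at most 1 a power decreases in its exponent, so lowering the exponent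
  raises the bound; the lower estimate uses the same fact in the other direction.\<close>

lemma kernel_upper:
  assumes "\<bar>\<theta> - \<sigma>\<bar> \<le> 1" "symm_R R \<theta> \<sigma> (h \<theta>) (h \<sigma>) \<le> C" "q \<le> h \<theta> + h \<sigma> - 2"
  shows "covariance_kernel R h (\<theta>, \<sigma>) \<le> C * \<bar>\<theta> - \<sigma>\<bar> powr q"
  unfolding covariance_kernel_def prod.case
proof (rule mult_mono)
  show "\<bar>\<theta> - \<sigma>\<bar> powr (h \<theta> + h \<sigma> - 2) \<le> \<bar>\<theta> - \<sigma>\<bar> powr q"
    using assms by (intro powr_mono') auto
  show "0 \<le> C" using assms(2) symm_R_pos[of \<theta> \<sigma>] by linarith
qed (use assms in auto)

lemma kernel_lower:
  assumes "\<bar>\<theta> - \<sigma>\<bar> \<le> 1" "c \<le> symm_R R \<theta> \<sigma> (h \<theta>) (h \<sigma>)" "h \<theta> + h \<sigma> - 2 \<le> q"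
  shows "c * \<bar>\<theta> - \<sigma>\<bar> powr q \<le> covariance_kernel R h (\<theta>, \<sigma>)"
  unfolding covariance_kernel_def prod.case
proof (rule mult_mono)
  show "\<bar>\<theta> - \<sigma>\<bar> powr q \<le> \<bar>\<theta> - \<sigma>\<bar> powr (h \<theta> + h \<sigma> - 2)"
    using assms by (intro powr_mono') auto
qed (use assms symm_R_pos[of \<theta> \<sigma>] in auto)

lemma kernel_integrable_square:
  assumes "x \<le> y"
  shows "integrable (lborel \<Otimes>\<^sub>M lborel) (\<lambda>p. covariance_kernel R h p * indicator ({x<..y} \<times> {x<..y}) p)"
proof -
  obtain C where C: "0 < C" "\<And>\<theta> \<sigma>. symm_R R \<theta> \<sigma> (h \<theta>) (h \<sigma>) \<le> C" using R_bounded by blast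
  \<comment> \<open>The first term dominates at distances up to 1, where the smallest exponent is
    the worst; the second, with exponent 0, dominates beyond 1.\<close>
  have "integrable (lborel \<Otimes>\<^sub>M lborel) (\<lambda>p. C * (\<bar>fst p - snd p\<bar> powr (2 * a - 2) * indicator ({x<..y} \<times> {x<..y}) p) +
      C * (\<bar>fst p - snd p\<bar> powr 0 * indicator ({x<..y} \<times> {x<..y}) p))"
    using ab assms
    by (intro Bochner_Integration.integrable_add integrable_mult_right integral_square_abs_powr) auto
  then show ?thesis
  proof (rule Bochner_Integration.integrable_bound)
    have bound: "covariance_kernel R h (\<theta>, \<sigma>) \<le> C * \<bar>\<theta> - \<sigma>\<bar> powr (2 * a - 2) + C * \<bar>\<theta> - \<sigma>\<bar> powr 0" for \<theta> \<sigma>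
    proof (cases "\<bar>\<theta> - \<sigma>\<bar> \<le> 1")
      case True
      have "covariance_kernel R h (\<theta>, \<sigma>) \<le> C * \<bar>\<theta> - \<sigma>\<bar> powr (2 * a - 2)"
        using h_bounds[of \<theta>] h_bounds[of \<sigma>] by (intro kernel_upper True C(2)) auto
      then show ?thesis using C(1) by (smt (verit) mult_nonneg_nonneg powr_ge_zero)
    next
      case False
      have "\<bar>\<theta> - \<sigma>\<bar> powr (h \<theta> + h \<sigma> - 2) \<le> \<bar>\<theta> - \<sigma>\<bar> powr 0"
        using False h_bounds[of \<theta>] h_bounds[of \<sigma>] by (intro powr_mono) auto
      then have "covariance_kernel R h (\<theta>, \<sigma>) \<le> C * \<bar>\<theta> - \<sigma>\<bar> powr 0"
        unfolding covariance_kernel_def prod.case using C by (intro mult_mono) auto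
      then show ?thesis using C(1) by (smt (verit) mult_nonneg_nonneg powr_ge_zero)
    qed
    show "AE p in lborel \<Otimes>\<^sub>M lborel. norm (covariance_kernel R h p * indicator ({x<..y} \<times> {x<..y}) p) \<le>
      norm (C * (\<bar>fst p - snd p\<bar> powr (2 * a - 2) * indicator ({x<..y} \<times> {x<..y}) p) +
      C * (\<bar>fst p - snd p\<bar> powr 0 * indicator ({x<..y} \<times> {x<..y}) p))"
    proof (rule AE_I2)
      fix p :: "real \<times> real"
      have "covariance_kernel R h p \<le> C * \<bar>fst p - snd p\<bar> powr (2 * a - 2) + C * \<bar>fst p - snd p\<bar> powr 0"
        using bound[of "fst p" "snd p"] unfolding prod.collapse .
      from order_trans[OF this abs_ge_self] kernel_nonneg[of p]
      show "norm (covariance_kernel R h p * indicator ({x<..y} \<times> {x<..y}) p) \<le>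
        norm (C * (\<bar>fst p - snd p\<bar> powr (2 * a - 2) * indicator ({x<..y} \<times> {x<..y}) p) +
        C * (\<bar>fst p - snd p\<bar> powr 0 * indicator ({x<..y} \<times> {x<..y}) p))"
        by (cases "p \<in> {x<..y} \<times> {x<..y}") simp_all
    qed
  qed measurable
qed

lemma kernel_integrable_box:
  assumes "A \<in> sets lborel" "B \<in> sets lborel" "A \<subseteq> {x<..y}" "B \<subseteq> {x<..y}"
  shows "integrable (lborel \<Otimes>\<^sub>M lborel) (\<lambda>p. covariance_kernel R h p * indicator (A \<times> B) p)"
proof (cases "x \<le> y")
  case True
  show ?thesis
  proof (rule Bochner_Integration.integrable_bound[OF kernel_integrable_square[OF True]])
    have "(\<lambda>p. indicator (A \<times> B) p :: real) \<in> borel_measurable (lborel \<Otimes>\<^sub>M lborel)"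
      using assms by (intro borel_measurable_indicator pair_measureI)
    then show "(\<lambda>p. covariance_kernel R h p * indicator (A \<times> B) p) \<in> borel_measurable (lborel \<Otimes>\<^sub>M lborel)"
      by (intro borel_measurable_times kernel_measurable)
    show "AE p in lborel \<Otimes>\<^sub>M lborel. norm (covariance_kernel R h p * indicator (A \<times> B) p) \<le>
        norm (covariance_kernel R h p * indicator ({x<..y} \<times> {x<..y}) p)"
      using assms by (intro AE_I2) (auto split: split_indicator)
  qed
next
  case False
  then have "A = {}" using assms by auto
  then show ?thesis by simp
qed

lemma limit_covariance_box:
  "limit_covariance R h t s = box_covariance R h {0..t} {0..s}"
proof -
  have int: "integrable (lborel \<Otimes>\<^sub>M lborel) (\<lambda>p. covariance_kernel R h p * indicator ({0..t} \<times> {0..s}) p)"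
    \<comment> \<open>The enclosing square is open on the left, so it starts below 0 to contain the
      closed box.\<close>
    by (rule kernel_integrable_box[where x = "-1" and y = "max t s"]) auto
  have "box_covariance R h {0..t} {0..s} =
      (\<integral>\<theta>. \<integral>\<sigma>. covariance_kernel R h (\<theta>, \<sigma>) * indicator ({0..t} \<times> {0..s}) (\<theta>, \<sigma>) \<partial>lborel \<partial>lborel)"
    unfolding box_covariance_def by (rule lborel_pair.integral_fst'[OF int, symmetric])
  also have "\<dots> = limit_covariance R h t s"
    unfolding limit_covariance_def set_lebesgue_integral_def
    by (intro Bochner_Integration.integral_cong refl)
      (auto simp: covariance_kernel_def indicator_times mult_ac split: split_indicator
        intro!: Bochner_Integration.integral_cong)
  finally show ?thesis ..
qed

text \<open>Inclusion--exclusion for the four boxes anchored at the origin; their indicators combine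
  pointwise to that of the half-open box.\<close>

lemma increment_covariance_box:
  assumes "0 \<le> x" "x \<le> y" "0 \<le> z" "z \<le> w"
  shows "limit_covariance R h y w - limit_covariance R h x w - limit_covariance R h y z + limit_covariance R h x z =
    box_covariance R h {x<..y} {z<..w}"
proof -
  let ?f = "\<lambda>A B p. covariance_kernel R h p * indicator (A \<times> B) p"
  have int: "integrable (lborel \<Otimes>\<^sub>M lborel) (?f {0..t} {0..s})" for t s :: real
    by (rule kernel_integrable_box[where x = "-1" and y = "max t s"]) auto
  have "limit_covariance R h y w - limit_covariance R h x w - limit_covariance R h y z + limit_covariance R h x z =
    (\<integral>p. ?f {0..y} {0..w} p - ?f {0..x} {0..w} p - ?f {0..y} {0..z} p + ?f {0..x} {0..z} p \<partial>(lborel \<Otimes>\<^sub>M lborel))"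
    unfolding limit_covariance_box box_covariance_def by (simp add: int)
  also have "\<dots> = box_covariance R h {x<..y} {z<..w}"
    unfolding box_covariance_def
    using assms by (intro Bochner_Integration.integral_cong) (auto split: split_indicator)
  finally show ?thesis .
qed

lemma box_covariance_nonneg: "0 \<le> box_covariance R h A B"
  unfolding box_covariance_def by (intro Bochner_Integration.integral_nonneg) (simp add: kernel_nonneg)

text \<open>Comparing \<open>q\<close> with \<open>2 * h \<theta> - 2\<close> at single points
  suffices, because \<open>h \<theta> + h \<sigma> - 2\<close> is the average of the two
  values.\<close>

lemma box_covariance_upper:
  assumes "x \<le> y" "y - x \<le> 1" "q > -1"
    and "\<And>\<theta> \<sigma>. \<theta> \<in> {x<..y} \<Longrightarrow> \<sigma> \<in> {x<..y} \<Longrightarrow> symm_R R \<theta> \<sigma> (h \<theta>) (h \<sigma>) \<le> C"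
    and "\<And>\<theta>. \<theta> \<in> {x<..y} \<Longrightarrow> q \<le> 2 * h \<theta> - 2"
  shows "box_covariance R h {x<..y} {x<..y} \<le> C * (2 * (y - x) powr (q + 2) / ((q + 1) * (q + 2)))"
proof -
  have "box_covariance R h {x<..y} {x<..y} \<le>
    (\<integral>p. C * (\<bar>fst p - snd p\<bar> powr q * indicator ({x<..y} \<times> {x<..y}) p) \<partial>(lborel \<Otimes>\<^sub>M lborel))"
    unfolding box_covariance_def
  proof (rule integral_mono)
    fix p :: "real \<times> real"
    show "covariance_kernel R h p * indicator ({x<..y} \<times> {x<..y}) p \<le>
        C * (\<bar>fst p - snd p\<bar> powr q * indicator ({x<..y} \<times> {x<..y}) p)"
    proof (cases "p \<in> {x<..y} \<times> {x<..y}")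
      case True
      then obtain \<theta> \<sigma> where p: "p = (\<theta>, \<sigma>)" "\<theta> \<in> {x<..y}" "\<sigma> \<in> {x<..y}" by auto
      have "covariance_kernel R h (\<theta>, \<sigma>) \<le> C * \<bar>\<theta> - \<sigma>\<bar> powr q"
        using assms(2) assms(4)[OF p(2,3)] assms(5)[OF p(2)] assms(5)[OF p(3)] p(2,3)
        by (intro kernel_upper) auto
      then show ?thesis using True by (simp add: p(1))
    qed simp
  qed (use assms in \<open>intro kernel_integrable_square integrable_mult_right integral_square_abs_powr; simp\<close>)+
  then show ?thesis by (simp add: integral_square_abs_powr(2)[OF assms(3,1)])
qed

lemma box_covariance_lower:
  assumes "x \<le> y" "y - x \<le> 1" "q > -1"
    and "\<And>\<theta> \<sigma>. \<theta> \<in> {x<..y} \<Longrightarrow> \<sigma> \<in> {x<..y} \<Longrightarrow> c \<le> symm_R R \<theta> \<sigma> (h \<theta>) (h \<sigma>)"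
    and "\<And>\<theta>. \<theta> \<in> {x<..y} \<Longrightarrow> 2 * h \<theta> - 2 \<le> q"
  shows "c * (2 * (y - x) powr (q + 2) / ((q + 1) * (q + 2))) \<le> box_covariance R h {x<..y} {x<..y}"
proof -
  have "(\<integral>p. c * (\<bar>fst p - snd p\<bar> powr q * indicator ({x<..y} \<times> {x<..y}) p) \<partial>(lborel \<Otimes>\<^sub>M lborel)) \<le>
      box_covariance R h {x<..y} {x<..y}"
    unfolding box_covariance_def
  proof (rule integral_mono)
    fix p :: "real \<times> real"
    show "c * (\<bar>fst p - snd p\<bar> powr q * indicator ({x<..y} \<times> {x<..y}) p) \<le>
        covariance_kernel R h p * indicator ({x<..y} \<times> {x<..y}) p"
    proof (cases "p \<in> {x<..y} \<times> {x<..y}")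
      case True
      then obtain \<theta> \<sigma> where p: "p = (\<theta>, \<sigma>)" "\<theta> \<in> {x<..y}" "\<sigma> \<in> {x<..y}" by auto
      have "c * \<bar>\<theta> - \<sigma>\<bar> powr q \<le> covariance_kernel R h (\<theta>, \<sigma>)"
        using assms(2) assms(4)[OF p(2,3)] assms(5)[OF p(2)] assms(5)[OF p(3)] p(2,3)
        by (intro kernel_lower) auto
      then show ?thesis using True by (simp add: p(1))
    qed simp
  qed (use assms in \<open>intro kernel_integrable_square integrable_mult_right integral_square_abs_powr; simp\<close>)+
  then show ?thesis by (simp add: integral_square_abs_powr(2)[OF assms(3,1)])
qed

text \<open>The exponent lies between -1 and 0, so at distance at least \<open>\<delta>\<close> the
  power is at most \<open>1 / \<delta>\<close>; what remains is the area of the box.\<close>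

lemma box_covariance_separated:
  assumes C: "\<And>\<theta> \<sigma>. symm_R R \<theta> \<sigma> (h \<theta>) (h \<sigma>) \<le> C" and \<delta>: "0 < \<delta>" "\<delta> \<le> 1"
    and sep: "\<And>\<theta> \<sigma>. \<theta> \<in> {x<..y} \<Longrightarrow> \<sigma> \<in> {z<..w} \<Longrightarrow> \<delta> \<le> \<bar>\<theta> - \<sigma>\<bar>"
    and "x \<le> y" "z \<le> w"
  shows "box_covariance R h {x<..y} {z<..w} \<le> C / \<delta> * ((y - x) * (w - z))"
proof -
  have C0: "0 < C" using C[of 0 0] symm_R_pos[of 0 0] by linarith
  have em: "emeasure (lborel \<Otimes>\<^sub>M lborel) ({x<..y} \<times> {z<..w}) = ennreal ((y - x) * (w - z))"
    using assms(5,6) by (subst lborel.emeasure_pair_measure_Times) (auto simp: ennreal_mult)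
  have int: "integrable (lborel \<Otimes>\<^sub>M lborel) (\<lambda>p. C / \<delta> * indicator ({x<..y} \<times> {z<..w}) p)"
    by (intro integrable_mult_right integrable_real_indicator) (auto simp: em)
  have "box_covariance R h {x<..y} {z<..w} \<le>
    (\<integral>p. C / \<delta> * indicator ({x<..y} \<times> {z<..w}) p \<partial>(lborel \<Otimes>\<^sub>M lborel))"
    unfolding box_covariance_def
  proof (rule integral_mono)
    show "integrable (lborel \<Otimes>\<^sub>M lborel) (\<lambda>p. covariance_kernel R h p * indicator ({x<..y} \<times> {z<..w}) p)"
      by (rule kernel_integrable_box[where x = "min x z" and y = "max y w"]) auto
    fix p :: "real \<times> real"
    show "covariance_kernel R h p * indicator ({x<..y} \<times> {z<..w}) p \<le> C / \<delta> * indicator ({x<..y} \<times> {z<..w}) p"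
    proof (cases "p \<in> {x<..y} \<times> {z<..w}")
      case True
      then obtain \<theta> \<sigma> where p: "p = (\<theta>, \<sigma>)" "\<theta> \<in> {x<..y}" "\<sigma> \<in> {z<..w}" by auto
      let ?e = "h \<theta> + h \<sigma> - 2"
      have e: "-1 \<le> ?e" "?e \<le> 0" using h_bounds[of \<theta>] h_bounds[of \<sigma>] by linarith+
      have "\<bar>\<theta> - \<sigma>\<bar> powr ?e \<le> \<delta> powr ?e"
        using sep[OF p(2,3)] \<delta> e by (intro powr_mono2') auto
      also have "\<dots> \<le> \<delta> powr (-1)"
        using \<delta> e by (intro powr_mono') auto
      finally have "\<bar>\<theta> - \<sigma>\<bar> powr ?e \<le> 1 / \<delta>" using \<delta> by (simp add: powr_minus_divide)
      then have "covariance_kernel R h (\<theta>, \<sigma>) \<le> C * (1 / \<delta>)"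
        unfolding covariance_kernel_def prod.case using C C0 by (intro mult_mono) auto
      then show ?thesis using True by (simp add: p(1))
    qed simp
  qed (rule int)
  also have "\<dots> = C / \<delta> * ((y - x) * (w - z))"
    using em assms(5,6) by (simp add: measure_def)
  finally show ?thesis .
qed

end

section \<open>Chaining, tightness and continuous modifications\<close>

text \<open>The good event of chaining, stated for a single path so that it applies on both
  probability spaces. The constant depends on \<open>L\<close>, as no uniform bound on the half-line
  is to be expected.\<close>

definition dyadic_regular :: "(nat \<Rightarrow> real) \<Rightarrow> real \<Rightarrow> (real \<Rightarrow> real) set" where
  "dyadic_regular A q = {x. \<forall>L n k. k < L * 2 ^ n \<longrightarrow> \<bar>x (real (Suc k) / 2 ^ n) - x (real k / 2 ^ n)\<bar> \<le> A L * q ^ n}"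

lemma dyadic_regularD:
  "x \<in> dyadic_regular A q \<Longrightarrow> k < L * 2 ^ n \<Longrightarrow> \<bar>x (real (Suc k) / 2 ^ n) - x (real k / 2 ^ n)\<bar> \<le> A L * q ^ n"
  unfolding dyadic_regular_def by blast

lemma dyadic_floor_Suc:
  fixes u :: real
  assumes "0 \<le> u"
  shows "nat \<lfloor>2 ^ Suc n * u\<rfloor> \<in> {2 * nat \<lfloor>2 ^ n * u\<rfloor>, Suc (2 * nat \<lfloor>2 ^ n * u\<rfloor>)}"
proof -
  define z where "z = 2 ^ n * u"
  have "0 \<le> z" using assms by (simp add: z_def)
  have "2 ^ Suc n * u = 2 * z" by (simp add: z_def)
  have "\<lfloor>2 * z\<rfloor> = 2 * \<lfloor>z\<rfloor> \<or> \<lfloor>2 * z\<rfloor> = 2 * \<lfloor>z\<rfloor> + 1"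
    by linarith
  then have "nat \<lfloor>2 * z\<rfloor> = 2 * nat \<lfloor>z\<rfloor> \<or> nat \<lfloor>2 * z\<rfloor> = Suc (2 * nat \<lfloor>z\<rfloor>)"
    using \<open>0 \<le> z\<close> by (auto simp: nat_mult_distrib nat_add_distrib)
  then show ?thesis unfolding \<open>2 ^ Suc n * u = 2 * z\<close> by (simp add: z_def)
qed

lemma dyadic_index_bound:
  assumes "0 \<le> u" "u \<le> real L" "Suc k \<le> nat \<lfloor>2 ^ n * u\<rfloor>"
  shows "k < L * 2 ^ n"
proof -
  have "real (Suc k) \<le> real (nat \<lfloor>2 ^ n * u\<rfloor>)" using assms(3) by linarith
  also have "\<dots> \<le> 2 ^ n * u" using assms(1) by simp
  also have "\<dots> \<le> 2 ^ n * real L" using assms(2) by simp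
  finally have "real (Suc k) \<le> real (L * 2 ^ n)" by (simp add: mult.commute)
  then show ?thesis by (simp only: of_nat_le_iff Suc_le_eq)
qed

text \<open>Refining the grid either keeps the rounded point or moves it from index
  \<open>2 * j\<close> to its right neighbour, which is one step of the finer grid.\<close>

lemma dyadic_chain_step:
  assumes x: "x \<in> dyadic_regular A q" and u: "0 \<le> u" "u \<le> real L" and A: "0 \<le> A L" "0 \<le> q"
  shows "\<bar>x (dyadic_floor (Suc n) u) - x (dyadic_floor n u)\<bar> \<le> A L * q ^ Suc n"
proof -
  let ?j = "nat \<lfloor>2 ^ n * u\<rfloor>"
  have eq: "dyadic_floor n u = real (2 * ?j) / 2 ^ Suc n" by (simp add: dyadic_floor_def)
  from dyadic_floor_Suc[OF u(1), of n] consider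
    "nat \<lfloor>2 ^ Suc n * u\<rfloor> = 2 * ?j" | "nat \<lfloor>2 ^ Suc n * u\<rfloor> = Suc (2 * ?j)" by blast
  then show ?thesis
  proof cases
    case 1
    then have "dyadic_floor (Suc n) u = dyadic_floor n u"
      unfolding eq unfolding dyadic_floor_def by simp
    then show ?thesis using A by simp
  next
    case 2
    have "2 * ?j < L * 2 ^ Suc n" by (rule dyadic_index_bound[OF u]) (simp add: 2 del: power_Suc)
    from dyadic_regularD[OF x this] show ?thesis
      unfolding eq unfolding dyadic_floor_def 2 .
  qed
qed

lemma dyadic_chain:
  assumes x: "x \<in> dyadic_regular A q" and u: "0 \<le> u" "u \<le> real L" and A: "0 \<le> A L" "0 < q" "q < 1"
    and "n \<le> m"
  shows "\<bar>x (dyadic_floor m u) - x (dyadic_floor n u)\<bar> \<le> A L * q / (1 - q) * q ^ n"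
proof -
  \<comment> \<open>Keeping the exact geometric sum lets the induction telescope; the subtracted
    term is dropped only at the end.\<close>
  have "\<bar>x (dyadic_floor (n + d) u) - x (dyadic_floor n u)\<bar> \<le> A L * q / (1 - q) * (q ^ n - q ^ (n + d))" for d
  proof (induction d)
    case (Suc d)
    have "\<bar>x (dyadic_floor (Suc (n + d)) u) - x (dyadic_floor (n + d) u)\<bar> \<le> A L * q ^ Suc (n + d)"
      using A by (intro dyadic_chain_step[OF x u]) auto
    also have "\<dots> = A L * q / (1 - q) * (q ^ (n + d) - q ^ Suc (n + d))"
      using A by (simp add: field_simps)
    finally have "\<bar>x (dyadic_floor (n + Suc d) u) - x (dyadic_floor n u)\<bar> \<le>
      A L * q / (1 - q) * (q ^ (n + d) - q ^ Suc (n + d)) + A L * q / (1 - q) * (q ^ n - q ^ (n + d))"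
      using Suc.IH by simp
    then show ?case by (simp only: ring_distribs add_Suc_right)
  qed simp
  from this[of "m - n"] \<open>n \<le> m\<close>
  have "\<bar>x (dyadic_floor m u) - x (dyadic_floor n u)\<bar> \<le> A L * q / (1 - q) * (q ^ n - q ^ m)" by simp
  also have "\<dots> \<le> A L * q / (1 - q) * q ^ n"
    using A by (intro mult_left_mono) auto
  finally show ?thesis .
qed

text \<open>One step on the coarse grid plus two chains of geometric sum:
  \<open>1 + 2 * q / (1 - q) = (1 + q) / (1 - q)\<close>.\<close>

definition chaining_const :: "(nat \<Rightarrow> real) \<Rightarrow> real \<Rightarrow> nat \<Rightarrow> real" where
  "chaining_const A q L = A L * (1 + q) / (1 - q)"

text \<open>Chain from \<open>u\<close> down to level \<open>n\<close>, where the roundings of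
  \<open>u\<close> and \<open>v\<close> coincide or are neighbours, and back up to
  \<open>v\<close>.\<close>

lemma dyadic_modulus:
  assumes x: "x \<in> dyadic_regular A q" and u: "0 \<le> u" "u \<le> real L" and v: "0 \<le> v" "v \<le> real L"
    and A: "0 \<le> A L" "0 < q" "q < 1" and "n \<le> m" and uv: "\<bar>u - v\<bar> \<le> 1 / 2 ^ n"
  shows "\<bar>x (dyadic_floor m u) - x (dyadic_floor m v)\<bar> \<le> chaining_const A q L * q ^ n"
proof -
  have step: "\<bar>x (dyadic_floor n u) - x (dyadic_floor n v)\<bar> \<le> A L * q ^ n"
    if "v \<le> u" "0 \<le> v" "u \<le> real L" "u - v \<le> 1 / 2 ^ n" for u v
  proof -
    have "2 ^ n * v \<le> 2 ^ n * u" using that by simp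
    moreover have "2 ^ n * u \<le> 2 ^ n * v + 1"
    proof -
      have "2 ^ n * (u - v) \<le> 2 ^ n * (1 / 2 ^ n)" using that by (intro mult_left_mono) auto
      then show ?thesis by (simp add: algebra_simps)
    qed
    ultimately have "\<lfloor>2 ^ n * u\<rfloor> = \<lfloor>2 ^ n * v\<rfloor> \<or> \<lfloor>2 ^ n * u\<rfloor> = \<lfloor>2 ^ n * v\<rfloor> + 1"
      by linarith
    moreover have "0 \<le> \<lfloor>2 ^ n * v\<rfloor>" using that by simp
    ultimately have "nat \<lfloor>2 ^ n * u\<rfloor> = nat \<lfloor>2 ^ n * v\<rfloor> \<or> nat \<lfloor>2 ^ n * u\<rfloor> = Suc (nat \<lfloor>2 ^ n * v\<rfloor>)"
      by (auto simp: nat_add_distrib)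
    then consider "nat \<lfloor>2 ^ n * u\<rfloor> = nat \<lfloor>2 ^ n * v\<rfloor>" | "nat \<lfloor>2 ^ n * u\<rfloor> = Suc (nat \<lfloor>2 ^ n * v\<rfloor>)"
      by blast
    then show ?thesis
    proof cases
      case 1
      then show ?thesis using A by (simp add: dyadic_floor_def)
    next
      case 2
      have "nat \<lfloor>2 ^ n * v\<rfloor> < L * 2 ^ n"
        by (rule dyadic_index_bound[of u]) (use that 2 in auto)
      from dyadic_regularD[OF x this] show ?thesis unfolding dyadic_floor_def 2 .
    qed
  qed
  have "\<bar>x (dyadic_floor n u) - x (dyadic_floor n v)\<bar> \<le> A L * q ^ n"
  proof (cases "v \<le> u")
    case True
    then show ?thesis using step[of v u] u v uv by simp
  next
    case False
    then show ?thesis using step[of u v] u v uv by (simp add: abs_minus_commute)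
  qed
  moreover have "\<bar>x (dyadic_floor m u) - x (dyadic_floor n u)\<bar> \<le> A L * q / (1 - q) * q ^ n"
    "\<bar>x (dyadic_floor m v) - x (dyadic_floor n v)\<bar> \<le> A L * q / (1 - q) * q ^ n"
    using assms by (intro dyadic_chain; simp)+
  ultimately have "\<bar>x (dyadic_floor m u) - x (dyadic_floor m v)\<bar> \<le>
      A L * q ^ n + 2 * (A L * q / (1 - q) * q ^ n)" by linarith
  also have "\<dots> = chaining_const A q L * q ^ n"
    using A by (simp add: chaining_const_def field_simps)
  finally show ?thesis .
qed

section \<open>Paths with a common modulus of continuity\<close>

definition modulus_set :: "(nat \<Rightarrow> real) \<Rightarrow> real \<Rightarrow> (real \<Rightarrow> real) set" where
  "modulus_set B q = {x. \<forall>L n u v. 0 \<le> u \<and> u \<le> real L \<and> 0 \<le> v \<and> v \<le> real L \<and> \<bar>u - v\<bar> \<le> 1 / 2 ^ n \<longrightarrow>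
     \<bar>x u - x v\<bar> \<le> B L * q ^ n}"

lemma modulus_setD:
  assumes "x \<in> modulus_set B q" "0 \<le> u" "u \<le> real L" "0 \<le> v" "v \<le> real L" "\<bar>u - v\<bar> \<le> 1 / 2 ^ n"
  shows "\<bar>x u - x v\<bar> \<le> B L * q ^ n"
  using assms unfolding modulus_set_def by blast

text \<open>The limit \<open>y\<close> need not be \<open>x\<close>: for a continuous process they
  agree on the half-line, whereas for a process without regular paths \<open>y\<close> is the path
  of its continuous modification.\<close>

lemma modulus_set_dyadic_limit:
  assumes x: "x \<in> dyadic_regular A q" and A: "\<And>L. 0 \<le> A L" "0 < q" "q < 1"
    and lim: "\<And>u. 0 \<le> u \<Longrightarrow> (\<lambda>m. x (dyadic_floor m u)) \<longlonglongrightarrow> y u"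
  shows "y \<in> modulus_set (chaining_const A q) q"
  unfolding modulus_set_def
proof (intro CollectI allI impI, elim conjE)
  fix L n u v
  assume uv: "0 \<le> u" "u \<le> real L" "0 \<le> v" "v \<le> real L" "\<bar>u - v\<bar> \<le> 1 / 2 ^ n"
  have "(\<lambda>m. \<bar>x (dyadic_floor m u) - x (dyadic_floor m v)\<bar>) \<longlonglongrightarrow> \<bar>y u - y v\<bar>"
    by (intro tendsto_intros lim uv)
  moreover have "\<forall>m\<ge>n. \<bar>x (dyadic_floor m u) - x (dyadic_floor m v)\<bar> \<le> chaining_const A q L * q ^ n"
    using dyadic_modulus[OF x uv(1-4) A(1) A(2,3) _ uv(5)] by blast
  ultimately show "\<bar>y u - y v\<bar> \<le> chaining_const A q L * q ^ n"
    by (intro LIMSEQ_le_const2) auto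
qed

lemma modulus_small:
  assumes "0 < q" "q < (1::real)" "0 < e"
  obtains n where "B * q ^ n < e"
proof -
  have "(\<lambda>n. B * q ^ n) \<longlonglongrightarrow> B * 0"
    using assms by (intro tendsto_intros LIMSEQ_realpow_zero) auto
  then have "\<forall>\<^sub>F n in sequentially. B * q ^ n < e"
    using assms(3) by (intro order_tendstoD(2)[of _ "B * 0"]) auto
  then obtain n where "B * q ^ n < e" using eventually_sequentially by fastforce
  then show ?thesis by (rule that)
qed

lemma modulus_set_continuous:
  assumes x: "x \<in> modulus_set B q" and q: "0 < q" "q < 1"
  shows "continuous_on {0..} x"
  unfolding continuous_on_iff
proof (intro ballI allI impI)
  fix u e :: real assume u: "u \<in> {0..}" and e: "0 < e"
  \<comment> \<open>The added 1 leaves room for the points near \<open>u\<close>, which lie within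
    distance \<open>1 / 2 ^ n \<le> 1\<close>.\<close>
  obtain n where n: "B (nat \<lceil>u\<rceil> + 1) * q ^ n < e" by (rule modulus_small[OF q e])
  have uc: "u \<le> real (nat \<lceil>u\<rceil>)" by (rule of_nat_ceiling)
  have "dist (x v) (x u) < e" if v: "v \<in> {0..}" "dist v u < 1 / 2 ^ n" for v
  proof -
    have "(1::real) / 2 ^ n \<le> 1" by simp
    then have "v \<le> real (nat \<lceil>u\<rceil> + 1)" using v uc unfolding dist_real_def by linarith
    moreover have "u \<le> real (nat \<lceil>u\<rceil> + 1)" using uc by linarith
    ultimately have "\<bar>x v - x u\<bar> \<le> B (nat \<lceil>u\<rceil> + 1) * q ^ n"
      using u v by (intro modulus_setD[OF x]; simp add: dist_real_def)
    then show ?thesis using n by (simp add: dist_real_def)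
  qed
  then show "\<exists>d>0. \<forall>v\<in>{0..}. dist v u < d \<longrightarrow> dist (x v) (x u) < e"
    by (intro exI[of _ "1 / 2 ^ n"]) auto
qed

definition modulus_compact :: "(nat \<Rightarrow> real) \<Rightarrow> real \<Rightarrow> (real \<Rightarrow> real) set" where
  "modulus_compact B q = {x \<in> extensional {0..}. x 0 = 0 \<and> x \<in> modulus_set B q}"

text \<open>Starting from the value 0, at most \<open>L\<close> unit steps reach \<open>u\<close>,
  each costing \<open>B L * q ^ 0\<close>.\<close>

lemma modulus_set_bound:
  assumes x: "x \<in> modulus_set B q" "x 0 = 0" and u: "0 \<le> u" "u \<le> real L"
  shows "\<bar>x u\<bar> \<le> real L * B L"
proof -
  have "\<bar>x (min u (real j))\<bar> \<le> real j * B L" for j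
  proof (induction j)
    case 0
    then show ?case using x u by simp
  next
    case (Suc j)
    have "\<bar>x (min u (real (Suc j))) - x (min u (real j))\<bar> \<le> B L * q ^ 0"
      using u by (intro modulus_setD[OF x(1)]) auto
    with Suc show ?case by (simp add: algebra_simps)
  qed
  from this[of L] show ?thesis using u by simp
qed

text \<open>Every condition involves at most two coordinates, so the set is closed for pointwise
  convergence; anchoring the paths at 0 bounds each coordinate and places the set in a product of
  compact factors.\<close>

lemma compact_modulus_compact: "compact (modulus_compact B q)"
proof -
  define C :: "(real \<Rightarrow> real) set" where
    "C = Pi\<^sub>E UNIV (\<lambda>u. if 0 \<le> u then {- (real (nat \<lceil>u\<rceil>) * B (nat \<lceil>u\<rceil>))..real (nat \<lceil>u\<rceil>) * B (nat \<lceil>u\<rceil>)} else {undefined})"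
  have "compactin (product_topology (\<lambda>_. euclideanreal) UNIV) C"
    unfolding C_def compactin_PiE by simp
  then have "compact C" by (simp add: euclidean_product_topology)
  have "modulus_compact B q = C \<inter> {x. x 0 = 0 \<and> x \<in> modulus_set B q}"
  proof (intro equalityI subsetI)
    fix x assume x: "x \<in> modulus_compact B q"
    then have "\<bar>x u\<bar> \<le> real (nat \<lceil>u\<rceil>) * B (nat \<lceil>u\<rceil>)" if "0 \<le> u" for u
      using that by (intro modulus_set_bound[of x]) (auto simp: modulus_compact_def)
    then show "x \<in> C \<inter> {x. x 0 = 0 \<and> x \<in> modulus_set B q}"
      using x by (auto simp: C_def modulus_compact_def PiE_iff extensional_def abs_le_iff minus_le_iff)
  next
    fix x assume "x \<in> C \<inter> {x. x 0 = 0 \<and> x \<in> modulus_set B q}"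
    then show "x \<in> modulus_compact B q"
      by (auto simp: C_def modulus_compact_def PiE_iff extensional_def split: if_splits)
  qed
  moreover have "closed {x :: real \<Rightarrow> real. x 0 = 0 \<and> x \<in> modulus_set B q}"
    unfolding modulus_set_def mem_Collect_eq
    by (intro closed_Collect_conj closed_Collect_all closed_Collect_imp open_Collect_const
        closed_Collect_eq closed_Collect_le continuous_intros continuous_on_product_coordinates)
  ultimately show ?thesis using \<open>compact C\<close> by (simp add: compact_Int_closed)
qed

lemma modulus_compact_subset:
  assumes "0 < q" "q < 1"
  shows "modulus_compact B q \<subseteq> continuous_fun_space {0..}"
  using modulus_set_continuous[OF _ assms] unfolding modulus_compact_def continuous_fun_space_def by blast

text \<open>Arzela--Ascoli: on an equicontinuous set, closeness at finitely many dyadic points implies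
  closeness on a compact interval.\<close>

lemma continuous_map_modulus_compact:
  assumes q: "0 < q" "q < 1"
  shows "continuous_map (top_of_set (modulus_compact B q)) (compact_convergence_topology {0..}) id"
  unfolding compact_convergence_topology_def
proof (rule continuous_on_generated_topo)
  let ?S = "{{g \<in> continuous_fun_space {0..}. \<forall>x\<in>K. dist (g x) (f x) < e} | (f :: real \<Rightarrow> real) K e.
        f \<in> continuous_fun_space {0..} \<and> compact K \<and> K \<subseteq> {0..} \<and> 0 < e}"
  have "\<Union>?S = continuous_fun_space {0..}"
    using topspace_compact_convergence[of "{0..}::real set", where ?'b = real]
    unfolding compact_convergence_topology_def topology_generated_by_topspace .
  then show "id ` topspace (top_of_set (modulus_compact B q)) \<subseteq> \<Union>?S"
    using modulus_compact_subset[OF q] by simp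
  fix U assume "U \<in> ?S"
  then have U: "openin (compact_convergence_topology {0..}) U"
    unfolding compact_convergence_topology_def by (rule topology_generated_by_Basis)
  show "openin (top_of_set (modulus_compact B q)) (id -` U \<inter> topspace (top_of_set (modulus_compact B q)))"
  proof (subst openin_subopen, intro ballI)
    fix g assume "g \<in> id -` U \<inter> topspace (top_of_set (modulus_compact B q))"
    then have g: "g \<in> U" "g \<in> modulus_compact B q" by auto
    obtain L e where e: "0 < e" and LU: "\<And>g'. g' \<in> continuous_fun_space {0..} \<Longrightarrow>
        (\<And>x. x \<in> {0..real L} \<Longrightarrow> \<bar>g' x - g x\<bar> < e) \<Longrightarrow> g' \<in> U"
      using compact_convergence_neighbourhood[OF U g(1)] by blast
    \<comment> \<open>One third of \<open>e\<close> is for the oscillation of \<open>g\<close>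
      between a point and its dyadic rounding, one for that of \<open>g'\<close>, and one for their
      difference at the grid point.\<close>
    obtain n where n: "B L * q ^ n < e / 3" using modulus_small[OF q, of "e / 3"] e by auto
    define V where "V = (\<Inter>k\<in>{..L * 2 ^ n}. {g' :: real \<Rightarrow> real. \<bar>g' (real k / 2 ^ n) - g (real k / 2 ^ n)\<bar> < e / 3})"
    have "open V" unfolding V_def
      by (intro open_INT finite_atMost ballI open_Collect_less continuous_intros continuous_on_product_coordinates)
    then have "openin (top_of_set (modulus_compact B q)) (modulus_compact B q \<inter> V)"
      by (rule openin_open_Int)
    moreover have "g \<in> modulus_compact B q \<inter> V"
      using g e by (simp add: V_def)
    moreover have "modulus_compact B q \<inter> V \<subseteq> id -` U \<inter> topspace (top_of_set (modulus_compact B q))"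
    proof
      fix g' assume g': "g' \<in> modulus_compact B q \<inter> V"
      have "\<bar>g' x - g x\<bar> < e" if x: "x \<in> {0..real L}" for x
      proof -
        let ?y = "dyadic_floor n x"
        have y: "0 \<le> ?y" "?y \<le> real L" "\<bar>x - ?y\<bar> \<le> 1 / 2 ^ n"
          using dyadic_floor_bounds[of x n] x by auto
        have "nat \<lfloor>2 ^ n * x\<rfloor> \<le> L * 2 ^ n"
        proof -
          have "real (nat \<lfloor>2 ^ n * x\<rfloor>) \<le> 2 ^ n * x" using x by simp
          also have "\<dots> \<le> 2 ^ n * real L" using x by simp
          finally have "real (nat \<lfloor>2 ^ n * x\<rfloor>) \<le> real (L * 2 ^ n)" by (simp add: mult.commute)
          then show ?thesis by (simp only: of_nat_le_iff)
        qed
        then have close: "\<bar>g' ?y - g ?y\<bar> < e / 3"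
          using g' unfolding V_def dyadic_floor_def by blast
        have mod: "\<bar>f x - f ?y\<bar> \<le> B L * q ^ n" if "f \<in> modulus_compact B q" for f
          using that x y by (intro modulus_setD) (auto simp: modulus_compact_def)
        have "\<bar>g x - g ?y\<bar> \<le> B L * q ^ n" "\<bar>g' x - g' ?y\<bar> \<le> B L * q ^ n"
          using mod g g' by auto
        then show ?thesis using n close by linarith
      qed
      moreover have "g' \<in> continuous_fun_space {0..}" using modulus_compact_subset[OF q] g' by blast
      ultimately show "g' \<in> id -` U \<inter> topspace (top_of_set (modulus_compact B q))"
        using LU g' by simp
    qed
    ultimately show "\<exists>T. openin (top_of_set (modulus_compact B q)) T \<and> g \<in> T \<and>
        T \<subseteq> id -` U \<inter> topspace (top_of_set (modulus_compact B q))" by blast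
  qed
qed

text \<open>With this threshold the union bound over \<^term>\<open>L\<close>, \<^term>\<open>n\<close> and the dyadic intervals of
  level \<^term>\<open>n\<close> in \<^term>\<open>{0..real L}\<close> sums to at most \<^term>\<open>\<delta>\<close>.\<close>

definition tightness_const :: "(nat \<Rightarrow> real) \<Rightarrow> real \<Rightarrow> real \<Rightarrow> nat \<Rightarrow> real" where
  "tightness_const C q \<delta> L = sqrt ((real L * C L + 1) * 2 ^ Suc L / (\<delta> * (1 - q\<^sup>2)))"

text \<open>Of the factor \<open>q ^ (4 * n)\<close>, Markov's inequality with threshold
  \<open>A L * q ^ n\<close> uses up \<open>q ^ (2 * n)\<close>. The denominator
  \<open>2 ^ n\<close> compensates the \<open>L * 2 ^ n\<close> intervals, and the remaining
  \<open>q ^ (2 * n)\<close> is summable.\<close>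

lemma prob_not_dyadic_regular:
  assumes M: "prob_space M" and Y: "\<And>u. 0 \<le> u \<Longrightarrow> Y u \<in> borel_measurable M"
    and q: "0 < q" "q < 1" and C: "\<And>L. 0 \<le> C L" and \<delta>: "0 < \<delta>"
    and int: "\<And>u v. 0 \<le> u \<Longrightarrow> 0 \<le> v \<Longrightarrow> integrable M (\<lambda>\<omega>. (Y u \<omega> - Y v \<omega>)\<^sup>2)"
    and bound: "\<And>L n k. k < L * 2 ^ n \<Longrightarrow>
      (\<integral>\<omega>. (Y (real (Suc k) / 2 ^ n) \<omega> - Y (real k / 2 ^ n) \<omega>)\<^sup>2 \<partial>M) \<le> C L * q ^ (4 * n) / 2 ^ n"
  shows "{\<omega> \<in> space M. (\<lambda>u. Y u \<omega>) \<notin> dyadic_regular (tightness_const C q \<delta>) q} \<in> sets M" (is "?N \<in> _")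
    and "measure M {\<omega> \<in> space M. (\<lambda>u. Y u \<omega>) \<notin> dyadic_regular (tightness_const C q \<delta>) q} \<le> \<delta>"
proof -
  interpret prob_space M by fact
  let ?A = "tightness_const C q \<delta>"
  have q2: "0 < 1 - q\<^sup>2" using q by (simp add: power_less_one_iff)
  have A: "0 < ?A L" "(?A L)\<^sup>2 = (real L * C L + 1) * 2 ^ Suc L / (\<delta> * (1 - q\<^sup>2))" for L
  proof -
    \<comment> \<open>The 1 added to \<open>real L * C L\<close> keeps the threshold positive, so it
      can be divided by, when \<open>L\<close> or \<open>C L\<close> is 0.\<close>
    have "0 < (real L * C L + 1) * 2 ^ Suc L / (\<delta> * (1 - q\<^sup>2))"
      using C[of L] \<delta> q2 by (intro divide_pos_pos mult_pos_pos add_nonneg_pos mult_nonneg_nonneg) auto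
    then show "0 < ?A L" "(?A L)\<^sup>2 = (real L * C L + 1) * 2 ^ Suc L / (\<delta> * (1 - q\<^sup>2))"
      by (simp_all add: tightness_const_def)
  qed
  have [measurable]: "Y (real i / 2 ^ n) \<in> borel_measurable M" for i n by (rule Y) simp
  define E where "E L n k = {\<omega> \<in> space M. \<not> \<bar>Y (real (Suc k) / 2 ^ n) \<omega> - Y (real k / 2 ^ n) \<omega>\<bar> \<le> ?A L * q ^ n}" for L n k
  have E [measurable]: "E L n k \<in> sets M" for L n k unfolding E_def by measurable
  have N: "?N = (\<Union>L. \<Union>n. \<Union>k\<in>{..<L * 2 ^ n}. E L n k)"
    unfolding dyadic_regular_def E_def by blast
  show "?N \<in> sets M" unfolding N by measurable
  have mE: "measure M (E L n k) \<le> C L * q ^ (2 * n) / 2 ^ n / (?A L)\<^sup>2" if "k < L * 2 ^ n" for L n k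
  proof -
    let ?D = "\<lambda>\<omega>. (Y (real (Suc k) / 2 ^ n) \<omega> - Y (real k / 2 ^ n) \<omega>)\<^sup>2"
    have pos: "0 < ?A L * q ^ n" using A(1)[of L] q by simp
    have "E L n k \<subseteq> {\<omega> \<in> space M. (?A L * q ^ n)\<^sup>2 \<le> ?D \<omega>}"
      unfolding E_def using pos by (auto simp: abs_le_square_iff[symmetric])
    then have "measure M (E L n k) \<le> measure M {\<omega> \<in> space M. (?A L * q ^ n)\<^sup>2 \<le> ?D \<omega>}"
      by (intro finite_measure_mono) measurable
    also have "\<dots> \<le> (\<integral>\<omega>. ?D \<omega> \<partial>M) / (?A L * q ^ n)\<^sup>2"
      using zero_less_power[OF pos, of 2] by (intro integral_Markov_inequality_measure[where A = "{}"] int) auto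
    also have "\<dots> \<le> (C L * q ^ (4 * n) / 2 ^ n) / (?A L * q ^ n)\<^sup>2"
      by (intro divide_right_mono bound that) simp
    also have "\<dots> = C L * q ^ (2 * n) / 2 ^ n / (?A L)\<^sup>2"
    proof -
      have "q ^ (4 * n) = q ^ (2 * n) * (q ^ n)\<^sup>2" by (simp add: power_mult[symmetric] power_add[symmetric] mult.commute)
      then show ?thesis using q by (simp add: power_mult_distrib)
    qed
    finally show ?thesis .
  qed
  \<comment> \<open>The weights \<open>(1 - q\<^sup>2) * (q\<^sup>2) ^ n\<close> sum to 1 over
    \<open>n\<close>, and \<open>1 / 2 ^ Suc L\<close> to 1 over \<open>L\<close>.\<close>
  have mn: "measure M (\<Union>k\<in>{..<L * 2 ^ n}. E L n k) \<le> \<delta> * (1 - q\<^sup>2) / 2 ^ Suc L * (q\<^sup>2) ^ n" for L n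
  proof -
    have "measure M (\<Union>k\<in>{..<L * 2 ^ n}. E L n k) \<le> (\<Sum>k<L * 2 ^ n. measure M (E L n k))"
      by (intro finite_measure_subadditive_finite) auto
    also have "\<dots> \<le> (\<Sum>k<L * 2 ^ n. C L * q ^ (2 * n) / 2 ^ n / (?A L)\<^sup>2)"
      by (intro sum_mono mE) auto
    also have "\<dots> = real L * C L / (?A L)\<^sup>2 * (q\<^sup>2) ^ n"
      by (simp add: power_mult)
    also have "\<dots> \<le> \<delta> * (1 - q\<^sup>2) / 2 ^ Suc L * (q\<^sup>2) ^ n"
    proof (rule mult_right_mono)
      have "real L * C L / (?A L)\<^sup>2 = real L * C L / (real L * C L + 1) * (\<delta> * (1 - q\<^sup>2) / 2 ^ Suc L)"
        unfolding A(2) by simp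
      also have "\<dots> \<le> 1 * (\<delta> * (1 - q\<^sup>2) / 2 ^ Suc L)"
        using C[of L] \<delta> q2 by (intro mult_right_mono) (auto simp: divide_le_eq_1 add_nonneg_pos)
      finally show "real L * C L / (?A L)\<^sup>2 \<le> \<delta> * (1 - q\<^sup>2) / 2 ^ Suc L" by simp
    qed (use q in simp)
    finally show ?thesis .
  qed
  have geo: "(\<lambda>n. c * r ^ n) sums (c / (1 - r))" if "0 \<le> r" "r < 1" for c r :: real
    using sums_mult[OF geometric_sums[of r], of c] that by simp
  have countable_bound: "measure M (\<Union>i. S i) \<le> s"
    if S: "\<And>i. S i \<in> sets M" "\<And>i. measure M (S i) \<le> c i" and c: "c sums s" for S c s
  proof -
    have sm: "summable (\<lambda>i. measure M (S i))"
      by (rule summable_comparison_test'[OF sums_summable[OF c], of 0]) (use S in auto)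
    have "measure M (\<Union>i. S i) \<le> (\<Sum>i. measure M (S i))"
      using S sm by (intro finite_measure_subadditive_countably) auto
    also have "\<dots> \<le> (\<Sum>i. c i)"
      by (intro suminf_le sm sums_summable[OF c] S)
    finally show ?thesis using sums_unique[OF c] by simp
  qed
  have mL: "measure M (\<Union>n. \<Union>k\<in>{..<L * 2 ^ n}. E L n k) \<le> \<delta> / 2 * (1 / 2) ^ L" for L
  proof -
    have "measure M (\<Union>n. \<Union>k\<in>{..<L * 2 ^ n}. E L n k) \<le> \<delta> * (1 - q\<^sup>2) / 2 ^ Suc L / (1 - q\<^sup>2)"
      using q2 by (intro countable_bound[OF _ mn geo]) auto
    also have "\<dots> = \<delta> / 2 * (1 / 2) ^ L" using q2 by (simp add: power_one_over)
    finally show ?thesis .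
  qed
  have "measure M (\<Union>L. \<Union>n. \<Union>k\<in>{..<L * 2 ^ n}. E L n k) \<le> \<delta> / 2 / (1 - 1 / 2)"
    by (intro countable_bound[OF _ mL geo]) auto
  then show "measure M ?N \<le> \<delta>" unfolding N by simp
qed

text \<open>Almost surely the path is regular on dyadic points and has a continuous extension from
  them. Mean-square continuity identifies the extension with the given variable at each fixed
  time.\<close>

lemma continuous_modification:
  fixes Z :: "real \<Rightarrow> 'v \<Rightarrow> real"
  assumes Q: "prob_space Q" and Z: "\<And>u. 0 \<le> u \<Longrightarrow> Z u \<in> borel_measurable Q"
    and q: "0 < q" "q < 1" and C: "\<And>L. 0 \<le> C L"
    and int: "\<And>u v. 0 \<le> u \<Longrightarrow> 0 \<le> v \<Longrightarrow> integrable Q (\<lambda>\<omega>. (Z u \<omega> - Z v \<omega>)\<^sup>2)"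
    and bound: "\<And>L n k. k < L * 2 ^ n \<Longrightarrow>
      (\<integral>\<omega>. (Z (real (Suc k) / 2 ^ n) \<omega> - Z (real k / 2 ^ n) \<omega>)\<^sup>2 \<partial>Q) \<le> C L * q ^ (4 * n) / 2 ^ n"
    and mean_square: "\<And>u. 0 \<le> u \<Longrightarrow> (\<lambda>m. \<integral>\<omega>. (Z (dyadic_floor m u) \<omega> - Z u \<omega>)\<^sup>2 \<partial>Q) \<longlonglongrightarrow> 0"
  obtains W where "is_modification Q {0..} W Z" "\<And>\<omega>. \<omega> \<in> space Q \<Longrightarrow> continuous_on {0..} (\<lambda>u. W u \<omega>)"
proof -
  interpret prob_space Q by fact
  define A where "A j = tightness_const C q (1 / real (Suc j))" for j
  have A_nonneg: "0 \<le> A j L" for j L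
    unfolding A_def tightness_const_def using C[of L] q
    by (intro real_sqrt_ge_zero divide_nonneg_nonneg mult_nonneg_nonneg add_nonneg_nonneg) (auto simp: power_le_one)
  define N where "N j = {\<omega> \<in> space Q. (\<lambda>u. Z u \<omega>) \<notin> dyadic_regular (A j) q}" for j
  have N: "N j \<in> sets Q" "measure Q (N j) \<le> 1 / real (Suc j)" for j
    unfolding N_def A_def
    by (rule prob_not_dyadic_regular[OF Q Z q C _ int bound]; simp)+
  \<comment> \<open>The failure probability at constants \<open>A j\<close> is at most
    \<open>1 / real (Suc j)\<close>, so failing for every \<open>j\<close> is a null event.\<close>
  define \<Omega> where "\<Omega> = space Q - (\<Inter>j. N j)"
  have \<Omega>: "\<Omega> \<in> sets Q" unfolding \<Omega>_def using N(1) by auto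
  have "measure Q (\<Inter>j. N j) \<le> 1 / real (Suc j)" for j
    by (rule order_trans[OF finite_measure_mono[OF _ N(1)] N(2)]) auto
  then have "measure Q (\<Inter>j. N j) \<le> 0"
    by (intro LIMSEQ_le_const[OF LIMSEQ_inverse_real_of_nat]) (auto simp: inverse_eq_divide)
  then have "emeasure Q (\<Inter>j. N j) = 0"
    by (simp add: emeasure_eq_measure measure_le_0_iff)
  moreover have "(\<Inter>j. N j) \<in> sets Q" using N(1) by auto
  ultimately have AE_\<Omega>: "AE \<omega> in Q. \<omega> \<in> \<Omega>"
    by (intro AE_I[where N = "\<Inter>j. N j"]) (auto simp: \<Omega>_def)
  \<comment> \<open>The value 0 off \<open>\<Omega>\<close> makes every path continuous, not only
    almost every one.\<close>
  define W where "W u \<omega> = (if \<omega> \<in> \<Omega> then lim (\<lambda>m. Z (dyadic_floor m u) \<omega>) else 0)" for u \<omega>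
  have regular: "\<exists>j. (\<lambda>u. Z u \<omega>) \<in> dyadic_regular (A j) q" if "\<omega> \<in> \<Omega>" for \<omega>
    using that by (auto simp: \<Omega>_def N_def)
  have lim: "(\<lambda>m. Z (dyadic_floor m u) \<omega>) \<longlonglongrightarrow> W u \<omega>" if \<omega>: "\<omega> \<in> \<Omega>" and u: "0 \<le> u" for u \<omega>
  proof -
    obtain j where j: "(\<lambda>u. Z u \<omega>) \<in> dyadic_regular (A j) q" using regular[OF \<omega>] by blast
    let ?B = "A j (nat \<lceil>u\<rceil>) * q / (1 - q)"
    have "Cauchy (\<lambda>m. Z (dyadic_floor m u) \<omega>)"
    proof (rule metric_CauchyI)
      fix e :: real assume "0 < e"
      then obtain n where n: "?B * q ^ n < e / 2" using modulus_small[OF q, of "e / 2" ?B] by auto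
      have *: "\<bar>Z (dyadic_floor m u) \<omega> - Z (dyadic_floor n u) \<omega>\<bar> < e / 2" if "n \<le> m" for m
        by (rule le_less_trans[OF dyadic_chain[OF j u of_nat_ceiling A_nonneg q that] n])
      show "\<exists>n. \<forall>m\<ge>n. \<forall>k\<ge>n. dist (Z (dyadic_floor m u) \<omega>) (Z (dyadic_floor k u) \<omega>) < e"
      proof (intro exI[of _ n] allI impI)
        fix m k assume "n \<le> m" "n \<le> k"
        with *[of m] *[of k] show "dist (Z (dyadic_floor m u) \<omega>) (Z (dyadic_floor k u) \<omega>) < e"
          unfolding dist_real_def by linarith
      qed
    qed
    then have "convergent (\<lambda>m. Z (dyadic_floor m u) \<omega>)" by (rule Cauchy_convergent)
    then show ?thesis using \<omega> by (simp add: W_def convergent_LIMSEQ_iff)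
  qed
  have cont: "continuous_on {0..} (\<lambda>u. W u \<omega>)" for \<omega>
  proof (cases "\<omega> \<in> \<Omega>")
    case True
    then obtain j where j: "(\<lambda>u. Z u \<omega>) \<in> dyadic_regular (A j) q" using regular by blast
    have "(\<lambda>u. W u \<omega>) \<in> modulus_set (chaining_const (A j) q) q"
      by (rule modulus_set_dyadic_limit[OF j A_nonneg q]) (rule lim[OF True])
    then show ?thesis using q by (rule modulus_set_continuous)
  next
    case False
    then show ?thesis by (simp add: W_def)
  qed
  have W_meas: "W u \<in> borel_measurable Q" if "0 \<le> u" for u
  proof -
    have [measurable]: "Z (dyadic_floor m u) \<in> borel_measurable Q" for m by (rule Z) simp
    have "(\<lambda>\<omega>. lim (\<lambda>m. Z (dyadic_floor m u) \<omega>)) \<in> borel_measurable Q"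
      by (rule borel_measurable_lim_metric) measurable
    then show ?thesis unfolding W_def
      by (rule measurable_If_set) (use \<Omega> in auto)
  qed
  have ae: "AE \<omega> in Q. W u \<omega> = Z u \<omega>" if u: "0 \<le> u" for u
  proof -
    have [measurable]: "Z (dyadic_floor m u) \<in> borel_measurable Q" "Z u \<in> borel_measurable Q"
      "W u \<in> borel_measurable Q" for m by (auto intro: Z W_meas u)
    \<comment> \<open>Fatou's lemma bounds the mean-square distance between \<open>W u\<close> and
      \<open>Z u\<close> by the limit of those along the dyadic approximations, which is 0.\<close>
    have "(\<integral>\<^sup>+\<omega>. ennreal ((W u \<omega> - Z u \<omega>)\<^sup>2) \<partial>Q) =
        (\<integral>\<^sup>+\<omega>. liminf (\<lambda>m. ennreal ((Z (dyadic_floor m u) \<omega> - Z u \<omega>)\<^sup>2)) \<partial>Q)"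
    proof (rule nn_integral_cong_AE)
      show "AE \<omega> in Q. ennreal ((W u \<omega> - Z u \<omega>)\<^sup>2) = liminf (\<lambda>m. ennreal ((Z (dyadic_floor m u) \<omega> - Z u \<omega>)\<^sup>2))"
        using AE_\<Omega>
      proof eventually_elim
        case (elim \<omega>)
        have "(\<lambda>m. ennreal ((Z (dyadic_floor m u) \<omega> - Z u \<omega>)\<^sup>2)) \<longlonglongrightarrow> ennreal ((W u \<omega> - Z u \<omega>)\<^sup>2)"
          by (intro tendsto_intros tendsto_ennrealI lim elim u)
        then show ?case by (intro lim_imp_Liminf[symmetric]) auto
      qed
    qed
    also have "\<dots> \<le> liminf (\<lambda>m. \<integral>\<^sup>+\<omega>. ennreal ((Z (dyadic_floor m u) \<omega> - Z u \<omega>)\<^sup>2) \<partial>Q)"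
      by (rule nn_integral_liminf) measurable
    also have "\<dots> = 0"
    proof (rule lim_imp_Liminf)
      have "(\<integral>\<^sup>+\<omega>. ennreal ((Z (dyadic_floor m u) \<omega> - Z u \<omega>)\<^sup>2) \<partial>Q) =
          ennreal (\<integral>\<omega>. (Z (dyadic_floor m u) \<omega> - Z u \<omega>)\<^sup>2 \<partial>Q)" for m
        by (rule nn_integral_eq_integral[OF int]) (use u in auto)
      then show "(\<lambda>m. \<integral>\<^sup>+\<omega>. ennreal ((Z (dyadic_floor m u) \<omega> - Z u \<omega>)\<^sup>2) \<partial>Q) \<longlonglongrightarrow> 0"
        using tendsto_ennrealI[OF mean_square[OF u]] by simp
    qed simp
    finally have "(\<integral>\<^sup>+\<omega>. ennreal ((W u \<omega> - Z u \<omega>)\<^sup>2) \<partial>Q) = 0" by simp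
    then have "AE \<omega> in Q. ennreal ((W u \<omega> - Z u \<omega>)\<^sup>2) = 0"
      by (subst (asm) nn_integral_0_iff_AE) auto
    then show ?thesis by eventually_elim simp
  qed
  show ?thesis
    by (rule that[of W]) (use W_meas ae cont in \<open>auto simp: is_modification_def\<close>)
qed

lemma path_in_modulus_compact:
  assumes "continuous_on {0..} x" "x 0 = 0" "x \<in> dyadic_regular A q" "\<And>L. 0 \<le> A L" "0 < q" "q < 1"
  shows "(\<lambda>u\<in>{0..}. x u) \<in> modulus_compact (chaining_const A q) q"
proof -
  have "x \<in> modulus_set (chaining_const A q) q"
    by (rule modulus_set_dyadic_limit[OF assms(3-6)])
      (auto intro!: continuous_on_tendsto_compose[OF assms(1)] dyadic_floor_tendsto)
  then show ?thesis using assms(2) by (auto simp: modulus_compact_def modulus_set_def)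
qed

lemma centered_gaussian_family_increment_integrable:
  assumes Y: "centered_gaussian_family M I Y" and "i \<in> I" "j \<in> I"
  shows "integrable M (\<lambda>\<omega>. (Y i \<omega> - Y j \<omega>)\<^sup>2)"
proof -
  have "integrable M (\<lambda>\<omega>. Y i \<omega> * Y i \<omega> - 2 * (Y i \<omega> * Y j \<omega>) + Y j \<omega> * Y j \<omega>)"
    using assms by (intro Bochner_Integration.integrable_add Bochner_Integration.integrable_diff
        integrable_mult_right centered_gaussian_family_integrable)
  then show ?thesis by (simp add: power2_eq_square algebra_simps)
qed

lemma continuous_map_evaluation:
  assumes "u \<in> A"
  shows "continuous_map (compact_convergence_topology A) euclideanreal (\<lambda>x. x u)"
  unfolding continuous_map_def
proof (intro conjI allI impI)
  fix U :: "real set" assume "openin euclideanreal U"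
  then have U: "open U" by simp
  let ?T = "compact_convergence_topology A :: ('a \<Rightarrow> real) topology"
  show "openin ?T {x \<in> topspace ?T. x u \<in> U}"
  proof (subst openin_subopen, intro ballI)
    fix g :: "'a \<Rightarrow> real" assume "g \<in> {x \<in> topspace ?T. x u \<in> U}"
    then have g: "g \<in> continuous_fun_space A" "g u \<in> U" by auto
    obtain e where e: "0 < e" "ball (g u) e \<subseteq> U" using U g(2) openE by blast
    let ?V = "{g' \<in> continuous_fun_space A. \<forall>x\<in>{u}. dist (g' x) (g x) < e}"
    have "openin ?T ?V"
      unfolding compact_convergence_topology_def
      using g(1) e(1) assms
      by (intro topology_generated_by_Basis CollectI exI[of _ g] exI[of _ "{u}"] exI[of _ e]) auto
    moreover have "?V \<subseteq> {x \<in> topspace ?T. x u \<in> U}"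
      using e(2) by (auto simp: dist_commute)
    ultimately show "\<exists>V. openin ?T V \<and> g \<in> V \<and> V \<subseteq> {x \<in> topspace ?T. x u \<in> U}"
      using g(1) e(1) by (intro exI[of _ ?V]) auto
  qed
qed auto

text \<open>Covariances give the characteristic functions; the increment bounds, shared by the
  processes and the limit, place both in one compact path set up to probability
  \<open>\<delta>\<close>. Only the limit needs a modification.\<close>

lemma gaussian_process_convergence:
  fixes Y :: "'e \<Rightarrow> real \<Rightarrow> 'w \<Rightarrow> real" and Z W :: "real \<Rightarrow> 'v \<Rightarrow> real"
  assumes M: "prob_space M" and N: "prob_space N"
    and Y: "\<forall>\<^sub>F e in F. centered_gaussian_family M {0..} (Y e)" and Z: "centered_gaussian_family N {0..} Z"
    and cov: "\<And>u v. 0 \<le> u \<Longrightarrow> 0 \<le> v \<Longrightarrow>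
      ((\<lambda>e. \<integral>\<omega>. Y e u \<omega> * Y e v \<omega> \<partial>M) \<longlongrightarrow> (\<integral>\<omega>. Z u \<omega> * Z v \<omega> \<partial>N)) F"
    and paths: "\<forall>\<^sub>F e in F. \<forall>\<omega>\<in>space M. continuous_on {0..} (\<lambda>u. Y e u \<omega>) \<and> Y e 0 \<omega> = 0"
    and Z0: "(\<integral>\<omega>. (Z 0 \<omega>)\<^sup>2 \<partial>N) = 0"
    and q: "0 < q" "q < 1" and C: "\<And>L. 0 \<le> C L"
    and Y_bound: "\<forall>\<^sub>F e in F. \<forall>L n k. k < L * 2 ^ n \<longrightarrow>
      (\<integral>\<omega>. (Y e (real (Suc k) / 2 ^ n) \<omega> - Y e (real k / 2 ^ n) \<omega>)\<^sup>2 \<partial>M) \<le> C L * q ^ (4 * n) / 2 ^ n"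
    and Z_bound: "\<And>L n k. k < L * 2 ^ n \<Longrightarrow>
      (\<integral>\<omega>. (Z (real (Suc k) / 2 ^ n) \<omega> - Z (real k / 2 ^ n) \<omega>)\<^sup>2 \<partial>N) \<le> C L * q ^ (4 * n) / 2 ^ n"
    and W: "is_modification N {0..} W Z"
    and W_cont: "\<And>\<omega>. \<omega> \<in> space N \<Longrightarrow> continuous_on {0..} (\<lambda>u. W u \<omega>)"
  shows "converges_in_distribution (compact_convergence_topology {0..})
    M (\<lambda>e \<omega>. \<lambda>u\<in>{0..}. Y e u \<omega>) N (\<lambda>\<omega>. \<lambda>u\<in>{0..}. W u \<omega>) F"
proof -
  interpret M: prob_space M by fact
  interpret N: prob_space N by fact
  have Y_meas: "Y e u \<in> borel_measurable M" if "centered_gaussian_family M {0..} (Y e)" "0 \<le> u" for e u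
    using that by (intro centered_gaussian_rv_measurable centered_gaussian_family_member[where I = "{0..}"]) auto
  have Z_meas: "Z u \<in> borel_measurable N" if "0 \<le> u" for u
    using Z that by (intro centered_gaussian_rv_measurable centered_gaussian_family_member[where I = "{0..}"]) auto
  have W_meas: "W u \<in> borel_measurable N" and WZ: "AE \<omega> in N. W u \<omega> = Z u \<omega>" if "0 \<le> u" for u
    using W that by (auto simp: is_modification_def)
  have A_nonneg: "0 \<le> tightness_const C q \<delta> L" if "0 < \<delta>" for \<delta> L
    unfolding tightness_const_def using C[of L] q that
    by (intro real_sqrt_ge_zero divide_nonneg_nonneg mult_nonneg_nonneg add_nonneg_nonneg) (auto simp: power_le_one)
  have "AE \<omega> in N. (Z 0 \<omega>)\<^sup>2 = 0"
    using Z0 centered_gaussian_rv_square_integrable[OF centered_gaussian_family_member[OF Z], of 0]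
    by (subst integral_nonneg_eq_0_iff_AE[symmetric]) auto
  with WZ[of 0] have W0: "AE \<omega> in N. W 0 \<omega> = 0"
    by (auto elim!: eventually_elim2)
  have W_increment: "(\<integral>\<omega>. (W u \<omega> - W v \<omega>)\<^sup>2 \<partial>N) = (\<integral>\<omega>. (Z u \<omega> - Z v \<omega>)\<^sup>2 \<partial>N)"
    "integrable N (\<lambda>\<omega>. (W u \<omega> - W v \<omega>)\<^sup>2)" if "0 \<le> u" "0 \<le> v" for u v
  proof -
    have ae: "AE \<omega> in N. (W u \<omega> - W v \<omega>)\<^sup>2 = (Z u \<omega> - Z v \<omega>)\<^sup>2"
      using WZ[OF that(1)] WZ[OF that(2)] by eventually_elim simp
    have [measurable]: "W u \<in> borel_measurable N" "W v \<in> borel_measurable N"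
      "Z u \<in> borel_measurable N" "Z v \<in> borel_measurable N" using that W_meas Z_meas by auto
    show "(\<integral>\<omega>. (W u \<omega> - W v \<omega>)\<^sup>2 \<partial>N) = (\<integral>\<omega>. (Z u \<omega> - Z v \<omega>)\<^sup>2 \<partial>N)"
      by (rule integral_cong_AE[OF _ _ ae]) measurable
    show "integrable N (\<lambda>\<omega>. (W u \<omega> - W v \<omega>)\<^sup>2)"
      using centered_gaussian_family_increment_integrable[OF Z, of u v] that
      by (subst integrable_cong_AE[OF _ _ ae]) auto
  qed
  show ?thesis
  proof (rule converges_in_distribution_criterion[OF M N, where I = "{0..}"])
    show "\<forall>\<^sub>F e in F. (\<lambda>\<omega>. \<lambda>u\<in>{0..}. Y e u \<omega>) \<in> measurable M (borel_of (compact_convergence_topology {0..}))"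
      using Y paths by eventually_elim (rule measurable_compact_convergence[OF Y_meas], auto)
    show "(\<lambda>\<omega>. \<lambda>u\<in>{0..}. W u \<omega>) \<in> measurable N (borel_of (compact_convergence_topology {0..}))"
      by (rule measurable_compact_convergence[OF W_meas W_cont])
    show "continuous_map (compact_convergence_topology {0..}) euclideanreal (\<lambda>x. x u)" if "u \<in> {0..}" for u
      using that by (rule continuous_map_evaluation)
  next
    fix l :: "(real \<Rightarrow> real) \<Rightarrow> real" assume l: "l \<in> linear_forms {0..}"
    \<comment> \<open>The exceptional null set of a modification depends on the time, but a linear
      form sees finitely many times.\<close>
    have AE_l: "AE \<omega> in N. l (\<lambda>u. W u \<omega>) = l (\<lambda>u. Z u \<omega>)"
      and l_W: "(\<lambda>\<omega>. l (\<lambda>u. W u \<omega>)) \<in> borel_measurable N" and l_Z: "(\<lambda>\<omega>. l (\<lambda>u. Z u \<omega>)) \<in> borel_measurable N"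
    proof -
      obtain J c where J: "finite J" "J \<subseteq> {0..}" and l': "l = (\<lambda>x. \<Sum>i\<in>J. c i * x i)"
        using l by (auto simp: linear_forms_def)
      have "AE \<omega> in N. \<forall>i\<in>J. W i \<omega> = Z i \<omega>"
        using J WZ by (intro AE_finite_allI) auto
      then show "AE \<omega> in N. l (\<lambda>u. W u \<omega>) = l (\<lambda>u. Z u \<omega>)"
        by eventually_elim (auto simp: l')
      show "(\<lambda>\<omega>. l (\<lambda>u. W u \<omega>)) \<in> borel_measurable N" "(\<lambda>\<omega>. l (\<lambda>u. Z u \<omega>)) \<in> borel_measurable N"
        unfolding l' using J W_meas Z_meas by (auto intro!: borel_measurable_sum borel_measurable_times)
    qed
    have "(\<integral>\<omega>. cos (l (\<lambda>u. W u \<omega>)) \<partial>N) = (\<integral>\<omega>. cos (l (\<lambda>u. Z u \<omega>)) \<partial>N)"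
      "(\<integral>\<omega>. sin (l (\<lambda>u. W u \<omega>)) \<partial>N) = (\<integral>\<omega>. sin (l (\<lambda>u. Z u \<omega>)) \<partial>N)"
      using l_W l_Z AE_l by (auto intro!: integral_cong_AE)
    then show "((\<lambda>e. \<integral>\<omega>. cos (l (\<lambda>u\<in>{0..}. Y e u \<omega>)) \<partial>M) \<longlongrightarrow> (\<integral>\<omega>. cos (l (\<lambda>u\<in>{0..}. W u \<omega>)) \<partial>N)) F"
      and "((\<lambda>e. \<integral>\<omega>. sin (l (\<lambda>u\<in>{0..}. Y e u \<omega>)) \<partial>M) \<longlongrightarrow> (\<integral>\<omega>. sin (l (\<lambda>u\<in>{0..}. W u \<omega>)) \<partial>N)) F"
      unfolding linear_forms_restrict[OF l]
      using gaussian_char_convergence[OF M N Y Z _ l] cov by auto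
  next
    fix \<delta> :: real assume \<delta>: "\<delta> > 0"
    define A where "A = tightness_const C q \<delta>"
    have A: "0 \<le> A L" for L unfolding A_def by (rule A_nonneg[OF \<delta>])
    let ?K = "modulus_compact (chaining_const A q) q"
    have "\<forall>\<^sub>F e in F. \<exists>B\<in>sets M. measure M B \<le> \<delta> \<and> (\<forall>\<omega>\<in>space M - B. (\<lambda>u\<in>{0..}. Y e u \<omega>) \<in> ?K)"
      using Y paths Y_bound
    proof eventually_elim
      case (elim e)
      let ?B = "{\<omega> \<in> space M. (\<lambda>u. Y e u \<omega>) \<notin> dyadic_regular A q}"
      have "?B \<in> sets M" "measure M ?B \<le> \<delta>"
        unfolding A_def
        by (rule prob_not_dyadic_regular[OF M Y_meas[OF elim(1)] q C \<delta>];
            use elim in \<open>auto intro: centered_gaussian_family_increment_integrable\<close>)+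
      moreover have "(\<lambda>u\<in>{0..}. Y e u \<omega>) \<in> ?K" if "\<omega> \<in> space M - ?B" for \<omega>
        by (rule path_in_modulus_compact) (use that elim(2) A q in auto)
      ultimately show ?case by blast
    qed
    moreover have "\<exists>B\<in>sets N. measure N B \<le> \<delta> \<and> (\<forall>\<omega>\<in>space N - B. (\<lambda>u\<in>{0..}. W u \<omega>) \<in> ?K)"
    proof -
      \<comment> \<open>The compact set requires the value 0 at time 0, which \<open>W\<close> has
        only almost surely.\<close>
      let ?B = "{\<omega> \<in> space N. (\<lambda>u. W u \<omega>) \<notin> dyadic_regular A q}" and ?D = "{\<omega> \<in> space N. W 0 \<omega> \<noteq> 0}"
      have B: "?B \<in> sets N" "measure N ?B \<le> \<delta>"
        unfolding A_def
        by (rule prob_not_dyadic_regular[OF N W_meas q C \<delta>]; simp add: W_increment Z_bound del: of_nat_Suc)+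
      have "?D \<in> sets N" using W_meas[of 0] by measurable
      moreover have "measure N ?D = 0"
        using W0 \<open>?D \<in> sets N\<close> by (simp add: AE_iff_measurable[OF _ refl] measure_def)
      ultimately have "?B \<union> ?D \<in> sets N" "measure N (?B \<union> ?D) \<le> \<delta>"
        using B measure_Un_le[OF B(1), of ?D] by (auto simp del: Un_iff)
      moreover have "(\<lambda>u\<in>{0..}. W u \<omega>) \<in> ?K" if "\<omega> \<in> space N - (?B \<union> ?D)" for \<omega>
        by (rule path_in_modulus_compact) (use that W_cont A q in auto)
      ultimately show ?thesis by blast
    qed
    moreover have "?K \<subseteq> extensional {0..}" by (auto simp: modulus_compact_def)
    ultimately show "\<exists>K. compact K \<and> K \<subseteq> extensional {0..} \<and>
        continuous_map (top_of_set K) (compact_convergence_topology {0..}) id \<and>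
        (\<forall>\<^sub>F e in F. \<exists>B\<in>sets M. measure M B \<le> \<delta> \<and> (\<forall>\<omega>\<in>space M - B. (\<lambda>u\<in>{0..}. Y e u \<omega>) \<in> K)) \<and>
        (\<exists>B\<in>sets N. measure N B \<le> \<delta> \<and> (\<forall>\<omega>\<in>space N - B. (\<lambda>u\<in>{0..}. W u \<omega>) \<in> K))"
      using compact_modulus_compact continuous_map_modulus_compact[OF q] by blast
  qed
qed

section \<open>Local asymptotics of the increments\<close>

text \<open>Both envelopes tend to the same \<open>A\<close>, but the factors
  \<open>r - \<rho>\<close> and \<open>r + \<rho>\<close> differ. Since the envelopes do not depend
  on \<open>\<rho>\<close>, it can be chosen small once the target inequality is fixed.\<close>

lemma tendsto_squeeze_family:
  fixes D A1 A2 :: "'a \<Rightarrow> real"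
  assumes r: "0 < r" and bound: "\<And>\<rho>. 0 < \<rho> \<Longrightarrow> \<rho> < r \<Longrightarrow>
      \<forall>\<^sub>F x in F. (r - \<rho>) * A1 x \<le> D x \<and> D x \<le> (r + \<rho>) * A2 x"
    and A1: "(A1 \<longlongrightarrow> A) F" and A2: "(A2 \<longlongrightarrow> A) F"
  shows "(D \<longlongrightarrow> r * A) F"
proof (rule order_tendstoI)
  have small: "\<forall>\<^sub>F \<rho> in at_right 0. 0 < \<rho> \<and> \<rho> < r"
    using eventually_at_right_real[OF r] by (auto elim: eventually_mono)
  fix y assume y: "r * A < y"
  have "((\<lambda>\<rho>. (r + \<rho>) * A) \<longlongrightarrow> (r + 0) * A) (at_right 0)" by (intro tendsto_intros)
  then have "\<forall>\<^sub>F \<rho> in at_right 0. (r + \<rho>) * A < y" using y by (intro order_tendstoD) auto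
  then obtain \<rho> where \<rho>: "0 < \<rho>" "\<rho> < r" "(r + \<rho>) * A < y"
    using eventually_happens'[OF trivial_limit_at_right_real eventually_conj[OF small]] by blast
  have "((\<lambda>x. (r + \<rho>) * A2 x) \<longlongrightarrow> (r + \<rho>) * A) F" by (intro tendsto_intros A2)
  from order_tendstoD(2)[OF this \<rho>(3)] bound[OF \<rho>(1,2)]
  show "\<forall>\<^sub>F x in F. D x < y" by eventually_elim linarith
next
  have small: "\<forall>\<^sub>F \<rho> in at_right 0. 0 < \<rho> \<and> \<rho> < r"
    using eventually_at_right_real[OF r] by (auto elim: eventually_mono)
  fix y assume y: "y < r * A"
  have "((\<lambda>\<rho>. (r - \<rho>) * A) \<longlongrightarrow> (r - 0) * A) (at_right 0)" by (intro tendsto_intros)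
  then have "\<forall>\<^sub>F \<rho> in at_right 0. y < (r - \<rho>) * A" using y by (intro order_tendstoD) auto
  then obtain \<rho> where \<rho>: "0 < \<rho>" "\<rho> < r" "y < (r - \<rho>) * A"
    using eventually_happens'[OF trivial_limit_at_right_real eventually_conj[OF small]] by blast
  have "((\<lambda>x. (r - \<rho>) * A1 x) \<longlongrightarrow> (r - \<rho>) * A) F" by (intro tendsto_intros A1)
  from order_tendstoD(1)[OF this \<rho>(3)] bound[OF \<rho>(1,2)]
  show "\<forall>\<^sub>F x in F. y < D x" by eventually_elim linarith
qed

lemma tendsto_powr_at_right_0:
  assumes "0 < (\<alpha>::real)"
  shows "((\<lambda>x. x powr \<alpha>) \<longlongrightarrow> 0) (at_right 0)"
proof -
  have "\<forall>\<^sub>F x in at_right 0. (0::real) \<le> x"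
    by (rule eventually_mono[OF eventually_at_right_less]) simp
  then show ?thesis
    using assms by (intro tendsto_zero_powrI[OF tendsto_ident_at tendsto_const])
qed

text \<open>This is \<open>ln y \<le> y - 1\<close> at
  \<open>y = x powr (-\<alpha>)\<close>.\<close>

lemma powr_neg_ln_bound:
  assumes "0 < x" "x \<le> 1" "0 < \<alpha>"
  shows "- ln x * x powr \<alpha> \<le> 1 / (\<alpha> :: real)"
proof -
  have "\<alpha> * (- ln x) = ln (x powr (-\<alpha>))" using assms by (simp add: ln_powr)
  also have "\<dots> \<le> x powr (-\<alpha>) - 1" using assms by (intro ln_le_minus_one) simp
  also have "\<dots> \<le> x powr (-\<alpha>)" by simp
  finally have "\<alpha> * (- ln x) * x powr \<alpha> \<le> x powr (-\<alpha>) * x powr \<alpha>"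
    by (intro mult_right_mono) auto
  also have "\<dots> = 1" using assms by (simp add: powr_add[symmetric])
  finally show ?thesis using assms by (simp add: field_simps)
qed

text \<open>Half of the exponent absorbs the logarithm, the other half tends to 0.\<close>

lemma tendsto_powr_ln:
  assumes "0 < (\<alpha>::real)"
  shows "((\<lambda>x. x powr \<alpha> * ln x) \<longlongrightarrow> 0) (at_right 0)"
proof (rule Lim_null_comparison)
  have "\<forall>\<^sub>F x in at_right 0. (0::real) < x \<and> x < 1"
    using eventually_at_right_real[of 0 1] by (auto elim: eventually_mono)
  then show "\<forall>\<^sub>F x in at_right 0. norm (x powr \<alpha> * ln x) \<le> 2 / \<alpha> * x powr (\<alpha> / 2)"
  proof eventually_elim
    case (elim x)
    have "norm (x powr \<alpha> * ln x) = (- ln x * x powr (\<alpha> / 2)) * x powr (\<alpha> / 2)"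
      using elim by (simp add: abs_mult powr_add[symmetric] mult.assoc)
    also have "\<dots> \<le> 1 / (\<alpha> / 2) * x powr (\<alpha> / 2)"
      using elim assms by (intro mult_right_mono powr_neg_ln_bound) auto
    finally show ?case by simp
  qed
  have "((\<lambda>x. x powr (\<alpha> / 2)) \<longlongrightarrow> 0) (at_right 0)"
    using assms by (intro tendsto_powr_at_right_0) simp
  then show "((\<lambda>x. 2 / \<alpha> * x powr (\<alpha> / 2)) \<longlongrightarrow> 0) (at_right 0)"
    using tendsto_mult_right_zero by fastforce
qed

section \<open>Rescaled variances and covariances of the increments\<close>

locale hoelder_hurst_function = hurst_function +
  fixes \<alpha> K :: real
  assumes \<alpha>: "0 < \<alpha>" and K: "0 \<le> K"
    and hoelder: "\<And>x y. \<bar>h x - h y\<bar> \<le> K * \<bar>x - y\<bar> powr \<alpha>"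
begin

text \<open>Bounds the change of \<open>2 * h\<close> within distance \<open>\<epsilon> * u\<close>
  to the right of a base point; the factor 2 is there because the kernel exponent contains
  \<open>h\<close> twice.\<close>

definition deviation :: "real \<Rightarrow> real \<Rightarrow> real" where
  "deviation u \<epsilon> = 2 * K * (\<epsilon> * u) powr \<alpha>"

lemma deviation_nonneg: "0 \<le> deviation u \<epsilon>"
  using K by (simp add: deviation_def)

lemma deviation_bound:
  assumes "0 \<le> t" "0 \<le> v" "0 < \<epsilon>" "\<theta> \<in> {t + \<epsilon> * v<..t + \<epsilon> * u}"
  shows "\<bar>2 * h \<theta> - 2 * h t\<bar> \<le> deviation u \<epsilon>"
proof -
  have "0 \<le> \<epsilon> * v" using assms by simp
  then have "0 \<le> \<theta> - t" "\<theta> - t \<le> \<epsilon> * u" using assms(4) by auto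
  then have "\<bar>\<theta> - t\<bar> powr \<alpha> \<le> (\<epsilon> * u) powr \<alpha>" using \<alpha> by (intro powr_mono2) auto
  then have "K * \<bar>\<theta> - t\<bar> powr \<alpha> \<le> K * (\<epsilon> * u) powr \<alpha>" using K by (rule mult_left_mono)
  then show ?thesis using hoelder[of \<theta> t] by (simp add: deviation_def)
qed

lemma deviation_tendsto:
  assumes "0 < u"
  shows "(deviation u \<longlongrightarrow> 0) (at_right 0)"
    and "((\<lambda>\<epsilon>. \<epsilon> powr (c * deviation u \<epsilon>)) \<longlongrightarrow> 1) (at_right 0)"
proof -
  have pos: "\<forall>\<^sub>F \<epsilon> in at_right 0. (0::real) < \<epsilon>" by (rule eventually_at_right_less)
  have "((\<lambda>\<epsilon>. \<epsilon> powr \<alpha>) \<longlongrightarrow> 0) (at_right 0)"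
    by (rule tendsto_powr_at_right_0[OF \<alpha>])
  from tendsto_mult_right_zero[OF this, of "2 * K * u powr \<alpha>"]
  have "((\<lambda>\<epsilon>. 2 * K * u powr \<alpha> * \<epsilon> powr \<alpha>) \<longlongrightarrow> 0) (at_right 0)" .
  moreover have "\<forall>\<^sub>F \<epsilon> in at_right 0. 2 * K * u powr \<alpha> * \<epsilon> powr \<alpha> = deviation u \<epsilon>"
    using pos assms by (auto elim!: eventually_mono simp: deviation_def powr_mult)
  ultimately show "(deviation u \<longlongrightarrow> 0) (at_right 0)" by (rule Lim_transform_eventually)
  from tendsto_mult_right_zero[OF tendsto_powr_ln[OF \<alpha>], of "c * (2 * K * u powr \<alpha>)"]
  have "((\<lambda>\<epsilon>. exp (c * (2 * K * u powr \<alpha>) * (\<epsilon> powr \<alpha> * ln \<epsilon>))) \<longlongrightarrow> exp 0) (at_right 0)"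
    by (rule tendsto_exp)
  moreover have "\<forall>\<^sub>F \<epsilon> in at_right 0. exp (c * (2 * K * u powr \<alpha>) * (\<epsilon> powr \<alpha> * ln \<epsilon>)) = \<epsilon> powr (c * deviation u \<epsilon>)"
    using pos
  proof eventually_elim
    case (elim \<epsilon>)
    have dev: "deviation u \<epsilon> = 2 * K * u powr \<alpha> * \<epsilon> powr \<alpha>"
      using assms elim by (simp add: deviation_def powr_mult)
    have "\<epsilon> powr (c * deviation u \<epsilon>) = exp (c * deviation u \<epsilon> * ln \<epsilon>)"
      using elim by (simp add: powr_def)
    then show ?case by (simp add: dev mult_ac)
  qed
  ultimately show "((\<lambda>\<epsilon>. \<epsilon> powr (c * deviation u \<epsilon>)) \<longlongrightarrow> 1) (at_right 0)"
    using Lim_transform_eventually by fastforce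
qed

text \<open>On the shrinking square the kernel lies between multiples of powers with exponents
  \<open>2 * H - 2 + \<eta>\<close> and \<open>2 * H - 2 - \<eta>\<close>, where
  \<open>\<eta>\<close> is the deviation. After rescaling, both explicit integrals have the same
  limit.\<close>

lemma increment_variance_limit:
  assumes t: "0 \<le> t" and uv: "0 \<le> v" "v \<le> u"
  shows "((\<lambda>\<epsilon>. box_covariance R h {t + \<epsilon> * v<..t + \<epsilon> * u} {t + \<epsilon> * v<..t + \<epsilon> * u} / \<epsilon> powr (2 * h t))
    \<longlongrightarrow> R (h t) (h t) * (2 * (u - v) powr (2 * h t) / ((2 * h t - 1) * (2 * h t)))) (at_right 0)"
proof (cases "v = u")
  case True
  then show ?thesis by (simp add: box_covariance_def)
next
  case False
  then have "0 < u" "0 < u - v" using uv by auto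
  define H where "H = h t"
  define d where "d = u - v"
  have d: "0 < d" using \<open>0 < u - v\<close> by (simp add: d_def)
  have H: "1 < 2 * H" using h_bounds[of t] by (simp add: H_def)
  let ?\<eta> = "deviation u"
  \<comment> \<open>The integral of the power with exponent
    \<open>2 * H - 2 + s * ?\<eta> \<epsilon>\<close> over a square of side
    \<open>\<epsilon> * d\<close>, divided by \<open>\<epsilon> powr (2 * H)\<close>. The sign
    \<open>s = 1\<close> serves the lower bound, \<open>s = -1\<close> the upper one.\<close>
  define A where "A s \<epsilon> = 2 * d powr (2 * H + s * ?\<eta> \<epsilon>) * \<epsilon> powr (s * ?\<eta> \<epsilon>) /
    ((2 * H - 1 + s * ?\<eta> \<epsilon>) * (2 * H + s * ?\<eta> \<epsilon>))" for s \<epsilon>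
  have A_lim: "(A s \<longlongrightarrow> 2 * d powr (2 * H) / ((2 * H - 1) * (2 * H))) (at_right 0)" for s
  proof -
    have "((\<lambda>\<epsilon>. 2 * d powr (2 * H + s * ?\<eta> \<epsilon>) * \<epsilon> powr (s * ?\<eta> \<epsilon>) /
      ((2 * H - 1 + s * ?\<eta> \<epsilon>) * (2 * H + s * ?\<eta> \<epsilon>))) \<longlongrightarrow>
      2 * d powr (2 * H + s * 0) * 1 / ((2 * H - 1 + s * 0) * (2 * H + s * 0))) (at_right 0)"
      using d H by (intro tendsto_intros deviation_tendsto \<open>0 < u\<close>) auto
    then show ?thesis unfolding A_def[abs_def] by simp
  qed
  let ?D = "\<lambda>\<epsilon>. box_covariance R h {t + \<epsilon> * v<..t + \<epsilon> * u} {t + \<epsilon> * v<..t + \<epsilon> * u} / \<epsilon> powr (2 * H)"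
  have scale: "c * (2 * (t + \<epsilon> * u - (t + \<epsilon> * v)) powr (q + 2) / ((q + 1) * (q + 2))) / \<epsilon> powr (2 * H) = c * A s \<epsilon>"
    if "0 < \<epsilon>" "q = 2 * H - 2 + s * ?\<eta> \<epsilon>" for c q s \<epsilon>
  proof -
    have "(t + \<epsilon> * u - (t + \<epsilon> * v)) powr (q + 2) = (\<epsilon> * d) powr (2 * H + s * ?\<eta> \<epsilon>)"
      using that(2) by (simp add: d_def algebra_simps)
    also have "\<dots> = \<epsilon> powr (2 * H) * \<epsilon> powr (s * ?\<eta> \<epsilon>) * d powr (2 * H + s * ?\<eta> \<epsilon>)"
      using that(1) d by (simp add: powr_mult powr_add)
    finally have base: "(t + \<epsilon> * u - (t + \<epsilon> * v)) powr (q + 2) =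
      \<epsilon> powr (2 * H) * \<epsilon> powr (s * ?\<eta> \<epsilon>) * d powr (2 * H + s * ?\<eta> \<epsilon>)" .
    have q: "q + 1 = 2 * H - 1 + s * ?\<eta> \<epsilon>" "q + 2 = 2 * H + s * ?\<eta> \<epsilon>" using that(2) by auto
    have cancel: "c * (2 * (p * r * z) / w) / p = c * (2 * z * r / w)" if "p \<noteq> 0" for p r z w :: real
      using that by simp
    show ?thesis
      unfolding A_def base[unfolded q] q by (rule cancel) (use that(1) in simp)
  qed
  have "(?D \<longlongrightarrow> R H H * (2 * d powr (2 * H) / ((2 * H - 1) * (2 * H)))) (at_right 0)"
  proof (rule tendsto_squeeze_family[OF _ _ A_lim[of 1] A_lim[of "-1"]])
    show RH: "0 < R H H" using R_pos h_range by (simp add: H_def)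
    fix \<rho> assume \<rho>: "0 < \<rho>" "\<rho> < R H H"
    have "isCont (\<lambda>p. R (h (fst p)) (h (snd p))) (t, t)"
      using continuous_R_h by (simp add: continuous_on_eq_continuous_at)
    then obtain r where r: "0 < r" "\<And>p. dist p (t, t) < r \<Longrightarrow> \<bar>R (h (fst p)) (h (snd p)) - R H H\<bar> < \<rho>"
      using \<rho>(1) unfolding continuous_at_eps_delta by (auto simp: dist_real_def H_def)
    \<comment> \<open>Keeps the smaller exponent \<open>2 * H - 2 - ?\<eta> \<epsilon>\<close> above
      -1.\<close>
    have ev1: "\<forall>\<^sub>F \<epsilon> in at_right 0. ?\<eta> \<epsilon> < 2 * H - 1"
      using H by (intro order_tendstoD(2)[OF deviation_tendsto(1)[OF \<open>0 < u\<close>]]) simp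
    \<comment> \<open>Each coordinate contributes \<open>\<epsilon> * u\<close> to the distance from
      \<open>(t, t)\<close>; a side below 1 makes the powers monotone in the exponent.\<close>
    have "((\<lambda>\<epsilon>. 2 * (\<epsilon> * u)) \<longlongrightarrow> 2 * (0 * u)) (at_right 0)" "((\<lambda>\<epsilon>. \<epsilon> * d) \<longlongrightarrow> 0 * d) (at_right 0)"
      by (intro tendsto_intros)+
    then have ev2: "\<forall>\<^sub>F \<epsilon> in at_right 0. 2 * (\<epsilon> * u) < r" "\<forall>\<^sub>F \<epsilon> in at_right 0. \<epsilon> * d < 1"
      using r(1) by (auto intro: order_tendstoD(2))
    show "\<forall>\<^sub>F \<epsilon> in at_right 0. (R H H - \<rho>) * A 1 \<epsilon> \<le> ?D \<epsilon> \<and> ?D \<epsilon> \<le> (R H H + \<rho>) * A (-1) \<epsilon>"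
      using eventually_at_right_less[of 0] ev1 ev2
    proof eventually_elim
      case (elim \<epsilon>)
      let ?x = "t + \<epsilon> * v" and ?y = "t + \<epsilon> * u"
      have xy: "?x \<le> ?y" "?y - ?x \<le> 1"
        using elim(1,4) uv by (auto simp: d_def algebra_simps)
      have R_near: "\<bar>symm_R R \<theta> \<sigma> (h \<theta>) (h \<sigma>) - R H H\<bar> < \<rho>" if "\<theta> \<in> {?x<..?y}" "\<sigma> \<in> {?x<..?y}" for \<theta> \<sigma>
      proof -
        have "0 \<le> \<epsilon> * v" using elim(1) uv by simp
        then have "\<bar>\<theta> - t\<bar> \<le> \<epsilon> * u" "\<bar>\<sigma> - t\<bar> \<le> \<epsilon> * u" using that by auto
        moreover have "dist (x, y) (t, t) \<le> \<bar>x - t\<bar> + \<bar>y - t\<bar>" for x y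
          unfolding dist_Pair_Pair dist_real_def
          using sqrt_sum_squares_le_sum_abs[of "x - t" "y - t"] by simp
        ultimately have "dist (\<theta>, \<sigma>) (t, t) < r" "dist (\<sigma>, \<theta>) (t, t) < r"
          using elim(3) by (smt (verit))+
        then show ?thesis using r(2)[of "(\<theta>, \<sigma>)"] r(2)[of "(\<sigma>, \<theta>)"] by (simp add: symm_R_def)
      qed
      have dev: "\<bar>2 * h \<theta> - 2 * H\<bar> \<le> ?\<eta> \<epsilon>" if "\<theta> \<in> {?x<..?y}" for \<theta>
        unfolding H_def by (rule deviation_bound[OF t uv(1) elim(1) that])
      have "box_covariance R h {?x<..?y} {?x<..?y} \<le>
          (R H H + \<rho>) * (2 * (?y - ?x) powr ((2 * H - 2 + (-1) * ?\<eta> \<epsilon>) + 2) /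
          (((2 * H - 2 + (-1) * ?\<eta> \<epsilon>) + 1) * ((2 * H - 2 + (-1) * ?\<eta> \<epsilon>) + 2)))"
      proof (rule box_covariance_upper[OF xy])
        show "-1 < 2 * H - 2 + (-1) * ?\<eta> \<epsilon>" using elim(2) by simp
        show "symm_R R \<theta> \<sigma> (h \<theta>) (h \<sigma>) \<le> R H H + \<rho>" if "\<theta> \<in> {?x<..?y}" "\<sigma> \<in> {?x<..?y}" for \<theta> \<sigma>
          using R_near[OF that] by linarith
        show "2 * H - 2 + (-1) * ?\<eta> \<epsilon> \<le> 2 * h \<theta> - 2" if "\<theta> \<in> {?x<..?y}" for \<theta>
          using dev[OF that] by linarith
      qed
      then have "?D \<epsilon> \<le> (R H H + \<rho>) * A (-1) \<epsilon>"
        unfolding scale[OF elim(1) refl, symmetric] by (rule divide_right_mono) simp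
      moreover have "(R H H - \<rho>) * (2 * (?y - ?x) powr ((2 * H - 2 + 1 * ?\<eta> \<epsilon>) + 2) /
          (((2 * H - 2 + 1 * ?\<eta> \<epsilon>) + 1) * ((2 * H - 2 + 1 * ?\<eta> \<epsilon>) + 2))) \<le> box_covariance R h {?x<..?y} {?x<..?y}"
      proof (rule box_covariance_lower[OF xy])
        show "-1 < 2 * H - 2 + 1 * ?\<eta> \<epsilon>" using H deviation_nonneg[of u \<epsilon>] by linarith
        show "R H H - \<rho> \<le> symm_R R \<theta> \<sigma> (h \<theta>) (h \<sigma>)" if "\<theta> \<in> {?x<..?y}" "\<sigma> \<in> {?x<..?y}" for \<theta> \<sigma>
          using R_near[OF that] by linarith
        show "2 * h \<theta> - 2 \<le> 2 * H - 2 + 1 * ?\<eta> \<epsilon>" if "\<theta> \<in> {?x<..?y}" for \<theta>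
          using dev[OF that] by linarith
      qed
      then have "(R H H - \<rho>) * A 1 \<epsilon> \<le> ?D \<epsilon>"
        unfolding scale[OF elim(1) refl, symmetric] by (rule divide_right_mono) simp
      ultimately show ?case by blast
    qed
  qed
  then show ?thesis by (simp add: H_def d_def)
qed

text \<open>Tightness needs a bound uniform in \<open>\<epsilon>\<close> and in the position of the
  increment, with an exponent above 1. The sharp exponent \<open>2 * h t\<close> is given up for
  \<open>2 * a\<close>, and the deviation is absorbed in the constant.\<close>

lemma increment_variance_bound:
  obtains C where "\<And>L. 0 \<le> C L" "\<And>\<epsilon> t u v L. 0 < \<epsilon> \<Longrightarrow> \<epsilon> \<le> 1 \<Longrightarrow> 0 \<le> t \<Longrightarrow> 0 \<le> v \<Longrightarrow> v \<le> u \<Longrightarrow> u \<le> real L \<Longrightarrow>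
    u - v \<le> 1 \<Longrightarrow> box_covariance R h {t + \<epsilon> * v<..t + \<epsilon> * u} {t + \<epsilon> * v<..t + \<epsilon> * u} / \<epsilon> powr (2 * h t) \<le> C L * (u - v) powr (2 * a)"
proof -
  obtain Rm where Rm: "0 < Rm" "\<And>\<theta> \<sigma>. symm_R R \<theta> \<sigma> (h \<theta>) (h \<sigma>) \<le> Rm" using R_bounded by blast
  \<comment> \<open>The fraction bounds \<open>2 / ((q + 1) * (q + 2))\<close>; the exponential
    bounds \<open>\<epsilon>\<close> to the power of minus the deviation, by \<open>- ln \<epsilon>
    * \<epsilon> powr \<alpha> \<le> 1 / \<alpha>\<close>.\<close>
  define C where "C L = Rm * (2 / (2 * a - 1)) * exp (2 * K * real L powr \<alpha> / \<alpha>)" for L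
  show ?thesis
  proof (rule that[of C])
    show "0 \<le> C L" for L using Rm(1) ab by (simp add: C_def)
    fix \<epsilon> t u v :: real and L :: nat
    assume \<epsilon>: "0 < \<epsilon>" "\<epsilon> \<le> 1" and t: "0 \<le> t" and uv: "0 \<le> v" "v \<le> u" "u \<le> real L" "u - v \<le> 1"
    let ?x = "t + \<epsilon> * v" and ?y = "t + \<epsilon> * u"
    define \<eta> where "\<eta> = deviation (real L) \<epsilon>"
    \<comment> \<open>The first entry keeps \<open>q > -1\<close> even when the deviation is large
      and supplies the power of \<open>u - v\<close>; the second supplies the power of
      \<open>\<epsilon>\<close>. Both are admissible lower bounds for
      \<open>2 * h \<theta> - 2\<close>.\<close>
    define q where "q = max (2 * a - 2) (2 * h t - 2 - \<eta>)"
    have diff: "?y - ?x = \<epsilon> * (u - v)" by (simp add: algebra_simps)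
    have xy: "?x \<le> ?y" "?y - ?x \<le> 1"
      using \<epsilon> uv mult_mono[of \<epsilon> 1 "u - v" 1] unfolding diff by (auto intro: mult_left_mono)
    have q: "2 * a - 2 \<le> q" "2 * h t - 2 - \<eta> \<le> q" by (auto simp: q_def)
    have q1: "q + 1 \<ge> 2 * a - 1" "q + 2 \<ge> 1" "q > -1" using q(1) ab by linarith+
    have "deviation u \<epsilon> \<le> \<eta>"
      unfolding \<eta>_def deviation_def using uv \<epsilon> \<alpha> K by (intro mult_left_mono powr_mono2) auto
    then have qh: "q \<le> 2 * h \<theta> - 2" if "\<theta> \<in> {?x<..?y}" for \<theta>
      using deviation_bound[OF t uv(1) \<epsilon>(1) that] h_bounds(1)[of \<theta>] unfolding q_def by auto
    have "box_covariance R h {?x<..?y} {?x<..?y} \<le> Rm * (2 * (?y - ?x) powr (q + 2) / ((q + 1) * (q + 2)))"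
      by (rule box_covariance_upper[OF xy q1(3) Rm(2) qh])
    also have "\<dots> \<le> Rm * (2 * (?y - ?x) powr (q + 2) / ((2 * a - 1) * 1))"
      using Rm(1) ab q1 by (intro mult_left_mono divide_left_mono mult_mono mult_pos_pos) auto
    also have "\<dots> = Rm * (2 / (2 * a - 1)) * (\<epsilon> powr (q + 2) * (u - v) powr (q + 2))"
      unfolding diff using \<epsilon> uv by (simp add: powr_mult)
    also have "\<dots> \<le> Rm * (2 / (2 * a - 1)) * (\<epsilon> powr (2 * h t - \<eta>) * (u - v) powr (2 * a))"
      using Rm(1) ab \<epsilon> uv q by (intro mult_left_mono mult_mono powr_mono') auto
    finally have "box_covariance R h {?x<..?y} {?x<..?y} / \<epsilon> powr (2 * h t) \<le>
        Rm * (2 / (2 * a - 1)) * (\<epsilon> powr (2 * h t - \<eta>) * (u - v) powr (2 * a)) / \<epsilon> powr (2 * h t)"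
      by (rule divide_right_mono) simp
    also have "\<dots> = Rm * (2 / (2 * a - 1)) * \<epsilon> powr (- \<eta>) * (u - v) powr (2 * a)"
    proof -
      have "\<epsilon> powr (2 * h t - \<eta>) = \<epsilon> powr (2 * h t) * \<epsilon> powr (- \<eta>)"
        by (simp add: powr_add[symmetric])
      then show ?thesis using \<epsilon>(1) by simp
    qed
    also have "\<dots> \<le> C L * (u - v) powr (2 * a)"
    proof -
      have "\<epsilon> powr (- \<eta>) = exp (2 * K * real L powr \<alpha> * (- ln \<epsilon> * \<epsilon> powr \<alpha>))"
        unfolding \<eta>_def deviation_def using \<epsilon> by (simp add: powr_def[of \<epsilon> "- _"] powr_mult mult_ac)
      also have "\<dots> \<le> exp (2 * K * real L powr \<alpha> * (1 / \<alpha>))"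
        using \<epsilon> \<alpha> K by (subst exp_le_cancel_iff) (intro mult_left_mono powr_neg_ln_bound, auto)
      finally show ?thesis unfolding C_def using Rm(1) ab by (intro mult_right_mono mult_left_mono) auto
    qed
    finally show "box_covariance R h {?x<..?y} {?x<..?y} / \<epsilon> powr (2 * h t) \<le> C L * (u - v) powr (2 * a)" .
  qed
qed

text \<open>The box has area of order \<open>\<epsilon>\<^sup>2\<close> and the kernel is bounded on
  it, whereas the normalization has exponent \<open>h t + h s < 2\<close>.\<close>

lemma cross_covariance_limit:
  assumes "0 \<le> u" "0 \<le> v" "t \<noteq> s"
  shows "((\<lambda>\<epsilon>. box_covariance R h {t<..t + \<epsilon> * u} {s<..s + \<epsilon> * v} / (\<epsilon> powr h t * \<epsilon> powr h s)) \<longlongrightarrow> 0) (at_right 0)"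
proof -
  obtain C where C: "0 < C" "\<And>\<theta> \<sigma>. symm_R R \<theta> \<sigma> (h \<theta>) (h \<sigma>) \<le> C" using R_bounded by blast
  \<comment> \<open>For small \<open>\<epsilon>\<close> the two intervals use up less than half of
    the distance between \<open>t\<close> and \<open>s\<close>.\<close>
  define \<delta> where "\<delta> = min 1 (\<bar>t - s\<bar> / 2)"
  have \<delta>: "0 < \<delta>" "\<delta> \<le> 1" "\<delta> \<le> \<bar>t - s\<bar> / 2"
    unfolding \<delta>_def using assms(3) by (simp, simp, intro min.cobounded2)
  have "((\<lambda>\<epsilon>. \<epsilon> * (u + v)) \<longlongrightarrow> 0 * (u + v)) (at_right 0)" by (intro tendsto_intros)
  then have "\<forall>\<^sub>F \<epsilon> in at_right 0. \<epsilon> * (u + v) < \<bar>t - s\<bar> / 2"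
    using assms(3) by (intro order_tendstoD(2)) auto
  with eventually_at_right_less[of 0]
  have bound: "\<forall>\<^sub>F \<epsilon> in at_right 0. norm (box_covariance R h {t<..t + \<epsilon> * u} {s<..s + \<epsilon> * v} / (\<epsilon> powr h t * \<epsilon> powr h s)) \<le>
    C / \<delta> * (u * v) * \<epsilon> powr (2 - h t - h s)"
  proof eventually_elim
    case (elim \<epsilon>)
    have eu: "0 \<le> \<epsilon> * u" "0 \<le> \<epsilon> * v" using elim(1) assms by auto
    have "box_covariance R h {t<..t + \<epsilon> * u} {s<..s + \<epsilon> * v} \<le>
        C / \<delta> * ((t + \<epsilon> * u - t) * (s + \<epsilon> * v - s))"
    proof (rule box_covariance_separated[OF C(2) \<delta>(1,2)])
      fix \<theta> \<sigma> assume "\<theta> \<in> {t<..t + \<epsilon> * u}" "\<sigma> \<in> {s<..s + \<epsilon> * v}"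
      then have "\<bar>t - s\<bar> - \<epsilon> * (u + v) \<le> \<bar>\<theta> - \<sigma>\<bar>"
        unfolding distrib_left greaterThanAtMost_iff by linarith
      moreover have "\<delta> \<le> \<bar>t - s\<bar> - \<epsilon> * (u + v)"
        using elim(2) \<delta>(3) by argo
      ultimately show "\<delta> \<le> \<bar>\<theta> - \<sigma>\<bar>" by (rule order_trans[rotated])
    qed (use eu in auto)
    also have "\<dots> = C / \<delta> * (u * v) * \<epsilon> powr 2"
      using elim(1) by (simp add: powr_numeral power2_eq_square)
    finally have "box_covariance R h {t<..t + \<epsilon> * u} {s<..s + \<epsilon> * v} / (\<epsilon> powr h t * \<epsilon> powr h s) \<le>
        C / \<delta> * (u * v) * \<epsilon> powr 2 / (\<epsilon> powr h t * \<epsilon> powr h s)"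
      by (rule divide_right_mono) simp
    also have "\<dots> = C / \<delta> * (u * v) * \<epsilon> powr (2 - h t - h s)"
      using elim(1) by (simp add: powr_diff)
    finally show ?case using box_covariance_nonneg[of "{t<..t + \<epsilon> * u}" "{s<..s + \<epsilon> * v}"] by simp
  qed
  have "2 - h t - h s > 0" using h_bounds[of t] h_bounds[of s] by linarith
  then have "((\<lambda>\<epsilon>. \<epsilon> powr (2 - h t - h s)) \<longlongrightarrow> 0) (at_right 0)"
    by (rule tendsto_powr_at_right_0)
  from tendsto_mult_right_zero[OF this]
  have "((\<lambda>\<epsilon>. C / \<delta> * (u * v) * \<epsilon> powr (2 - h t - h s)) \<longlongrightarrow> 0) (at_right 0)" .
  then show ?thesis by (rule Lim_null_comparison[OF bound])
qed

end

section \<open>The rescaled increments of the process as a Gaussian family\<close>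

lemma square_diff_expectation:
  assumes Y: "centered_gaussian_family M I Y" and "i \<in> I" "j \<in> I"
  shows "(\<integral>\<omega>. (Y i \<omega> - Y j \<omega>)\<^sup>2 \<partial>M) =
    (\<integral>\<omega>. Y i \<omega> * Y i \<omega> \<partial>M) - 2 * (\<integral>\<omega>. Y i \<omega> * Y j \<omega> \<partial>M) + (\<integral>\<omega>. Y j \<omega> * Y j \<omega> \<partial>M)"
proof -
  note int = centered_gaussian_family_integrable[OF Y]
  have "(\<integral>\<omega>. (Y i \<omega> - Y j \<omega>)\<^sup>2 \<partial>M) =
      (\<integral>\<omega>. Y i \<omega> * Y i \<omega> - 2 * (Y i \<omega> * Y j \<omega>) + Y j \<omega> * Y j \<omega> \<partial>M)"
    by (simp add: power2_eq_square algebra_simps)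
  also have "\<dots> = (\<integral>\<omega>. Y i \<omega> * Y i \<omega> \<partial>M) - 2 * (\<integral>\<omega>. Y i \<omega> * Y j \<omega> \<partial>M) + (\<integral>\<omega>. Y j \<omega> * Y j \<omega> \<partial>M)"
    using int assms(2,3) by simp
  finally show ?thesis .
qed

lemma rescaled_increment_gaussian:
  assumes S: "centered_gaussian_family M {0..} S" and \<epsilon>: "0 \<le> \<epsilon>"
  shows "centered_gaussian_family M ({0..} \<times> {0..}) (\<lambda>(t, u). rescaled_increment S h \<epsilon> t u)"
  unfolding centered_gaussian_family_def
proof (intro allI impI, elim conjE)
  fix J :: "(real \<times> real) set" and c
  assume J: "finite J" "J \<subseteq> {0..} \<times> {0..}"
  \<comment> \<open>The boolean selects the endpoint of the increment; endpoints of different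
    increments may coincide.\<close>
  define g :: "(real \<times> real) \<times> bool \<Rightarrow> real" where "g = (\<lambda>((t, u), b). if b then t + \<epsilon> * u else t)"
  define d :: "(real \<times> real) \<times> bool \<Rightarrow> real" where
    "d = (\<lambda>((t, u), b). (if b then c (t, u) else - c (t, u)) / \<epsilon> powr h t)"
  have "centered_gaussian_rv M (\<lambda>\<omega>. \<Sum>k\<in>J \<times> UNIV. d k * S (g k) \<omega>)"
    using J \<epsilon> by (intro centered_gaussian_family_combination[OF S]) (auto simp: g_def)
  moreover have "(\<Sum>k\<in>J \<times> UNIV. d k * S (g k) \<omega>) = (\<Sum>i\<in>J. c i * (case i of (t, u) \<Rightarrow> rescaled_increment S h \<epsilon> t u) \<omega>)" for \<omega>
  proof -
    have "(\<Sum>k\<in>J \<times> UNIV. d k * S (g k) \<omega>) = (\<Sum>i\<in>J. \<Sum>b\<in>UNIV. d (i, b) * S (g (i, b)) \<omega>)"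
      by (simp add: sum.cartesian_product)
    also have "\<dots> = (\<Sum>i\<in>J. c i * (case i of (t, u) \<Rightarrow> rescaled_increment S h \<epsilon> t u) \<omega>)"
      by (intro sum.cong)
        (auto simp: UNIV_bool d_def g_def rescaled_increment_def diff_divide_distrib algebra_simps)
    finally show ?thesis .
  qed
  ultimately show "centered_gaussian_rv M (\<lambda>\<omega>. \<Sum>i\<in>J. c i * (case i of (t, u) \<Rightarrow> rescaled_increment S h \<epsilon> t u) \<omega>)"
    by simp
qed

lemma rescaled_increment_zero [simp]: "rescaled_increment S h \<epsilon> t 0 \<omega> = 0"
  by (simp add: rescaled_increment_def)

locale gaussian_limit_process = hoelder_hurst_function a b h R \<alpha> K
  for a b :: real and h R \<alpha> K +
  fixes M :: "'w measure" and S :: "real \<Rightarrow> 'w \<Rightarrow> real"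
  assumes S_gauss: "centered_gaussian_family M {0..} S"
    and S_cov: "\<And>t s. 0 \<le> t \<Longrightarrow> 0 \<le> s \<Longrightarrow> (\<integral>\<omega>. S t \<omega> * S s \<omega> \<partial>M) = limit_covariance R h t s"
begin

lemma increment_expectation:
  assumes "0 \<le> x" "x \<le> y" "0 \<le> z" "z \<le> w"
  shows "(\<integral>\<omega>. (S y \<omega> - S x \<omega>) * (S w \<omega> - S z \<omega>) \<partial>M) = box_covariance R h {x<..y} {z<..w}"
proof -
  note int = centered_gaussian_family_integrable[OF S_gauss]
  have "(\<integral>\<omega>. (S y \<omega> - S x \<omega>) * (S w \<omega> - S z \<omega>) \<partial>M) =
      (\<integral>\<omega>. S y \<omega> * S w \<omega> - S x \<omega> * S w \<omega> - S y \<omega> * S z \<omega> + S x \<omega> * S z \<omega> \<partial>M)"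
    by (simp add: algebra_simps)
  also have "\<dots> = limit_covariance R h y w - limit_covariance R h x w - limit_covariance R h y z + limit_covariance R h x z"
    using assms int by (simp add: S_cov)
  also have "\<dots> = box_covariance R h {x<..y} {z<..w}" by (rule increment_covariance_box[OF assms])
  finally show ?thesis .
qed

lemma rescaled_increment_covariance:
  assumes "0 < \<epsilon>" "0 \<le> t" "0 \<le> u" "0 \<le> s" "0 \<le> v"
  shows "(\<integral>\<omega>. rescaled_increment S h \<epsilon> t u \<omega> * rescaled_increment S h \<epsilon> s v \<omega> \<partial>M) =
    box_covariance R h {t<..t + \<epsilon> * u} {s<..s + \<epsilon> * v} / (\<epsilon> powr h t * \<epsilon> powr h s)"
proof -
  have "(\<integral>\<omega>. (S (t + \<epsilon> * u) \<omega> - S t \<omega>) * (S (s + \<epsilon> * v) \<omega> - S s \<omega>) \<partial>M) =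
      box_covariance R h {t<..t + \<epsilon> * u} {s<..s + \<epsilon> * v}"
    using assms by (intro increment_expectation) auto
  then show ?thesis by (simp add: rescaled_increment_def)
qed

lemma rescaled_increment_variance:
  assumes "0 < \<epsilon>" "0 \<le> t" "0 \<le> v" "v \<le> u"
  shows "(\<integral>\<omega>. (rescaled_increment S h \<epsilon> t u \<omega> - rescaled_increment S h \<epsilon> t v \<omega>)\<^sup>2 \<partial>M) =
    box_covariance R h {t + \<epsilon> * v<..t + \<epsilon> * u} {t + \<epsilon> * v<..t + \<epsilon> * u} / \<epsilon> powr (2 * h t)"
proof -
  have "(\<integral>\<omega>. (S (t + \<epsilon> * u) \<omega> - S (t + \<epsilon> * v) \<omega>) * (S (t + \<epsilon> * u) \<omega> - S (t + \<epsilon> * v) \<omega>) \<partial>M) =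
      box_covariance R h {t + \<epsilon> * v<..t + \<epsilon> * u} {t + \<epsilon> * v<..t + \<epsilon> * u}"
    using assms by (intro increment_expectation) (auto intro: mult_left_mono)
  moreover have "(rescaled_increment S h \<epsilon> t u \<omega> - rescaled_increment S h \<epsilon> t v \<omega>)\<^sup>2 =
      (S (t + \<epsilon> * u) \<omega> - S (t + \<epsilon> * v) \<omega>) * (S (t + \<epsilon> * u) \<omega> - S (t + \<epsilon> * v) \<omega>) / \<epsilon> powr (2 * h t)" for \<omega>
    by (simp add: rescaled_increment_def diff_divide_distrib[symmetric] power_divide power2_eq_square
        powr_add[symmetric])
  ultimately show ?thesis by simp
qed

lemma rescaled_increment_variance_limit:
  assumes "0 \<le> t" "0 \<le> u" "0 \<le> v"
  shows "((\<lambda>\<epsilon>. \<integral>\<omega>. (rescaled_increment S h \<epsilon> t u \<omega> - rescaled_increment S h \<epsilon> t v \<omega>)\<^sup>2 \<partial>M)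
    \<longlongrightarrow> R (h t) (h t) / (4 * (h t)\<^sup>2 - 2 * h t) * (2 * \<bar>u - v\<bar> powr (2 * h t))) (at_right 0)"
proof -
  have ordered: "((\<lambda>\<epsilon>. \<integral>\<omega>. (rescaled_increment S h \<epsilon> t u \<omega> - rescaled_increment S h \<epsilon> t v \<omega>)\<^sup>2 \<partial>M)
    \<longlongrightarrow> R (h t) (h t) / (4 * (h t)\<^sup>2 - 2 * h t) * (2 * \<bar>u - v\<bar> powr (2 * h t))) (at_right 0)"
    if "0 \<le> v" "v \<le> u" for u v
  proof -
    have "R (h t) (h t) * (2 * (u - v) powr (2 * h t) / ((2 * h t - 1) * (2 * h t))) =
        R (h t) (h t) / (4 * (h t)\<^sup>2 - 2 * h t) * (2 * \<bar>u - v\<bar> powr (2 * h t))"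
      using that by (simp add: power2_eq_square algebra_simps)
    with increment_variance_limit[OF assms(1) that]
    have "((\<lambda>\<epsilon>. box_covariance R h {t + \<epsilon> * v<..t + \<epsilon> * u} {t + \<epsilon> * v<..t + \<epsilon> * u} / \<epsilon> powr (2 * h t)) \<longlongrightarrow>
        R (h t) (h t) / (4 * (h t)\<^sup>2 - 2 * h t) * (2 * \<bar>u - v\<bar> powr (2 * h t))) (at_right 0)" by simp
    moreover have "\<forall>\<^sub>F \<epsilon> in at_right 0. box_covariance R h {t + \<epsilon> * v<..t + \<epsilon> * u} {t + \<epsilon> * v<..t + \<epsilon> * u} / \<epsilon> powr (2 * h t) =
        (\<integral>\<omega>. (rescaled_increment S h \<epsilon> t u \<omega> - rescaled_increment S h \<epsilon> t v \<omega>)\<^sup>2 \<partial>M)"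
      by (rule eventually_mono[OF eventually_at_right_less])
        (simp add: rescaled_increment_variance assms(1) that)
    ultimately show ?thesis by (rule Lim_transform_eventually)
  qed
  show ?thesis
  proof (cases "v \<le> u")
    case True
    then show ?thesis using ordered assms by blast
  next
    case False
    then show ?thesis using ordered[of u v] assms by (simp add: power2_commute abs_minus_commute)
  qed
qed

text \<open>For a common base point this is polarization: the rescaled increment vanishes at 0, so
  \<open>?V \<epsilon> u 0\<close> is a second moment and the three variance limits combine to the
  covariance. For distinct base points the limit is 0.\<close>

lemma rescaled_increment_covariance_limit:
  assumes "0 \<le> t" "0 \<le> u" "0 \<le> s" "0 \<le> v"
  shows "((\<lambda>\<epsilon>. \<integral>\<omega>. rescaled_increment S h \<epsilon> t u \<omega> * rescaled_increment S h \<epsilon> s v \<omega> \<partial>M)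
    \<longlongrightarrow> tangent_covariance R h (t, u) (s, v)) (at_right 0)"
proof (cases "t = s")
  case True
  let ?V = "\<lambda>\<epsilon> u v. \<integral>\<omega>. (rescaled_increment S h \<epsilon> t u \<omega> - rescaled_increment S h \<epsilon> t v \<omega>)\<^sup>2 \<partial>M"
  let ?c = "R (h t) (h t) / (4 * (h t)\<^sup>2 - 2 * h t)"
  have "((\<lambda>\<epsilon>. (?V \<epsilon> u 0 + ?V \<epsilon> v 0 - ?V \<epsilon> u v) / 2) \<longlongrightarrow>
      (?c * (2 * \<bar>u - 0\<bar> powr (2 * h t)) + ?c * (2 * \<bar>v - 0\<bar> powr (2 * h t)) - ?c * (2 * \<bar>u - v\<bar> powr (2 * h t))) / 2) (at_right 0)"
    using assms by (intro tendsto_intros rescaled_increment_variance_limit) auto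
  moreover have "(?c * (2 * \<bar>u - 0\<bar> powr (2 * h t)) + ?c * (2 * \<bar>v - 0\<bar> powr (2 * h t)) - ?c * (2 * \<bar>u - v\<bar> powr (2 * h t))) / 2 =
      tangent_covariance R h (t, u) (s, v)"
  proof -
    have "(c * (2 * x) + c * (2 * y) - c * (2 * z)) / 2 = c * (x + y - z)" for c x y z :: real
      by (simp add: field_simps)
    moreover have "tangent_covariance R h (t, u) (s, v) =
        ?c * (\<bar>u\<bar> powr (2 * h t) + \<bar>v\<bar> powr (2 * h t) - \<bar>u - v\<bar> powr (2 * h t))"
      using True by (simp add: tangent_covariance_def)
    ultimately show ?thesis unfolding diff_zero by presburger
  qed
  moreover have "\<forall>\<^sub>F \<epsilon> in at_right 0. (?V \<epsilon> u 0 + ?V \<epsilon> v 0 - ?V \<epsilon> u v) / 2 =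
      (\<integral>\<omega>. rescaled_increment S h \<epsilon> t u \<omega> * rescaled_increment S h \<epsilon> s v \<omega> \<partial>M)"
  proof (rule eventually_mono[OF eventually_at_right_less])
    fix \<epsilon> :: real assume "0 < \<epsilon>"
    then have "centered_gaussian_family M ({0..} \<times> {0..}) (\<lambda>(t, u). rescaled_increment S h \<epsilon> t u)"
      by (intro rescaled_increment_gaussian S_gauss) simp
    from square_diff_expectation[OF this, of "(t, u)" "(t, v)"] assms True
    show "(?V \<epsilon> u 0 + ?V \<epsilon> v 0 - ?V \<epsilon> u v) / 2 =
      (\<integral>\<omega>. rescaled_increment S h \<epsilon> t u \<omega> * rescaled_increment S h \<epsilon> s v \<omega> \<partial>M)"
      by (simp add: power2_eq_square)
  qed
  ultimately show ?thesis using Lim_transform_eventually by fastforce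
next
  case False
  have "\<forall>\<^sub>F \<epsilon> in at_right 0. box_covariance R h {t<..t + \<epsilon> * u} {s<..s + \<epsilon> * v} / (\<epsilon> powr h t * \<epsilon> powr h s) =
      (\<integral>\<omega>. rescaled_increment S h \<epsilon> t u \<omega> * rescaled_increment S h \<epsilon> s v \<omega> \<partial>M)"
    by (rule eventually_mono[OF eventually_at_right_less])
      (simp add: rescaled_increment_covariance assms)
  from Lim_transform_eventually[OF cross_covariance_limit[OF assms(2,4) False] this]
  show ?thesis using False by (simp add: tangent_covariance_def)
qed

end

text \<open>The excess \<open>2 * a - 1\<close> over the exponent 1 is divided into four equal
  shares: two pay for the squared threshold of chaining and two for summability over the
  levels.\<close>

lemma dyadic_powr:
  fixes a :: real
  shows
  "(1 / 2 ^ n) powr (2 * a) = (2 powr (- (2 * a - 1) / 4)) ^ (4 * n) / 2 ^ n"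
proof -
  let ?c = "- (2 * a - 1) / 4"
  have inv: "1 / 2 ^ n = 2 powr (- real n)"
    by (simp add: powr_minus powr_realpow inverse_eq_divide)
  have "(2 powr ?c) ^ (4 * n) = (2 powr ?c) powr real (4 * n)"
    by (rule powr_realpow[symmetric]) simp
  then have "(2 powr ?c) ^ (4 * n) = 2 powr (?c * real (4 * n))"
    by (simp only: powr_powr)
  then have "(2 powr ?c) ^ (4 * n) / 2 ^ n = 2 powr (?c * real (4 * n)) * 2 powr (- real n)"
    unfolding inv[symmetric] by simp
  also have "\<dots> = 2 powr (- real n * (2 * a))"
  proof -
    have "?c * real (4 * n) + - real n = - real n * (2 * a)" by (simp add: field_simps)
    then show ?thesis by (simp only: powr_add[symmetric])
  qed
  also have "\<dots> = (1 / 2 ^ n) powr (2 * a)"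
    unfolding inv powr_powr ..
  finally show ?thesis ..
qed

theorem proposition1:
  fixes a b :: real
    and h :: "real \<Rightarrow> real"
    and R :: "real \<Rightarrow> real \<Rightarrow> real"
    and P :: "'x measure" and X :: "nat \<Rightarrow> real \<Rightarrow> 'x \<Rightarrow> real"
    and M :: "'w measure" and S :: "real \<Rightarrow> 'w \<Rightarrow> real"
    and Q :: "'v measure" and T :: "real \<Rightarrow> real \<Rightarrow> 'v \<Rightarrow> real"
  assumes ab: "1/2 < a" "a \<le> b" "b < 1"
    and h_cont: "continuous_on UNIV h"
    and h_range: "\<And>x. h x \<in> {a..b}"
    and R_cont: "continuous_on ({a..b} \<times> {a..b}) (\<lambda>(H1, H2). R H1 H2)"
    and R_pos: "\<And>H1 H2. H1 \<in> {a..b} \<Longrightarrow> H2 \<in> {a..b} \<Longrightarrow> 0 < R H1 H2"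
    and P_prob: "prob_space P"
    and X_gauss: "centered_gaussian_family P (UNIV \<times> {1/2<..<1}) (\<lambda>(n, H). X n H)"
    and X_bounded: "\<And>m::real. 0 < m \<Longrightarrow>
      bounded ((\<lambda>(j, k, H1, H2). \<integral>\<omega>. X j H1 \<omega> * X k H2 \<omega> \<partial>P) `
        {(j, k, H1, H2). \<bar>real j - real k\<bar> \<le> m \<and> H1 \<in> {a..b} \<and> H2 \<in> {a..b}})"
    and X_limit:
      "((\<lambda>(j, k). SUP (H1, H2) \<in> {a..b} \<times> {a..b}.
            \<bar>(real j - real k) powr (2 - H1 - H2) * (\<integral>\<omega>. X j H1 \<omega> * X k H2 \<omega> \<partial>P) - R H1 H2\<bar>)
          \<longlongrightarrow> 0) (filtercomap (\<lambda>(j, k). real j - real k) at_top)"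
    and M_prob: "prob_space M"
    and S_limit: "converges_fdd {0..} P (partial_sum_process X h) M S sequentially"
    and S_gauss: "centered_gaussian_family M {0..} S"
    and S_cov: "\<And>t s. 0 \<le> t \<Longrightarrow> 0 \<le> s \<Longrightarrow> (\<integral>\<omega>. S t \<omega> * S s \<omega> \<partial>M) = limit_covariance R h t s"
    and S_cont: "\<And>\<omega>. \<omega> \<in> space M \<Longrightarrow> continuous_on {0..} (\<lambda>t. S t \<omega>)"
    and h_holder: "holder_continuous_on UNIV h"
    and Q_prob: "prob_space Q"
    and T_gauss: "centered_gaussian_family Q ({0..} \<times> {0..}) (\<lambda>(t, u). T t u)"
    and T_cov: "\<And>t u s v. 0 \<le> t \<Longrightarrow> 0 \<le> u \<Longrightarrow> 0 \<le> s \<Longrightarrow> 0 \<le> v \<Longrightarrow>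
      (\<integral>\<omega>. T t u \<omega> * T s v \<omega> \<partial>Q) = tangent_covariance R h (t, u) (s, v)"
  shows "converges_fdd ({0..} \<times> {0..}) M (\<lambda>\<epsilon> (t, u). rescaled_increment S h \<epsilon> t u)
           Q (\<lambda>(t, u). T t u) (at_right 0) \<and>
         (\<forall>t\<ge>0.
           is_fBm Q (h t) (T t) \<and>
           (\<integral>\<omega>. (T t 1 \<omega>)\<^sup>2 \<partial>Q) = R (h t) (h t) / (2 * (h t)\<^sup>2 - h t) \<and>
           (\<exists>W. is_modification Q {0..} W (T t) \<and>
                (\<forall>\<omega>\<in>space Q. continuous_on {0..} (\<lambda>u. W u \<omega>)) \<and>
                converges_in_distribution (compact_convergence_topology {0..})
                  M (\<lambda>\<epsilon> \<omega>. \<lambda>u\<in>{0..}. rescaled_increment S h \<epsilon> t u \<omega>)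
                  Q (\<lambda>\<omega>. \<lambda>u\<in>{0..}. W u \<omega>) (at_right 0)))"
proof -
  obtain \<alpha> K where hoelder: "0 < \<alpha>" "0 \<le> K" "\<And>x y. \<bar>h x - h y\<bar> \<le> K * \<bar>x - y\<bar> powr \<alpha>"
    using h_holder unfolding holder_continuous_on_def dist_real_def by blast
  interpret gaussian_limit_process a b h R \<alpha> K M S
    by standard (fact ab h_cont h_range R_cont R_pos hoelder S_gauss S_cov)+
  have Y_gauss: "\<forall>\<^sub>F \<epsilon> in at_right 0. centered_gaussian_family M ({0..} \<times> {0..}) (\<lambda>(t, u). rescaled_increment S h \<epsilon> t u)"
    by (rule eventually_mono[OF eventually_at_right_less]) (simp add: rescaled_increment_gaussian S_gauss)
  have fdd: "converges_fdd ({0..} \<times> {0..}) M (\<lambda>\<epsilon> (t, u). rescaled_increment S h \<epsilon> t u)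
      Q (\<lambda>(t, u). T t u) (at_right 0)"
    by (rule gaussian_converges_fdd[OF M_prob Q_prob Y_gauss T_gauss])
      (auto simp: T_cov intro: rescaled_increment_covariance_limit)
  obtain C0 where C0: "\<And>L. 0 \<le> C0 L" "\<And>\<epsilon> t u v L. 0 < \<epsilon> \<Longrightarrow> \<epsilon> \<le> 1 \<Longrightarrow> 0 \<le> t \<Longrightarrow> 0 \<le> v \<Longrightarrow> v \<le> u \<Longrightarrow> u \<le> real L \<Longrightarrow>
    u - v \<le> 1 \<Longrightarrow> box_covariance R h {t + \<epsilon> * v<..t + \<epsilon> * u} {t + \<epsilon> * v<..t + \<epsilon> * u} / \<epsilon> powr (2 * h t) \<le> C0 L * (u - v) powr (2 * a)"
    using increment_variance_bound by blast
  define q where "q = 2 powr (- (2 * a - 1) / 4)"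
  have q: "0 < q" "q < 1" using ab by (auto simp: q_def powr_less_one)
  have "is_fBm Q (h t) (T t) \<and>
      (\<integral>\<omega>. (T t 1 \<omega>)\<^sup>2 \<partial>Q) = R (h t) (h t) / (2 * (h t)\<^sup>2 - h t) \<and>
      (\<exists>W. is_modification Q {0..} W (T t) \<and>
        (\<forall>\<omega>\<in>space Q. continuous_on {0..} (\<lambda>u. W u \<omega>)) \<and>
        converges_in_distribution (compact_convergence_topology {0..})
          M (\<lambda>\<epsilon> \<omega>. \<lambda>u\<in>{0..}. rescaled_increment S h \<epsilon> t u \<omega>)
          Q (\<lambda>\<omega>. \<lambda>u\<in>{0..}. W u \<omega>) (at_right 0))" if t: "0 \<le> t" for t
  proof -
    define H where "H = h t"
    define c where "c = R H H / (4 * H\<^sup>2 - 2 * H)"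
    have H: "1/2 < H" "H < 1" "a \<le> H" using h_bounds[of t] by (auto simp: H_def)
    have "0 < 2 * H * (2 * H - 1)" using H by simp
    then have "0 < 4 * H\<^sup>2 - 2 * H" by (simp add: power2_eq_square algebra_simps)
    then have c: "0 < c" using R_pos[OF h_range h_range, of t t] by (simp add: c_def H_def)
    have T_t_gauss: "centered_gaussian_family Q {0..} (T t)"
      using centered_gaussian_family_reindex[OF T_gauss, of "{0..}" "\<lambda>u. (t, u)"] t by simp
    have T_t_cov: "(\<integral>\<omega>. T t u \<omega> * T t v \<omega> \<partial>Q) = c * (\<bar>u\<bar> powr (2 * H) + \<bar>v\<bar> powr (2 * H) - \<bar>u - v\<bar> powr (2 * H))"
      if "0 \<le> u" "0 \<le> v" for u v
      using T_cov[OF t that(1) t that(2)] by (simp add: tangent_covariance_def c_def H_def)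
    have T1: "(\<integral>\<omega>. (T t 1 \<omega>)\<^sup>2 \<partial>Q) = 2 * c"
      using T_t_cov[of 1 1] by (simp add: power2_eq_square)
    have fBm: "is_fBm Q (h t) (T t)"
      unfolding is_fBm_def T1 using T_t_gauss T_t_cov H by (auto simp: H_def)
    have T1': "(\<integral>\<omega>. (T t 1 \<omega>)\<^sup>2 \<partial>Q) = R (h t) (h t) / (2 * (h t)\<^sup>2 - h t)"
    proof -
      have "4 * H\<^sup>2 - 2 * H = 2 * (2 * H\<^sup>2 - H)" by simp
      then have c': "c = R H H / (2 * (2 * H\<^sup>2 - H))" by (simp only: c_def)
      have "2 * (x / (2 * y)) = x / y" for x y :: real by simp
      then have "2 * c = R H H / (2 * H\<^sup>2 - H)" unfolding c' .
      then show ?thesis unfolding T1 H_def .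
    qed
    have T_increment: "(\<integral>\<omega>. (T t u \<omega> - T t v \<omega>)\<^sup>2 \<partial>Q) = 2 * c * \<bar>u - v\<bar> powr (2 * H)" if "0 \<le> u" "0 \<le> v" for u v
      using square_diff_expectation[OF T_t_gauss, of u v] T_t_cov that by (simp add: algebra_simps)
    \<comment> \<open>One constant for both processes: \<open>C0 L\<close> for the rescaled
      increments, \<open>2 * c\<close> for the limit, whose exponent \<open>2 * H\<close> is at
      least \<open>2 * a\<close>.\<close>
    define C where "C L = C0 L + 2 * c" for L
    have C: "0 \<le> C L" for L using C0(1)[of L] c by (simp add: C_def)
    have step: "real (Suc k) / 2 ^ n - real k / 2 ^ n = 1 / 2 ^ n" for k n
      by (simp add: diff_divide_distrib[symmetric])
    have dy: "(1 / 2 ^ n) powr (2 * a) = q ^ (4 * n) / 2 ^ n" for n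
      unfolding q_def by (rule dyadic_powr)
    have T_bound: "(\<integral>\<omega>. (T t (real (Suc k) / 2 ^ n) \<omega> - T t (real k / 2 ^ n) \<omega>)\<^sup>2 \<partial>Q) \<le> C L * q ^ (4 * n) / 2 ^ n" for L n k
    proof -
      have "(\<integral>\<omega>. (T t (real (Suc k) / 2 ^ n) \<omega> - T t (real k / 2 ^ n) \<omega>)\<^sup>2 \<partial>Q) = 2 * c * (1 / 2 ^ n) powr (2 * H)"
        by (subst T_increment) (simp_all add: step del: of_nat_Suc)
      also have "\<dots> \<le> C L * (1 / 2 ^ n) powr (2 * a)"
        using c C0(1)[of L] H ab by (intro mult_mono powr_mono') (auto simp: C_def)
      finally show ?thesis by (simp add: dy)
    qed
    have Y_bound: "\<forall>\<^sub>F \<epsilon> in at_right 0. \<forall>L n k. k < L * 2 ^ n \<longrightarrow>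
      (\<integral>\<omega>. (rescaled_increment S h \<epsilon> t (real (Suc k) / 2 ^ n) \<omega> - rescaled_increment S h \<epsilon> t (real k / 2 ^ n) \<omega>)\<^sup>2 \<partial>M)
        \<le> C L * q ^ (4 * n) / 2 ^ n"
      using eventually_at_right_real[of 0 1, OF zero_less_one]
    proof (eventually_elim, intro allI impI)
      fix \<epsilon> :: real and L n k :: nat
      assume \<epsilon>: "\<epsilon> \<in> {0<..<1}" and k: "k < L * 2 ^ n"
      have "real (Suc k) \<le> real (L * 2 ^ n)" using k by (simp only: of_nat_le_iff Suc_le_eq)
      then have kL: "real (Suc k) / 2 ^ n \<le> real L" by (simp add: divide_le_eq)
      have le: "real k / 2 ^ n \<le> real (Suc k) / 2 ^ n" by (intro divide_right_mono) auto
      have "(\<integral>\<omega>. (rescaled_increment S h \<epsilon> t (real (Suc k) / 2 ^ n) \<omega> - rescaled_increment S h \<epsilon> t (real k / 2 ^ n) \<omega>)\<^sup>2 \<partial>M)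
          \<le> C0 L * (1 / 2 ^ n) powr (2 * a)"
        using C0(2)[of \<epsilon> t "real k / 2 ^ n" "real (Suc k) / 2 ^ n" L] \<epsilon> t le kL
        unfolding step by (subst rescaled_increment_variance) auto
      also have "\<dots> \<le> C L * (1 / 2 ^ n) powr (2 * a)"
        using c by (intro mult_right_mono) (auto simp: C_def)
      finally show "(\<integral>\<omega>. (rescaled_increment S h \<epsilon> t (real (Suc k) / 2 ^ n) \<omega> - rescaled_increment S h \<epsilon> t (real k / 2 ^ n) \<omega>)\<^sup>2 \<partial>M)
          \<le> C L * q ^ (4 * n) / 2 ^ n" by (simp add: dy)
    qed
    have mean_square: "(\<lambda>m. \<integral>\<omega>. (T t (dyadic_floor m u) \<omega> - T t u \<omega>)\<^sup>2 \<partial>Q) \<longlonglongrightarrow> 0" if u: "0 \<le> u" for u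
    proof -
      have "(\<lambda>m. \<bar>dyadic_floor m u - u\<bar>) \<longlonglongrightarrow> \<bar>u - u\<bar>"
        by (intro tendsto_intros dyadic_floor_tendsto u)
      then have "(\<lambda>m. \<bar>dyadic_floor m u - u\<bar> powr (2 * H)) \<longlonglongrightarrow> 0"
        using H by (intro tendsto_zero_powrI[OF _ tendsto_const]) auto
      from tendsto_mult_right_zero[OF this, of "2 * c"] show ?thesis
        using u by (simp add: T_increment)
    qed
    have T_meas: "T t u \<in> borel_measurable Q" if "0 \<le> u" for u
      using that by (intro centered_gaussian_rv_measurable centered_gaussian_family_member[OF T_t_gauss]) simp
    have T_int: "integrable Q (\<lambda>\<omega>. (T t u \<omega> - T t v \<omega>)\<^sup>2)" if "0 \<le> u" "0 \<le> v" for u v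
      using that by (intro centered_gaussian_family_increment_integrable[OF T_t_gauss]) auto
    obtain W where W: "is_modification Q {0..} W (T t)" "\<And>\<omega>. \<omega> \<in> space Q \<Longrightarrow> continuous_on {0..} (\<lambda>u. W u \<omega>)"
      using continuous_modification[OF Q_prob T_meas q C T_int T_bound mean_square] by blast
    have "converges_in_distribution (compact_convergence_topology {0..})
        M (\<lambda>\<epsilon> \<omega>. \<lambda>u\<in>{0..}. rescaled_increment S h \<epsilon> t u \<omega>) Q (\<lambda>\<omega>. \<lambda>u\<in>{0..}. W u \<omega>) (at_right 0)"
    proof (rule gaussian_process_convergence[OF M_prob Q_prob _ T_t_gauss _ _ _ q C Y_bound T_bound W])
      show "\<forall>\<^sub>F \<epsilon> in at_right 0. centered_gaussian_family M {0..} (rescaled_increment S h \<epsilon> t)"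
        using Y_gauss
      proof eventually_elim
        case (elim \<epsilon>)
        from centered_gaussian_family_reindex[OF this, of "{0..}" "\<lambda>u. (t, u)"] t show ?case by simp
      qed
      show "((\<lambda>\<epsilon>. \<integral>\<omega>. rescaled_increment S h \<epsilon> t u \<omega> * rescaled_increment S h \<epsilon> t v \<omega> \<partial>M) \<longlongrightarrow>
          (\<integral>\<omega>. T t u \<omega> * T t v \<omega> \<partial>Q)) (at_right 0)" if "0 \<le> u" "0 \<le> v" for u v
        unfolding T_cov[OF t that(1) t that(2)] by (rule rescaled_increment_covariance_limit[OF t that(1) t that(2)])
      show "\<forall>\<^sub>F \<epsilon> in at_right 0. \<forall>\<omega>\<in>space M. continuous_on {0..} (\<lambda>u. rescaled_increment S h \<epsilon> t u \<omega>) \<and>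
          rescaled_increment S h \<epsilon> t 0 \<omega> = 0"
      proof (rule eventually_mono[OF eventually_at_right_less], intro ballI conjI)
        fix \<epsilon> :: real and \<omega> assume "0 < \<epsilon>" "\<omega> \<in> space M"
        have "continuous_on {0..} (\<lambda>u. S (t + \<epsilon> * u) \<omega>)"
          using \<open>0 < \<epsilon>\<close> t by (intro continuous_on_compose2[OF S_cont[OF \<open>\<omega> \<in> space M\<close>]] continuous_intros) auto
        then show "continuous_on {0..} (\<lambda>u. rescaled_increment S h \<epsilon> t u \<omega>)"
          unfolding rescaled_increment_def using \<open>0 < \<epsilon>\<close> by (intro continuous_intros) auto
      qed simp
      show "(\<integral>\<omega>. (T t 0 \<omega>)\<^sup>2 \<partial>Q) = 0"
        using T_t_cov[of 0 0] by (simp add: power2_eq_square)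
    qed
    then show ?thesis using fBm T1' W by blast
  qed
  with fdd show ?thesis by blast
qed

end
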